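(* (Affine Fertility Formula) For every $v\in\widetilde S_n$, $$\lvert\widetilde{\mathtt s}^{-1}(v)\rvert=\sum_{\mathcal H\in\mathrm{AVHC}(v)}C_{\mathbf q^{\mathcal H}} .$$
   Context: An affine permutation of size $n$ is a bijection $w:\mathbb Z\to\mathbb Z$ with $w(i+n)=w(i)+n$ for all $i\in\mathbb Z$ and $\sum_{i=1}^n w(i)=\binom{n+1}{2}$. They form the affine symmetric group $\widetilde S_n$ under composition (trivial if $n=1$), a Coxeter group with simple generators $\widetilde s_1,\ldots,\widetilde s_n$, where $\widetilde s_i$ swaps $i+mn$ and $i+mn+1$ for all $m\in\mathbb Z$ and fixes all other integers. The left weak order is $x\leq_L y\iff\ell(yx^{-1})=\ell(y)-\ell(x)$, $\ell$ being Coxeter length. Affine sylvester congruence. For $w\in\widetilde S_n$ define a partial order $\preceq_w$ on $\mathbb Z$ (positions): for $i<j$, the positions $i,j$ are incomparable if and only if there is $k$ with $i<k<j$ and $w(k)>\max\{w(i),w(j)\}$; otherwise the position with the smaller value of $w$ is below the other. (This is the descendant order of the decreasing affine binary plane tree with in-order reading $w$.) The affine sylvester congruence is $v\equiv_{\widetilde{\mathrm{syl}}}w\iff{\preceq_v}={\preceq_w}$; it is a semilattice congruence on $(\widetilde S_n,\leq_L)$ in which $\{e\}$ is a class, and each class has a unique $\leq_L$-minimal element. Let $\pi_\downarrow(w)$ be the minimal element of the class of $w$. The affine stack-sorting map is $\widetilde{\mathtt s}:\widetilde S_n\to\widetilde S_n$, $\widetilde{\mathtt s}(w)=w\,(\pi_\downarrow(w))^{-1}$.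 Valid hook configurations. Let $z=z(1)\cdots z(N)$ be a finite permutation (a word of distinct integers) with plot $\{(i,z(i))\}$. A hook of $z$ joins points $(i,z(i))$ (southwest endpoint) and $(j,z(j))$ (northeast endpoint) with $i<j$, $z(i)<z(j)$; it consists of the vertical segment from $(i,z(i))$ up to $(i,z(j))$ followed by the horizontal segment from $(i,z(j))$ to $(j,z(j))$. If the descents of $z$ (indices $d$ with $z(d)>z(d+1)$) are $d_1<\cdots<d_k$, a valid hook configuration of $z$ is a tuple $(H_1,\ldots,H_k)$ of hooks such that: (1) the southwest endpoint of $H_i$ is $(d_i,z(d_i))$ for each $i$; (2) no point of the plot lies directly above a hook; (3) no two hooks intersect or overlap, except that the northeast endpoint of one may be the southwest endpoint of another. $\mathrm{VHC}(z)$ is the set of these. For $\mathcal H=(H_1,\dots,H_k)\in\mathrm{VHC}(z)$, color each point of the plot that is not a northeast endpoint of a hook: the point looks vertically upward (a southwest endpoint of a hook looks around the left side of that hook, so it ignores it) and gets the color of the first hook it sees, or blue if it sees none. Let $q_i$ be the number of points colored with the color of $H_i$, $q_0$ the number of blue points, and $\mathbf q^{\mathcal H}=(q_0,\ldots,q_k)$. The empty permutation has exactly one (empty) valid hook configuration, whose $\mathbf q$ is the empty composition. For a tuple $\mathbf q$ of nonnegative integers, $C_{\mathbf q}$ is the product over its parts $q$ of the Catalan numbers $C_q=\frac1{q+1}\binom{2q}{q}$ (empty product $=1$). Affine valid hook configurations. Let $v\in\widetilde S_n$. A left-to-right maximum of $v$ is an integer $m$ larger than every integer to its left in the word $\cdots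 v(0)v(1)v(2)\cdots$. $\mathrm{Sky}(v)$ is the collection of nonempty $n$-periodic (i.e. invariant under translation by $\pm n$) subsets of the set of left-to-right maxima of $v$. Write $\mathscr M\in\mathrm{Sky}(v)$ as $\{\cdots<m_0<m_1<m_2<\cdots\}$ with $v^{-1}(m_1)\le1<v^{-1}(m_2)$, let $r(\mathscr M)$ be the positive integer with $m_{j+r(\mathscr M)}=m_j+n$ for all $j$, and let $z_i^{\mathscr M}$ be the (possibly empty) permutation formed by the entries of $v$ strictly between $m_i$ and $m_{i+1}$. An affine valid hook configuration $\mathcal H$ of $v$ consists of some $\mathscr M\in\mathrm{Sky}(v)$ (giving the "skyline" of hooks joining $(v^{-1}(m_i),m_i)$ to $(v^{-1}(m_{i+1}),m_{i+1})$ for all $i$) together with a choice of $\mathcal H_i\in\mathrm{VHC}(z_i^{\mathscr M})$ for $1\le i\le r(\mathscr M)$ (repeated periodically). $\mathrm{AVHC}(v)$ is the set of these, and $\mathbf q^{\mathcal H}$ is the concatenation of $\mathbf q^{\mathcal H_1},\ldots,\mathbf q^{\mathcal H_{r(\mathscr M)}}$. *)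

theory Defs
  imports Complex_Main "HOL-Library.FuncSet"
begin

section \<open>The affine symmetric group and the left weak order\<close>

definition affine_perms :: "nat \<Rightarrow> (int \<Rightarrow> int) set" where
  "affine_perms n = {w. bij w \<and> (\<forall>i. w (i + int n) = w i + int n) \<and>
     (\<Sum>i = 1..int n. w i) = int ((n + 1) choose 2)}"

definition affine_simple :: "nat \<Rightarrow> int \<Rightarrow> int \<Rightarrow> int" where
  "affine_simple n i x =
     (if x mod int n = i mod int n then x + 1
      else if x mod int n = (i + 1) mod int n then x - 1
      else x)"

text \<open>For \<open>n = 1\<close> the group is trivial and there are no generators (the formula for
  \<open>affine_simple\<close> describes a product of transpositions only if \<open>n \<ge> 2\<close>).\<close>

definition affine_gens :: "nat \<Rightarrow> (int \<Rightarrow> int) set" where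
  "affine_gens n = (if n \<ge> 2 then affine_simple n ` {1..int n} else {})"

definition coxeter_length :: "nat \<Rightarrow> (int \<Rightarrow> int) \<Rightarrow> nat" where
  "coxeter_length n w =
     (LEAST k. \<exists>ss. length ss = k \<and> set ss \<subseteq> affine_gens n \<and> w = foldr (\<circ>) ss id)"

definition left_weak_le :: "nat \<Rightarrow> (int \<Rightarrow> int) \<Rightarrow> (int \<Rightarrow> int) \<Rightarrow> bool" where
  "left_weak_le n x y \<longleftrightarrow>
     int (coxeter_length n (y \<circ> inv x)) = int (coxeter_length n y) - int (coxeter_length n x)"


section \<open>The affine sylvester congruence and affine stack-sorting\<close>

definition descendant_le :: "(int \<Rightarrow> int) \<Rightarrow> int \<Rightarrow> int \<Rightarrow> bool" where
  "descendant_le w i j \<longleftrightarrow>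
     i = j \<or>
     (w i < w j \<and> \<not> (\<exists>k. min i j < k \<and> k < max i j \<and> max (w i) (w j) < w k))"

definition affine_sylvester :: "(int \<Rightarrow> int) \<Rightarrow> (int \<Rightarrow> int) \<Rightarrow> bool" where
  "affine_sylvester v w \<longleftrightarrow> descendant_le v = descendant_le w"

definition sylvester_class :: "nat \<Rightarrow> (int \<Rightarrow> int) \<Rightarrow> (int \<Rightarrow> int) set" where
  "sylvester_class n w = {u \<in> affine_perms n. affine_sylvester u w}"

definition pi_down :: "nat \<Rightarrow> (int \<Rightarrow> int) \<Rightarrow> int \<Rightarrow> int" where
  "pi_down n w = (THE u. u \<in> sylvester_class n w \<and>
     (\<forall>x \<in> sylvester_class n w. left_weak_le n x u \<longrightarrow> x = u))"

definition affine_stack_sort :: "nat \<Rightarrow> (int \<Rightarrow> int) \<Rightarrow> int \<Rightarrow> int" where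
  "affine_stack_sort n w = w \<circ> inv (pi_down n w)"


section \<open>Valid hook configurations of finite words\<close>

text \<open>A finite permutation is a list \<open>z\<close> of distinct integers, with positions numbered from
  \<open>0\<close>. A hook is recorded as the pair of positions of its southwest and northeast endpoints;
  \<open>hook_points\<close> is the corresponding subset of the plane.\<close>

type_synonym hook = "nat \<times> nat"

definition plot_point :: "int list \<Rightarrow> nat \<Rightarrow> real \<times> real" where
  "plot_point z p = (real p, real_of_int (z ! p))"

definition is_hook :: "int list \<Rightarrow> hook \<Rightarrow> bool" where
  "is_hook z H \<longleftrightarrow> fst H < snd H \<and> snd H < length z \<and> z ! fst H < z ! snd H"

definition hook_points :: "int list \<Rightarrow> hook \<Rightarrow> (real \<times> real) set" where
  "hook_points z H =
     {real (fst H)} \<times> {real_of_int (z ! fst H)..real_of_int (z ! snd H)} \<union>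
     {real (fst H)..real (snd H)} \<times> {real_of_int (z ! snd H)}"

definition descents :: "int list \<Rightarrow> nat list" where
  "descents z = filter (\<lambda>d. z ! d > z ! (d + 1)) [0..<length z - 1]"

definition VHC :: "int list \<Rightarrow> hook list set" where
  "VHC z = {hs.
     map fst hs = descents z \<and>
     (\<forall>H \<in> set hs. is_hook z H) \<and>
     (\<forall>H \<in> set hs. \<forall>p < length z. \<forall>y.
        (real p, y) \<in> hook_points z H \<longrightarrow> \<not> y < real_of_int (z ! p)) \<and>
     (\<forall>a < length hs. \<forall>b < length hs. a \<noteq> b \<longrightarrow>
        (\<forall>P \<in> hook_points z (hs ! a) \<inter> hook_points z (hs ! b).
           (P = plot_point z (snd (hs ! a)) \<and> P = plot_point z (fst (hs ! b))) \<or>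
           (P = plot_point z (snd (hs ! b)) \<and> P = plot_point z (fst (hs ! a)))))}"

text \<open>\<open>sees z hs p a y\<close>: looking upward from the point at position \<open>p\<close>, one meets the
  \<open>a\<close>-th hook (counted from \<open>0\<close>) at height \<open>y\<close>. A point that is itself a southwest endpoint
  does not see its own hook. Colour \<open>0\<close> is blue and colour \<open>a + 1\<close> is that of \<open>hs ! a\<close>.\<close>

definition sees :: "int list \<Rightarrow> hook list \<Rightarrow> nat \<Rightarrow> nat \<Rightarrow> real \<Rightarrow> bool" where
  "sees z hs p a y \<longleftrightarrow> a < length hs \<and> fst (hs ! a) \<noteq> p \<and>
     real_of_int (z ! p) < y \<and> (real p, y) \<in> hook_points z (hs ! a)"

definition point_color :: "int list \<Rightarrow> hook list \<Rightarrow> nat \<Rightarrow> nat" where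
  "point_color z hs p =
     (if \<exists>a y. sees z hs p a y
      then Suc (THE a. \<exists>y. sees z hs p a y \<and> (\<forall>b y'. sees z hs p b y' \<longrightarrow> y \<le> y'))
      else 0)"

definition q_comp :: "int list \<Rightarrow> hook list \<Rightarrow> nat list" where
  "q_comp z hs =
     (if z = [] then []
      else map (\<lambda>c. card {p. p < length z \<and> p \<notin> snd ` set hs \<and> point_color z hs p = c})
             [0..<Suc (length hs)])"

text \<open>The division is exact.\<close>

definition catalan :: "nat \<Rightarrow> nat" where
  "catalan q = ((2 * q) choose q) div (q + 1)"

definition catalan_prod :: "nat list \<Rightarrow> nat" where
  "catalan_prod qs = prod_list (map catalan qs)"


section \<open>Affine valid hook configurations\<close>

definition ltr_maxima :: "(int \<Rightarrow> int) \<Rightarrow> int set" where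
  "ltr_maxima v = {m. \<forall>i < inv v m. v i < m}"

definition Sky :: "nat \<Rightarrow> (int \<Rightarrow> int) \<Rightarrow> int set set" where
  "Sky n v = {M. M \<noteq> {} \<and> M \<subseteq> ltr_maxima v \<and> (\<lambda>m. m + int n) ` M = M}"

definition sky_enum :: "(int \<Rightarrow> int) \<Rightarrow> int set \<Rightarrow> int \<Rightarrow> int" where
  "sky_enum v M = (THE m. strict_mono m \<and> range m = M \<and> inv v (m 1) \<le> 1 \<and> 1 < inv v (m 2))"

definition sky_period :: "nat \<Rightarrow> (int \<Rightarrow> int) \<Rightarrow> int set \<Rightarrow> nat" where
  "sky_period n v M =
     (THE r. 0 < r \<and> (\<forall>j. sky_enum v M (j + int r) = sky_enum v M j + int n))"

definition sky_word :: "(int \<Rightarrow> int) \<Rightarrow> int set \<Rightarrow> nat \<Rightarrow> int list" where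
  "sky_word v M i =
     map v [inv v (sky_enum v M (int i)) + 1 .. inv v (sky_enum v M (int i + 1)) - 1]"

definition AVHC :: "nat \<Rightarrow> (int \<Rightarrow> int) \<Rightarrow> (int set \<times> (nat \<Rightarrow> hook list)) set" where
  "AVHC n v = (SIGMA M : Sky n v. \<Pi>\<^sub>E i \<in> {1..sky_period n v M}. VHC (sky_word v M i))"

definition affine_q :: "nat \<Rightarrow> (int \<Rightarrow> int) \<Rightarrow> int set \<times> (nat \<Rightarrow> hook list) \<Rightarrow> nat list" where
  "affine_q n v A =
     concat (map (\<lambda>i. q_comp (sky_word v (fst A) i) (snd A i)) [1..<Suc (sky_period n v (fst A))])"

end

theory Submission
  imports Defs "HOL-Computational_Algebra.Formal_Power_Series"
begin

text \<open>
  The permutation \<open>\<pi>\<^sub>\<down>(w)\<close> numbers the nodes of the decreasing tree of \<open>w\<close>, which are the positions,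
  in postorder. Hence \<open>w\<close> is sorted to \<open>v\<close> iff \<open>v\<^sup>-\<^sup>1 w\<close> is this numbering. The left-to-right maxima
  \<open>\<dots> < m\<^sub>i < m\<^sub>i\<^sub>+\<^sub>1 < \<dots>\<close> of such a \<open>w\<close> form a skyline \<open>\<M>\<close> of \<open>v\<close>, and \<open>w\<close> is obtained from \<open>v\<close> by
  replacing, for each \<open>i\<close>, the factor \<open>z\<^sub>i m\<^sub>i\<^sub>+\<^sub>1\<close> of \<open>v\<close> by \<open>m\<^sub>i\<^sub>+\<^sub>1 x\<^sub>i\<close>, where the finite word \<open>x\<^sub>i\<close> is
  stack-sorted to \<open>z\<^sub>i\<close>; the words \<open>x\<^sub>1, \<dots>, x\<^sub>r\<close> can be chosen independently. Hence the fiber is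
  a sum over skylines of products of finite fertilities.

  The finite fertility formula holds because both sides vanish unless the last entry is the maximum,
  in which case both satisfy the recursion over all ways to cut the remaining word in two. For
  the hook side, the cuts at ascents come from splitting the blue points by the Catalan
  recurrence, and the cuts at descents come from the hook that ends at the last point.
\<close>

section \<open>Catalan numbers\<close>

text \<open>The two sides of the finite formula decompose at opposite ends. A stack-sorted word ends
  with its maximum, so \<open>sorts\<close> recurses at the right end, whereas a hook configuration
  is taken apart at its left end, where the first position is either blue or the start of a hook.
  Peeling a blue point off on the left changes the weight \<phi> into
  \<open>\<phi> \<circ> Suc\<close>, so an induction with the weight fixed to \<open>catalan\<close>
  would not close.

  The affine tree has no root. The left-to-right maxima form its bi-infinite spine:
  \<open>m i\<close> is the left child of \<open>m (i + 1)\<close>, and the right subtree of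
  \<open>m (i + 1)\<close> is visited just between the two, which explains why each factor is
  rotated. Postorder fixes only the relative order of the numbers; their offset comes from the
  normalized sum over a period. For lack of a root the numbering is not built by recursion but found
  as the class member with the fewest inversions. Since \<open>pi_down\<close> is defined by Coxeter
  length, length must first be identified with the number of inversions modulo translation.\<close>

lemma catalan_mult_Suc: "(q + 1) * catalan q = (2 * q) choose q"
proof -
  \<comment> \<open>The quotient is the difference of the binomials of \<open>2 * q\<close> over
    \<open>q\<close> and over \<open>Suc q\<close>, hence an integer.\<close>
  have "Suc q * ((2 * q) choose Suc q) = q * ((2 * q) choose q)"
    using binomial_absorb_comp[of "2 * q" q] binomial_absorption[of q "2 * q"]
    by (metis add_diff_cancel_right' mult_2)
  then have "(2 * q) choose q = (q + 1) * (((2 * q) choose q) - ((2 * q) choose Suc q))"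
    by (simp add: diff_mult_distrib2)
  then have "(q + 1) dvd ((2 * q) choose q)"
    by (metis dvd_triv_left)
  then show ?thesis
    unfolding catalan_def by (rule dvd_mult_div_cancel)
qed

lemma catalan_0 [simp]: "catalan 0 = 1"
  by (simp add: catalan_def)

text \<open>Absorption twice, from row \<open>2 * q + 2\<close> to row \<open>2 * q + 1\<close> and
  from there to row \<open>2 * q\<close>. To stay within the natural numbers both sides carry the
  factor \<open>q + 1\<close> twice, cancelled at the end.\<close>

lemma catalan_ratio: "(q + 2) * catalan (Suc q) = 2 * (2 * q + 1) * catalan q"
proof -
  have a: "Suc q * (Suc (Suc (2 * q)) choose Suc q) = Suc (Suc (2 * q)) * (Suc (2 * q) choose q)"
    by (metis Suc_times_binomial_eq mult.commute)
  have b: "Suc q * (Suc (2 * q) choose q) = Suc (2 * q) * ((2 * q) choose q)"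
  proof -
    have "Suc (2 * q) choose q = Suc (2 * q) choose Suc q"
      by (subst binomial_symmetric) auto
    then show ?thesis
      by (metis Suc_times_binomial_eq mult.commute)
  qed
  have "(q + 1) * ((q + 1) * ((q + 2) * catalan (Suc q)))
      = (q + 1) * (Suc q * (Suc (Suc (2 * q)) choose Suc q))"
    using catalan_mult_Suc[of "Suc q"] by (simp add: algebra_simps)
  also have "\<dots> = Suc (Suc (2 * q)) * (Suc q * (Suc (2 * q) choose q))"
    unfolding a by (simp only: Suc_eq_plus1 mult_ac)
  also have "\<dots> = Suc (Suc (2 * q)) * (Suc (2 * q) * ((q + 1) * catalan q))"
    by (simp only: b catalan_mult_Suc)
  also have "\<dots> = (q + 1) * ((q + 1) * (2 * (2 * q + 1) * catalan q))"
    by (simp add: algebra_simps)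
  finally show ?thesis
    by (simp only: mult_cancel1) simp
qed

text \<open>These are the coefficients of the square root of \<open>1 + x\<close> after the constant
  one. Their successive ratio \<open>(1 / 2 - k) / (k + 1)\<close> agrees with
  \<open>catalan_ratio\<close>.\<close>

lemma half_gchoose_Suc:
  "(1 / 2 :: real) gchoose Suc q = (- 1) ^ q * 2 * real (catalan q) / 4 ^ Suc q"
proof (induction q)
  case 0
  show ?case by simp
next
  case (Suc q)
  have r: "(real q + 2) * real (catalan (Suc q)) = 2 * (2 * real q + 1) * real (catalan q)"
    using arg_cong[OF catalan_ratio[of q], of real] by (simp add: algebra_simps)
  have "real (Suc (Suc q)) * ((1 / 2 :: real) gchoose Suc (Suc q))
      = (1 / 2 - real (Suc q)) * ((1 / 2) gchoose Suc q)"
    using gbinomial_absorb_comp[of "1/2::real" "Suc q"] gbinomial_absorption[of "Suc q" "1/2::real"]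
    by simp
  also have "\<dots> = (1 / 2 - real (Suc q)) * ((- 1) ^ q * 2 * real (catalan q) / 4 ^ Suc q)"
    using Suc by simp
  also have "\<dots> = (- 1) ^ Suc q * 2 * (2 * (2 * real q + 1) * real (catalan q)) / 4 ^ Suc (Suc q)"
    by (simp add: field_simps)
  also have "\<dots> = (- 1) ^ Suc q * 2 * ((real q + 2) * real (catalan (Suc q))) / 4 ^ Suc (Suc q)"
    by (simp only: r)
  also have "\<dots> = real (Suc (Suc q)) * ((- 1) ^ Suc q * 2 * real (catalan (Suc q)) / 4 ^ Suc (Suc q))"
    by (simp add: add.commute)
  finally show ?case
    by (simp only: mult_cancel_left of_nat_eq_0_iff) simp
qed

text \<open>The generating function of the Catalan numbers is \<open>(1 - \<surd>(1 - 4x)) / (2x)\<close>, so the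
  convolution identity is Vandermonde's identity for the exponents \<open>1/2 + 1/2\<close>.\<close>

lemma catalan_Suc: "catalan (Suc q) = (\<Sum>i\<le>q. catalan i * catalan (q - i))"
proof -
  define g where "g k = (1 / 2 :: real) gchoose k" for k
  have "(\<Sum>k\<le>Suc (Suc q). g k * g (Suc (Suc q) - k)) = (1 :: real) gchoose (Suc (Suc q))"
    unfolding g_def using gbinomial_Vandermonde[of "1/2::real" "1/2" "Suc (Suc q)"]
    by (simp add: atMost_atLeast0)
  also have "(1 :: real) gchoose (Suc (Suc q)) = 0"
    using binomial_gbinomial[of 1 "Suc (Suc q)", where ?'a = real] by simp
  finally have "(\<Sum>k\<le>Suc (Suc q). g k * g (Suc (Suc q) - k)) = 0" .
  \<comment> \<open>The two extreme terms carry the coefficient sought; the middle terms are the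
    Catalan convolution up to a sign and a power of 4 that do not depend on
    \<open>i\<close>.\<close>
  moreover have "(\<Sum>k\<le>Suc (Suc q). g k * g (Suc (Suc q) - k))
      = 2 * g (Suc (Suc q)) + (\<Sum>i\<le>q. g (Suc i) * g (Suc (q - i)))"
    unfolding sum.atMost_Suc_shift[of _ "Suc q"]
    by (simp add: g_def Suc_diff_le)
  ultimately have "2 * g (Suc (Suc q)) + (\<Sum>i\<le>q. g (Suc i) * g (Suc (q - i))) = 0"
    by simp
  moreover have "(\<Sum>i\<le>q. g (Suc i) * g (Suc (q - i)))
      = (\<Sum>i\<le>q. ((- 1) ^ q * 4 / 4 ^ Suc (Suc q)) * (real (catalan i) * real (catalan (q - i))))"
  proof (rule sum.cong[OF refl])
    fix i assume "i \<in> {..q}"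
    then have "(- 1 :: real) ^ q = (- 1) ^ i * (- 1) ^ (q - i)"
      "(4 :: real) ^ Suc (Suc q) = 4 ^ Suc i * 4 ^ Suc (q - i)"
      by (simp_all flip: power_add power_Suc)
    then show "g (Suc i) * g (Suc (q - i))
        = ((- 1) ^ q * 4 / 4 ^ Suc (Suc q)) * (real (catalan i) * real (catalan (q - i)))"
      by (simp only: g_def half_gchoose_Suc) simp
  qed
  ultimately have "real (catalan (Suc q)) = (\<Sum>i\<le>q. real (catalan i) * real (catalan (q - i)))"
    by (simp add: g_def half_gchoose_Suc flip: sum_distrib_left sum_divide_distrib)
  then have "real (catalan (Suc q)) = real (\<Sum>i\<le>q. catalan i * catalan (q - i))"
    by simp
  then show ?thesis
    by (simp only: of_nat_eq_iff)
qed

section \<open>Hook configurations on an interval of positions\<close>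

text \<open>The content of a valid hook configuration, freed of lists and plane geometry
  (\<open>VHC_iff\<close>): the strict maximum at \<open>e\<close> expresses that no point lies
  above a hook, and nesting expresses disjointness. The strict \<open>d' < e\<close> leaves a hook
  that starts at the end of another one unrestricted.\<close>

definition hook_confs :: "(nat \<Rightarrow> int) \<Rightarrow> nat \<Rightarrow> nat \<Rightarrow> (nat \<times> nat) set set" where
  "hook_confs z a b = {E.
     (\<forall>d e. (d, e) \<in> E \<longrightarrow> a \<le> d \<and> d < e \<and> e < b \<and> (\<forall>p\<in>{d..<e}. z p < z e)) \<and>
     (\<forall>d. (\<exists>e. (d, e) \<in> E) \<longleftrightarrow> a \<le> d \<and> Suc d < b \<and> z (Suc d) < z d) \<and>
     (\<forall>d e e'. (d, e) \<in> E \<longrightarrow> (d, e') \<in> E \<longrightarrow> e = e') \<and>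
     (\<forall>d e d' e'. (d, e) \<in> E \<longrightarrow> (d', e') \<in> E \<longrightarrow> d < d' \<longrightarrow> d' < e \<longrightarrow> e' < e)}"

text \<open>One notion for all colours: the whole interval yields the blue points, and
  \<open>{Suc d..<e}\<close> yields the points coloured by the hook \<open>(d, e)\<close>. The
  condition \<open>a \<le> d\<close> makes hooks that start further left invisible, in particular
  \<open>(d, e)\<close> itself and the hooks around it.\<close>

definition free_points :: "(nat \<times> nat) set \<Rightarrow> nat \<Rightarrow> nat \<Rightarrow> nat set" where
  "free_points E a b =
     {p \<in> {a..<b}. p \<notin> snd ` E \<and> \<not> (\<exists>d e. (d, e) \<in> E \<and> a \<le> d \<and> d < p \<and> p < e)}"

text \<open>The weight \<open>\<phi>\<close> of the number of blue points is left arbitrary for the sake of the recursions;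
  \<open>\<phi> = catalan\<close> gives \<open>C\<^sub>q\<close>.\<close>

definition conf_weight :: "(nat \<Rightarrow> nat) \<Rightarrow> nat \<Rightarrow> nat \<Rightarrow> (nat \<times> nat) set \<Rightarrow> nat" where
  "conf_weight \<phi> a b E =
     \<phi> (card (free_points E a b)) * (\<Prod>(d, e)\<in>E. catalan (card (free_points E (Suc d) e)))"

definition conf_sum :: "(nat \<Rightarrow> int) \<Rightarrow> (nat \<Rightarrow> nat) \<Rightarrow> nat \<Rightarrow> nat \<Rightarrow> nat" where
  "conf_sum z \<phi> a b = (\<Sum>E\<in>hook_confs z a b. conf_weight \<phi> a b E)"

definition hook_ends :: "(nat \<Rightarrow> int) \<Rightarrow> nat \<Rightarrow> nat \<Rightarrow> nat set" where
  "hook_ends z a b = {e. a < e \<and> e < b \<and> (\<forall>p\<in>{a..<e}. z p < z e)}"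

lemma free_points_iff:
  "p \<in> free_points E a b \<longleftrightarrow> a \<le> p \<and> p < b \<and> (\<forall>d. (d, p) \<notin> E) \<and>
     (\<forall>d e. (d, e) \<in> E \<longrightarrow> a \<le> d \<longrightarrow> d < p \<longrightarrow> e \<le> p)"
proof -
  have "p \<in> snd ` E \<longleftrightarrow> (\<exists>d. (d, p) \<in> E)"
    by force
  then show ?thesis
    unfolding free_points_def mem_Collect_eq atLeastLessThan_iff by (meson not_less)
qed

lemma finite_free_points [simp]: "finite (free_points E a b)"
  by (simp add: free_points_def)

lemma finite_hook_ends [simp]: "finite (hook_ends z a b)"
  by (rule finite_subset[of _ "{..<b}"]) (auto simp: hook_ends_def)

lemma hook_conf_edgeD:
  assumes "E \<in> hook_confs z a b" "(d, e) \<in> E"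
  shows "a \<le> d" "d < e" "e < b" "\<And>p. d \<le> p \<Longrightarrow> p < e \<Longrightarrow> z p < z e" "z (Suc d) < z d" "Suc d < e"
proof -
  show 1: "a \<le> d" "d < e" "e < b" "\<And>p. d \<le> p \<Longrightarrow> p < e \<Longrightarrow> z p < z e"
    using assms unfolding hook_confs_def by auto
  show 2: "z (Suc d) < z d"
    using assms unfolding hook_confs_def by blast
  show "Suc d < e"
    using 1(2) 1(4)[of d] 2 by (cases "Suc d = e") auto
qed

lemma hook_conf_descent:
  assumes "E \<in> hook_confs z a b"
  shows "(\<exists>e. (d, e) \<in> E) \<longleftrightarrow> a \<le> d \<and> Suc d < b \<and> z (Suc d) < z d"
  using assms unfolding hook_confs_def by blast

lemma hook_conf_unique:
  assumes "E \<in> hook_confs z a b" "(d, e) \<in> E" "(d, e') \<in> E"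
  shows "e = e'"
  using assms unfolding hook_confs_def by blast

lemma hook_conf_nested:
  assumes "E \<in> hook_confs z a b" "(d, e) \<in> E" "(d', e') \<in> E" "d < d'" "d' < e"
  shows "e' < e"
  using assms unfolding hook_confs_def by blast

lemma hook_confsI:
  assumes "\<And>d e. (d, e) \<in> E \<Longrightarrow> a \<le> d \<and> d < e \<and> e < b"
    and "\<And>d e p. (d, e) \<in> E \<Longrightarrow> d \<le> p \<Longrightarrow> p < e \<Longrightarrow> z p < z e"
    and "\<And>d. a \<le> d \<Longrightarrow> Suc d < b \<Longrightarrow> z (Suc d) < z d \<Longrightarrow> \<exists>e. (d, e) \<in> E"
    and "\<And>d e. (d, e) \<in> E \<Longrightarrow> z (Suc d) < z d"
    and "\<And>d e e'. (d, e) \<in> E \<Longrightarrow> (d, e') \<in> E \<Longrightarrow> e = e'"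
    and "\<And>d e d' e'. (d, e) \<in> E \<Longrightarrow> (d', e') \<in> E \<Longrightarrow> d < d' \<Longrightarrow> d' < e \<Longrightarrow> e' < e"
  shows "E \<in> hook_confs z a b"
proof -
  have "(\<exists>e. (d, e) \<in> E) \<longleftrightarrow> a \<le> d \<and> Suc d < b \<and> z (Suc d) < z d" for d
    using assms(1,3,4) by (metis Suc_leI le_less_trans)
  then show ?thesis
    unfolding hook_confs_def using assms by auto
qed

lemma hook_confs_subset: "E \<in> hook_confs z a b \<Longrightarrow> E \<subseteq> {a..<b} \<times> {a..<b}"
proof (rule subrelI)
  fix d e assume "E \<in> hook_confs z a b" "(d, e) \<in> E"
  note D = hook_conf_edgeD(1-3)[OF this]
  show "(d, e) \<in> {a..<b} \<times> {a..<b}"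
    using D by simp
qed

lemma finite_conf: "E \<in> hook_confs z a b \<Longrightarrow> finite E"
  by (rule finite_subset[OF hook_confs_subset]) simp_all

lemma finite_hook_confs [simp]: "finite (hook_confs z a b)"
  by (rule finite_subset[of _ "Pow ({a..<b} \<times> {a..<b})"]) (use hook_confs_subset in blast, simp)

section \<open>Recursion at the left end of the interval\<close>

lemma conf_sum_empty:
  assumes "b \<le> a"
  shows "conf_sum z \<phi> a b = \<phi> 0"
proof -
  have "hook_confs z a b = {{}}"
  proof (intro equalityI subsetI)
    fix E assume "E \<in> hook_confs z a b"
    then show "E \<in> {{}}"
      using hook_confs_subset[of E z a b] assms by auto
  qed (use assms in \<open>auto simp: hook_confs_def\<close>)
  then show ?thesis
    using assms by (simp add: conf_sum_def conf_weight_def free_points_def)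
qed

text \<open>Without a descent at \<open>a\<close> no hook starts there, and none can end at the
  first position. So \<open>a\<close> is blue, and \<open>\<phi> \<circ> Suc\<close> records it
  after its removal.\<close>

lemma conf_sum_ascent:
  assumes "a < b" "\<not> (Suc a < b \<and> z (Suc a) < z a)"
  shows "conf_sum z \<phi> a b = conf_sum z (\<phi> \<circ> Suc) (Suc a) b"
proof -
  have eq: "hook_confs z a b = hook_confs z (Suc a) b"
  proof (intro set_eqI iffI)
    fix E assume E: "E \<in> hook_confs z a b"
    have a: "(a, e) \<notin> E" for e
      using hook_conf_descent[OF E, of a] assms by auto
    show "E \<in> hook_confs z (Suc a) b"
    proof (rule hook_confsI)
      show "Suc a \<le> d \<and> d < e \<and> e < b" if "(d, e) \<in> E" for d e
        using hook_conf_edgeD(1-3)[OF E that] that a[of e] by (cases "d = a") auto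
      show "\<exists>e. (d, e) \<in> E" if "Suc a \<le> d" "Suc d < b" "z (Suc d) < z d" for d
        using hook_conf_descent[OF E, of d] that by simp
    qed (use hook_conf_edgeD(4,5)[OF E] hook_conf_unique[OF E] hook_conf_nested[OF E] in blast)+
  next
    fix E assume E: "E \<in> hook_confs z (Suc a) b"
    show "E \<in> hook_confs z a b"
    proof (rule hook_confsI)
      show "a \<le> d \<and> d < e \<and> e < b" if "(d, e) \<in> E" for d e
        using hook_conf_edgeD(1-3)[OF E that] by simp
      show "\<exists>e. (d, e) \<in> E" if "a \<le> d" "Suc d < b" "z (Suc d) < z d" for d
        using hook_conf_descent[OF E, of d] assms that by (cases "d = a") auto
    qed (use hook_conf_edgeD(4,5)[OF E] hook_conf_unique[OF E] hook_conf_nested[OF E] in blast)+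
  qed
  have "conf_weight \<phi> a b E = conf_weight (\<phi> \<circ> Suc) (Suc a) b E"
    if E: "E \<in> hook_confs z (Suc a) b" for E
  proof -
    have "free_points E a b = insert a (free_points E (Suc a) b)"
    proof (intro set_eqI)
      fix p
      have "(d, a) \<notin> E" "(d, y) \<in> E \<longrightarrow> \<not> d < Suc a" for d y
        using hook_conf_edgeD(1,2)[OF E, of d] by fastforce+
      then show "p \<in> free_points E a b \<longleftrightarrow> p \<in> insert a (free_points E (Suc a) b)"
        using assms(1) by (cases "p = a") (auto simp: free_points_iff; fastforce)+
    qed
    moreover have "a \<notin> free_points E (Suc a) b" "finite (free_points E (Suc a) b)"
      by (auto simp: free_points_def)
    ultimately show ?thesis
      by (simp add: conf_weight_def)
  qed
  then show ?thesis
    unfolding conf_sum_def eq by (intro sum.cong) auto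
qed

text \<open>The position \<open>e\<close> belongs to the outer piece \<open>E1\<close> and is only
  the right boundary of the inner piece \<open>E2\<close>: a further hook may start at
  \<open>e\<close>, but no inner hook may end there.\<close>

lemma hook_confs_join:
  assumes e: "e \<in> hook_ends z a b" and desc: "z (Suc a) < z a"
    and E1: "E1 \<in> hook_confs z e b" and E2: "E2 \<in> hook_confs z (Suc a) e"
  shows "insert (a, e) (E1 \<union> E2) \<in> hook_confs z a b"
proof -
  note D1 = hook_conf_edgeD[OF E1] and D2 = hook_conf_edgeD[OF E2]
  have e': "a < e" "e < b" "\<And>p. a \<le> p \<Longrightarrow> p < e \<Longrightarrow> z p < z e"
    using e by (auto simp: hook_ends_def)
  show ?thesis
  proof (rule hook_confsI)
    show "a \<le> d \<and> d < e' \<and> e' < b" if "(d, e') \<in> insert (a, e) (E1 \<union> E2)" for d e'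
      using that D1(1-3)[of d e'] D2(1-3)[of d e'] e' by auto
    show "z p < z e'" if "(d, e') \<in> insert (a, e) (E1 \<union> E2)" "d \<le> p" "p < e'" for d e' p
      using that D1(4)[of d e'] D2(4)[of d e'] e' by auto
    show "z (Suc d) < z d" if "(d, e') \<in> insert (a, e) (E1 \<union> E2)" for d e'
      using that D1(5)[of d e'] D2(5)[of d e'] desc by auto
    show "\<exists>e'. (d, e') \<in> insert (a, e) (E1 \<union> E2)" if h: "a \<le> d" "Suc d < b" "z (Suc d) < z d" for d
    proof -
      have "d = a \<or> d \<ge> Suc a \<and> Suc d < e \<or> Suc d = e \<or> d \<ge> e"
        using h(1) by linarith
      then consider "d = a" | "d \<ge> Suc a" "Suc d < e" | "Suc d = e" | "d \<ge> e"
        by blast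
      then show ?thesis
      proof cases
        \<comment> \<open>The position just before \<open>e\<close> lies in neither piece as a
          possible descent. It is none, because \<open>z e\<close> exceeds everything under the
          hook.\<close>
        case 3
        then have "z d < z e" using e'(3)[of d] h(1) by simp
        then show ?thesis using 3 h(3) by simp
      qed (use hook_conf_descent[OF E1, of d] hook_conf_descent[OF E2, of d] h in auto)
    qed
    show "e1 = e2" if "(d, e1) \<in> insert (a, e) (E1 \<union> E2)" "(d, e2) \<in> insert (a, e) (E1 \<union> E2)"
      for d e1 e2
      using that D1(1)[of d] D2(1-3)[of d] e'(1) hook_conf_unique[OF E1, of d]
        hook_conf_unique[OF E2, of d]
      by (auto; fastforce)
    show "e2 < e1" if h: "(d1, e1) \<in> insert (a, e) (E1 \<union> E2)" "(d2, e2) \<in> insert (a, e) (E1 \<union> E2)"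
      "d1 < d2" "d2 < e1" for d1 e1 d2 e2
    proof -
      consider "d1 = a \<and> e1 = e" | "(d1, e1) \<in> E1" | "(d1, e1) \<in> E2" using h(1) by blast
      then show ?thesis
      proof cases
        case 1
        then have "(d2, e2) \<in> E2" using h D1(1)[of d2 e2] by auto
        then show ?thesis using D2(3) 1 by auto
      next
        case 2
        then have "e \<le> d1" "(d2, e2) \<in> E1"
          using h D1(1)[of d1 e1] D2(2,3)[of d2 e2] e'(1) by auto
        then show ?thesis using hook_conf_nested[OF E1 2] h by blast
      next
        case 3
        then have "(d2, e2) \<in> E2"
          using h D1(1)[of d2 e2] D2(1,2,3)[of d1 e1] by auto
        then show ?thesis using hook_conf_nested[OF E2 3] h by blast
      qed
    qed
  qed
qed

text \<open>By nesting, a hook that starts strictly under \<open>(a, e)\<close> ends before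
  \<open>e\<close>. Hence sorting the remaining hooks by their starting points already yields two
  complete configurations.\<close>

lemma hook_confs_split:
  assumes E: "E \<in> hook_confs z a b" and ae: "(a, e) \<in> E"
  defines "E1 \<equiv> {h \<in> E. e \<le> fst h}" and "E2 \<equiv> {h \<in> E. a < fst h \<and> fst h < e}"
  shows "e \<in> hook_ends z a b" "E1 \<in> hook_confs z e b" "E2 \<in> hook_confs z (Suc a) e"
    "E = insert (a, e) (E1 \<union> E2)"
proof -
  note D = hook_conf_edgeD[OF E] and U = hook_conf_unique[OF E] and N = hook_conf_nested[OF E]
  note De = hook_conf_descent[OF E]
  have e': "a < e" "e < b" "\<And>p. a \<le> p \<Longrightarrow> p < e \<Longrightarrow> z p < z e"
    using D[OF ae] by auto
  show "e \<in> hook_ends z a b"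
    using e' by (auto simp: hook_ends_def)
  show "E1 \<in> hook_confs z e b"
  proof (rule hook_confsI)
    show "\<exists>e'. (d, e') \<in> E1" if "e \<le> d" "Suc d < b" "z (Suc d) < z d" for d
      using De[of d] that e'(1) by (auto simp: E1_def)
  qed (use D U N in \<open>auto simp: E1_def\<close>)
  show "E2 \<in> hook_confs z (Suc a) e"
  proof (rule hook_confsI)
    show "\<exists>e'. (d, e') \<in> E2" if "Suc a \<le> d" "Suc d < e" "z (Suc d) < z d" for d
      using De[of d] that e' by (auto simp: E2_def)
    show "Suc a \<le> d \<and> d < e' \<and> e' < e" if "(d, e') \<in> E2" for d e'
      using D[of d e'] N[OF ae, of d e'] that by (auto simp: E2_def)
  qed (use D U N in \<open>auto simp: E2_def\<close>)
  show "E = insert (a, e) (E1 \<union> E2)"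
  proof -
    have "h \<in> insert (a, e) (E1 \<union> E2)" if "h \<in> E" for h
    proof (cases h)
      case (Pair d e')
      then have "d = a \<or> a < d" using D(1)[of d e'] that by auto
      then show ?thesis using Pair that U[OF ae, of e'] by (auto simp: E1_def E2_def)
    qed
    then show ?thesis using ae by (auto simp: E1_def E2_def)
  qed
qed

text \<open>The number of blue points is that of the outer piece: there \<open>e\<close> is blue as
  its first position, while in the joined configuration \<open>e\<close> is a northeast endpoint and
  \<open>a\<close> is blue instead. The blue points of the inner piece take the colour of
  \<open>(a, e)\<close>, hence its weight \<open>catalan\<close>.\<close>

lemma conf_weight_join:
  assumes e: "e \<in> hook_ends z a b"
    and E1: "E1 \<in> hook_confs z e b" and E2: "E2 \<in> hook_confs z (Suc a) e"
  shows "conf_weight \<phi> a b (insert (a, e) (E1 \<union> E2))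
    = conf_weight \<phi> e b E1 * conf_weight catalan (Suc a) e E2"
proof -
  define E where "E = insert (a, e) (E1 \<union> E2)"
  have e': "a < e" "e < b" using e by (auto simp: hook_ends_def)
  have K1: "e \<le> d \<and> d < y" if "(d, y) \<in> E1" for d y
    using hook_conf_edgeD(1,2)[OF E1 that] by simp
  have K2: "Suc a \<le> d \<and> d < y \<and> y < e" if "(d, y) \<in> E2" for d y
    using hook_conf_edgeD(1-3)[OF E2 that] by simp
  have E_iff: "(d, y) \<in> E \<longleftrightarrow> d = a \<and> y = e \<or> (d, y) \<in> E1 \<or> (d, y) \<in> E2" for d y
    by (auto simp: E_def)
  have E_e: "(d, y) \<in> E \<longleftrightarrow> (d, y) \<in> E1" if "e \<le> d \<or> e < y" for d y
    using that e' K2[of d y] by (auto simp: E_iff)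
  have E_a: "(d, y) \<in> E \<longleftrightarrow> (d, y) \<in> E2" if "a < d \<and> d < e \<or> y < e" for d y
    using that e' K1[of d y] by (auto simp: E_iff)
  have in1: "e \<in> free_points E1 e b"
    using e' K1 by (fastforce simp: free_points_iff)
  have a_notin: "a \<notin> free_points E1 e b - {e}"
    using e' by (simp add: free_points_iff)
  have "free_points E a b = insert a (free_points E1 e b - {e})"
  proof (intro set_eqI iffI)
    fix p assume p: "p \<in> free_points E a b"
    show "p \<in> insert a (free_points E1 e b - {e})"
    proof (cases "p = a")
      case False
      have "p \<noteq> e" "a \<le> p" "a < p \<longrightarrow> e \<le> p"
        using p by (auto simp: free_points_iff E_iff)
      then have "e < p"
        using False by linarith
      then show ?thesis
        using p e' by (auto simp: free_points_iff E_iff)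
    qed simp
  next
    fix p assume p: "p \<in> insert a (free_points E1 e b - {e})"
    show "p \<in> free_points E a b"
    proof (cases "p = a")
      case True
      then show ?thesis
        using e' K1 K2 by (fastforce simp: free_points_iff E_iff)
    next
      case False
      then have "e < p" "p \<in> free_points E1 e b"
        using p by (auto simp: free_points_iff)
      then show ?thesis
        using e' K1 K2 by (fastforce simp: free_points_iff E_iff)
    qed
  qed
  then have "card (free_points E a b) = Suc (card (free_points E1 e b - {e}))"
    using a_notin by simp
  also have "\<dots> = card (free_points E1 e b)"
    using in1 by (intro card.remove[symmetric]) simp_all
  finally have c0: "card (free_points E a b) = card (free_points E1 e b)" .
  have f1: "free_points E (Suc d) y = free_points E1 (Suc d) y" if "(d, y) \<in> E1" for d y
  proof -
    have *: "(d', y') \<in> E \<longleftrightarrow> (d', y') \<in> E1" if "Suc d \<le> d' \<or> Suc d \<le> y'" for d' y'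
      using K1[OF \<open>(d, y) \<in> E1\<close>] that by (intro E_e) auto
    show ?thesis
      unfolding set_eq_iff free_points_iff using * by blast
  qed
  have f2: "free_points E (Suc d) y = free_points E2 (Suc d) y"
    if "a \<le> d" "y \<le> e" for d y
  proof -
    have "(d', p) \<in> E \<longleftrightarrow> (d', p) \<in> E2" if "p < y" for d' p
      using \<open>y \<le> e\<close> that by (intro E_a) auto
    moreover have "(d', y') \<in> E \<longleftrightarrow> (d', y') \<in> E2" if "Suc d \<le> d'" "d' < p" "p < y" for d' y' p
      using \<open>y \<le> e\<close> \<open>a \<le> d\<close> that by (intro E_a) auto
    ultimately show ?thesis
      unfolding set_eq_iff free_points_iff by blast
  qed
  have disj: "E1 \<inter> E2 = {}" "(a, e) \<notin> E1 \<union> E2"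
    using K1 K2 e'(1) by fastforce+
  have "(\<Prod>(d, y)\<in>E. catalan (card (free_points E (Suc d) y)))
    = catalan (card (free_points E (Suc a) e)) *
      ((\<Prod>(d, y)\<in>E1. catalan (card (free_points E (Suc d) y))) *
       (\<Prod>(d, y)\<in>E2. catalan (card (free_points E (Suc d) y))))"
    using disj finite_conf[OF E1] finite_conf[OF E2]
    unfolding E_def by (simp add: prod.union_disjoint)
  also have "(\<Prod>(d, y)\<in>E1. catalan (card (free_points E (Suc d) y)))
    = (\<Prod>(d, y)\<in>E1. catalan (card (free_points E1 (Suc d) y)))"
    by (intro prod.cong) (auto simp: f1)
  also have "(\<Prod>(d, y)\<in>E2. catalan (card (free_points E (Suc d) y)))
    = (\<Prod>(d, y)\<in>E2. catalan (card (free_points E2 (Suc d) y)))"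
    by (intro prod.cong) (use K2 in \<open>fastforce simp: f2\<close>)+
  finally show ?thesis
    using f2[of a e] c0 unfolding E_def[symmetric] by (simp add: conf_weight_def mult_ac)
qed

text \<open>A descent at \<open>a\<close> starts exactly one hook, and its end \<open>e\<close>
  splits the configuration into independent pieces. Only the outer piece inherits \<phi>.\<close>

lemma conf_sum_descent:
  assumes "Suc a < b" "z (Suc a) < z a"
  shows "conf_sum z \<phi> a b
    = (\<Sum>e\<in>hook_ends z a b. conf_sum z \<phi> e b * conf_sum z catalan (Suc a) e)"
proof -
  define T where "T = (SIGMA e:hook_ends z a b. hook_confs z e b \<times> hook_confs z (Suc a) e)"
  have "conf_sum z \<phi> a b
    = (\<Sum>(e, E1, E2)\<in>T. conf_weight \<phi> e b E1 * conf_weight catalan (Suc a) e E2)"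
    unfolding conf_sum_def
  proof (rule sum.reindex_bij_witness[where
        i = "\<lambda>(e, E1, E2). insert (a, e) (E1 \<union> E2)" and
        j = "\<lambda>E. let e = (THE e. (a, e) \<in> E) in
               (e, {h \<in> E. e \<le> fst h}, {h \<in> E. a < fst h \<and> fst h < e})"])
    fix E assume E: "E \<in> hook_confs z a b"
    obtain e where ae: "(a, e) \<in> E"
      using hook_conf_descent[OF E, of a] assms by auto
    have the: "(THE e. (a, e) \<in> E) = e"
      using ae hook_conf_unique[OF E] by blast
    note sp = hook_confs_split[OF E ae]
    show "(case let e = THE e. (a, e) \<in> E in (e, {h \<in> E. e \<le> fst h}, {h \<in> E. a < fst h \<and> fst h < e})
      of (e, E1, E2) \<Rightarrow> insert (a, e) (E1 \<union> E2)) = E"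
      using sp(4) by (simp add: the)
    show "(let e = THE e. (a, e) \<in> E in (e, {h \<in> E. e \<le> fst h}, {h \<in> E. a < fst h \<and> fst h < e})) \<in> T"
      using sp(1-3) by (simp add: the T_def)
    show "(case let e = THE e. (a, e) \<in> E in (e, {h \<in> E. e \<le> fst h}, {h \<in> E. a < fst h \<and> fst h < e})
      of (e, E1, E2) \<Rightarrow> conf_weight \<phi> e b E1 * conf_weight catalan (Suc a) e E2) = conf_weight \<phi> a b E"
      using conf_weight_join[OF sp(1-3), of \<phi>] sp(4) by (simp add: the)
  next
    fix t assume t: "t \<in> T"
    obtain e E1 E2 where [simp]: "t = (e, E1, E2)" by (cases t)
    have h: "e \<in> hook_ends z a b" "E1 \<in> hook_confs z e b" "E2 \<in> hook_confs z (Suc a) e"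
      using t by (auto simp: T_def)
    note J = hook_confs_join[OF h(1) assms(2) h(2,3)]
    then show "(case t of (e, E1, E2) \<Rightarrow> insert (a, e) (E1 \<union> E2)) \<in> hook_confs z a b"
      by simp
    have the: "(THE e'. (a, e') \<in> insert (a, e) (E1 \<union> E2)) = e"
      by (rule the_equality) (use hook_conf_unique[OF J] in blast)+
    have "{h \<in> insert (a, e) (E1 \<union> E2). e \<le> fst h} = E1"
      "{h \<in> insert (a, e) (E1 \<union> E2). a < fst h \<and> fst h < e} = E2"
      using h(1) hook_conf_edgeD(1)[OF h(2)] hook_conf_edgeD(1-3)[OF h(3)]
      by (auto simp: hook_ends_def; fastforce)+
    then show "(let e = THE e'. (a, e') \<in> (case t of (e, E1, E2) \<Rightarrow> insert (a, e) (E1 \<union> E2)) in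
      (e, {h \<in> (case t of (e, E1, E2) \<Rightarrow> insert (a, e) (E1 \<union> E2)). e \<le> fst h},
       {h \<in> (case t of (e, E1, E2) \<Rightarrow> insert (a, e) (E1 \<union> E2)). a < fst h \<and> fst h < e})) = t"
      by (simp only: \<open>t = _\<close> prod.case the Let_def)
  qed
  also have "\<dots> = (\<Sum>e\<in>hook_ends z a b. \<Sum>(E1, E2)\<in>hook_confs z e b \<times> hook_confs z (Suc a) e.
      conf_weight \<phi> e b E1 * conf_weight catalan (Suc a) e E2)"
    unfolding T_def by (subst sum.Sigma) auto
  also have "\<dots> = (\<Sum>e\<in>hook_ends z a b. conf_sum z \<phi> e b * conf_sum z catalan (Suc a) e)"
    unfolding conf_sum_def by (simp add: sum_product sum.cartesian_product)
  finally show ?thesis .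
qed

section \<open>Cuts and the recursion at the right end\<close>

definition conv :: "(nat \<Rightarrow> nat) \<Rightarrow> (nat \<Rightarrow> nat) \<Rightarrow> nat \<Rightarrow> nat" where
  "conv f g n = (\<Sum>i\<le>n. f i * g (n - i))"

lemma conv_Suc: "conv f g (Suc n) = f 0 * g (Suc n) + conv (f \<circ> Suc) g n"
  unfolding conv_def by (subst sum.atMost_Suc_shift) simp

lemma conv_0: "conv f g 0 = f 0 * g 0"
  by (simp add: conv_def)

lemma catalan_comp_Suc: "catalan \<circ> Suc = conv catalan catalan"
  by (rule ext) (simp add: conv_def catalan_Suc)

text \<open>Lets \<open>conv_Suc\<close> be expanded under the sum over configurations.\<close>

lemma conf_sum_linear:
  "conf_sum z (\<lambda>n. k * \<phi> n + \<psi> n) a b = k * conf_sum z \<phi> a b + conf_sum z \<psi> a b"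
  by (simp add: conf_sum_def conf_weight_def algebra_simps sum.distrib sum_distrib_left)

text \<open>A cut \<open>c\<close> separates the positions \<open>c - 1\<close> and
  \<open>c\<close>. At \<open>a\<close> and \<open>b\<close> one of them lies outside
  \<open>{a..<b}\<close>; both are counted as ascents, so that no entry outside the interval is
  consulted.\<close>

definition asc_cuts :: "(nat \<Rightarrow> int) \<Rightarrow> nat \<Rightarrow> nat \<Rightarrow> nat set" where
  "asc_cuts z a b = {c \<in> {a..b}. c = a \<or> c = b \<or> \<not> z c < z (c - 1)}"

definition desc_cuts :: "(nat \<Rightarrow> int) \<Rightarrow> nat \<Rightarrow> nat \<Rightarrow> nat set" where
  "desc_cuts z a b = {c \<in> {a<..<b}. z c < z (c - 1)}"

lemma finite_cuts [simp]: "finite (asc_cuts z a b)" "finite (desc_cuts z a b)"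
  by (simp_all add: asc_cuts_def desc_cuts_def)

lemma hook_ends_below: "c \<le> b \<Longrightarrow> hook_ends z a c = {e \<in> hook_ends z a b. e < c}"
  by (auto simp: hook_ends_def)

lemma hook_ends_gt_Suc: "e \<in> hook_ends z a b \<Longrightarrow> z (Suc a) < z a \<Longrightarrow> Suc a < e"
  by (cases "e = Suc a") (auto simp: hook_ends_def)

text \<open>A cut can be made exactly in front of a blue point or at the right end, so the cuts
  correspond to the ways of splitting the blue points into an initial and a final part.\<close>

lemma conf_sum_conv:
  assumes "a \<le> b"
  shows "conf_sum z (conv f g) a b = (\<Sum>c\<in>asc_cuts z a b. conf_sum z f a c * conf_sum z g c b)"
  using assms
proof (induction "b - a" arbitrary: a f rule: less_induct)
  case less
  consider "a = b" | "a < b" "\<not> (Suc a < b \<and> z (Suc a) < z a)"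
    | "Suc a < b" "z (Suc a) < z a"
    using less.prems by fastforce
  then show ?case
  proof cases
    case 1
    then have "asc_cuts z a b = {a}" by (auto simp: asc_cuts_def)
    then show ?thesis using 1 by (simp add: conf_sum_empty conv_0)
  next
    case 2
    have c1: "asc_cuts z a b = insert a (asc_cuts z (Suc a) b)"
      using 2 by (auto simp: asc_cuts_def not_less_eq_eq)
    have c2: "a \<notin> asc_cuts z (Suc a) b" by (auto simp: asc_cuts_def)
    \<comment> \<open>The first summand is the cut in front of the blue point \<open>a\<close>; in
      the second, \<open>a\<close> goes to the initial part.\<close>
    have "conf_sum z (conv f g) a b = conf_sum z (\<lambda>n. f 0 * (g \<circ> Suc) n + conv (f \<circ> Suc) g n) (Suc a) b"
      by (subst conf_sum_ascent[OF 2]) (simp add: comp_def conv_Suc)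
    also have "\<dots> = f 0 * conf_sum z (g \<circ> Suc) (Suc a) b + conf_sum z (conv (f \<circ> Suc) g) (Suc a) b"
      by (rule conf_sum_linear)
    also have "conf_sum z (conv (f \<circ> Suc) g) (Suc a) b
      = (\<Sum>c\<in>asc_cuts z (Suc a) b. conf_sum z (f \<circ> Suc) (Suc a) c * conf_sum z g c b)"
      using 2 by (intro less.hyps) auto
    also have "\<dots> = (\<Sum>c\<in>asc_cuts z (Suc a) b. conf_sum z f a c * conf_sum z g c b)"
    proof (rule sum.cong[OF refl])
      fix c assume "c \<in> asc_cuts z (Suc a) b"
      then have "conf_sum z f a c = conf_sum z (f \<circ> Suc) (Suc a) c"
        using 2 by (intro conf_sum_ascent) (auto simp: asc_cuts_def)
      then show "conf_sum z (f \<circ> Suc) (Suc a) c * conf_sum z g c b = conf_sum z f a c * conf_sum z g c b"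
        by simp
    qed
    also have "f 0 * conf_sum z (g \<circ> Suc) (Suc a) b = conf_sum z f a a * conf_sum z g a b"
      by (simp add: conf_sum_ascent[OF 2] conf_sum_empty)
    finally show ?thesis
      by (simp add: c1 c2)
  next
    case 3
    define I where "I e = conf_sum z catalan (Suc a) e" for e
    define G where "G e c = conf_sum z f e c * conf_sum z g c b * I e" for e c
    have c1: "asc_cuts z a b = insert a {c \<in> asc_cuts z a b. a < c}" (is "_ = insert a ?C")
      using 3 by (auto simp: asc_cuts_def)
    have c2: "asc_cuts z e b = insert e {c \<in> ?C. e < c}" if "e \<in> hook_ends z a b" for e
      using that by (auto simp: asc_cuts_def hook_ends_def)
    have "conf_sum z (conv f g) a b = (\<Sum>e\<in>hook_ends z a b. conf_sum z (conv f g) e b * I e)"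
      unfolding I_def using 3 by (rule conf_sum_descent)
    also have "\<dots> = (\<Sum>e\<in>hook_ends z a b. \<Sum>c\<in>asc_cuts z e b. G e c)"
    proof (rule sum.cong[OF refl])
      fix e assume "e \<in> hook_ends z a b"
      then have "conf_sum z (conv f g) e b
        = (\<Sum>c\<in>asc_cuts z e b. conf_sum z f e c * conf_sum z g c b)"
        by (intro less.hyps) (auto simp: hook_ends_def)
      then show "conf_sum z (conv f g) e b * I e = (\<Sum>c\<in>asc_cuts z e b. G e c)"
        by (simp add: sum_distrib_right G_def)
    qed
    also have "\<dots> = (\<Sum>e\<in>hook_ends z a b. G e e + (\<Sum>c\<in>{c \<in> ?C. e < c}. G e c))"
      by (intro sum.cong refl) (simp add: c2)
    also have "\<dots> = (\<Sum>e\<in>hook_ends z a b. G e e)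
        + (\<Sum>e\<in>hook_ends z a b. \<Sum>c\<in>{c \<in> ?C. e < c}. G e c)"
      by (rule sum.distrib)
    also have "(\<Sum>e\<in>hook_ends z a b. \<Sum>c\<in>{c \<in> ?C. e < c}. G e c)
      = (\<Sum>c\<in>?C. \<Sum>e\<in>{e \<in> hook_ends z a b. e < c}. G e c)"
      by (rule sum.swap_restrict) simp_all
    also have "\<dots> = (\<Sum>c\<in>?C. conf_sum z f a c * conf_sum z g c b)"
    proof (rule sum.cong[OF refl])
      fix c assume c: "c \<in> ?C"
      \<comment> \<open>The descent at \<open>a\<close> excludes this ascending cut. Therefore
        \<open>a\<close> is still a descent inside \<open>{a..<c}\<close>, and the recursion for
        descents applies to the initial part.\<close>
      then have "c \<noteq> Suc a" using 3 by (auto simp: asc_cuts_def)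
      then have "conf_sum z f a c = (\<Sum>e\<in>hook_ends z a c. conf_sum z f e c * I e)"
        unfolding I_def using 3 c by (intro conf_sum_descent) auto
      also have "hook_ends z a c = {e \<in> hook_ends z a b. e < c}"
        using c by (intro hook_ends_below) (auto simp: asc_cuts_def)
      finally have *: "conf_sum z f a c = (\<Sum>e\<in>{e \<in> hook_ends z a b. e < c}. conf_sum z f e c * I e)" .
      show "(\<Sum>e\<in>{e \<in> hook_ends z a b. e < c}. G e c) = conf_sum z f a c * conf_sum z g c b"
        unfolding * G_def sum_distrib_right by (simp only: mult_ac)
    qed
    \<comment> \<open>The cuts in front of \<open>e\<close> in the outer pieces add up to the single
      cut in front of \<open>a\<close>, since the blue point \<open>e\<close> of an outer piece
      stands for the blue point \<open>a\<close>.\<close>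
    also have "(\<Sum>e\<in>hook_ends z a b. G e e) = conf_sum z f a a * conf_sum z g a b"
      unfolding conf_sum_descent[OF 3, of g]
      by (simp add: G_def I_def conf_sum_empty sum_distrib_left mult_ac)
    finally show ?thesis
      by (subst c1) simp
  qed
qed

text \<open>A maximal last entry either is a new blue point or ends the hook of a descent \<open>c - 1\<close>.\<close>

lemma conf_sum_Suc_max:
  assumes "a \<le> b" "\<And>p. a \<le> p \<Longrightarrow> p < b \<Longrightarrow> z p < z b"
  shows "conf_sum z \<phi> a (Suc b) = conf_sum z (\<phi> \<circ> Suc) a b
    + (\<Sum>c\<in>desc_cuts z a b. conf_sum z \<phi> a c * conf_sum z catalan c b)"
  using assms
proof (induction "b - a" arbitrary: a \<phi> rule: less_induct)
  case less
  consider "a = b" | "a < b" "\<not> (Suc a < b \<and> z (Suc a) < z a)"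
    | "Suc a < b" "z (Suc a) < z a"
    using less.prems(1) by fastforce
  then show ?case
  proof cases
    case 1
    then have "desc_cuts z a b = {}" by (auto simp: desc_cuts_def)
    then show ?thesis using 1 by (simp add: conf_sum_ascent conf_sum_empty)
  next
    case 2
    \<comment> \<open>This includes \<open>Suc a = b\<close>: the maximal entry \<open>z b\<close>
      cannot complete a descent at \<open>a\<close>.\<close>
    have asc: "\<not> (Suc a < c \<and> z (Suc a) < z a)" if "c \<le> Suc b" for c
      using 2 that less.prems(2)[of a] by (cases "Suc a = b") auto
    have c1: "desc_cuts z a b = desc_cuts z (Suc a) b"
    proof (rule set_eqI)
      show "c \<in> desc_cuts z a b \<longleftrightarrow> c \<in> desc_cuts z (Suc a) b" for c
        using 2 by (cases "c = Suc a") (auto simp: desc_cuts_def)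
    qed
    have "conf_sum z \<phi> a (Suc b) = conf_sum z (\<phi> \<circ> Suc) (Suc a) (Suc b)"
      using 2 asc by (intro conf_sum_ascent) auto
    also have "\<dots> = conf_sum z (\<phi> \<circ> Suc \<circ> Suc) (Suc a) b
        + (\<Sum>c\<in>desc_cuts z (Suc a) b. conf_sum z (\<phi> \<circ> Suc) (Suc a) c * conf_sum z catalan c b)"
      using 2 less.prems by (intro less.hyps) auto
    also have "conf_sum z (\<phi> \<circ> Suc \<circ> Suc) (Suc a) b = conf_sum z (\<phi> \<circ> Suc) a b"
      by (rule conf_sum_ascent[OF 2, symmetric])
    also have "(\<Sum>c\<in>desc_cuts z (Suc a) b. conf_sum z (\<phi> \<circ> Suc) (Suc a) c * conf_sum z catalan c b)
      = (\<Sum>c\<in>desc_cuts z a b. conf_sum z \<phi> a c * conf_sum z catalan c b)"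
    proof (rule sum.cong[OF c1[symmetric]])
      fix c assume "c \<in> desc_cuts z a b"
      then have "conf_sum z \<phi> a c = conf_sum z (\<phi> \<circ> Suc) (Suc a) c"
        using asc by (intro conf_sum_ascent) (auto simp: desc_cuts_def)
      then show "conf_sum z (\<phi> \<circ> Suc) (Suc a) c * conf_sum z catalan c b
          = conf_sum z \<phi> a c * conf_sum z catalan c b"
        by simp
    qed
    finally show ?thesis .
  next
    case 3
    define I where "I e = conf_sum z catalan (Suc a) e" for e
    define G where "G e c = conf_sum z \<phi> e c * conf_sum z catalan c b * I e" for e c
    let ?C = "{c \<in> desc_cuts z a b. Suc a < c}"
    have c1: "desc_cuts z a b = insert (Suc a) ?C"
      using 3 by (auto simp: desc_cuts_def)
    have c2: "desc_cuts z e b = {c \<in> ?C. e < c}" if "e \<in> hook_ends z a b" for e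
      using that hook_ends_gt_Suc[OF that 3(2)] by (auto simp: desc_cuts_def)
    have he: "hook_ends z a (Suc b) = insert b (hook_ends z a b)" "b \<notin> hook_ends z a b"
      using less.prems 3 by (auto simp: hook_ends_def)
    have "conf_sum z \<phi> a (Suc b) = (\<Sum>e\<in>hook_ends z a (Suc b). conf_sum z \<phi> e (Suc b) * I e)"
      unfolding I_def using 3 by (intro conf_sum_descent) auto
    also have "\<dots> = conf_sum z \<phi> b (Suc b) * I b
        + (\<Sum>e\<in>hook_ends z a b. conf_sum z \<phi> e (Suc b) * I e)"
      using he by simp
    also have "(\<Sum>e\<in>hook_ends z a b. conf_sum z \<phi> e (Suc b) * I e)
      = (\<Sum>e\<in>hook_ends z a b. conf_sum z (\<phi> \<circ> Suc) e b * I e + (\<Sum>c\<in>{c \<in> ?C. e < c}. G e c))"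
    proof (rule sum.cong[OF refl])
      fix e assume e: "e \<in> hook_ends z a b"
      then have "conf_sum z \<phi> e (Suc b) = conf_sum z (\<phi> \<circ> Suc) e b
        + (\<Sum>c\<in>desc_cuts z e b. conf_sum z \<phi> e c * conf_sum z catalan c b)"
        using less.prems by (intro less.hyps) (auto simp: hook_ends_def)
      then show "conf_sum z \<phi> e (Suc b) * I e
          = conf_sum z (\<phi> \<circ> Suc) e b * I e + (\<Sum>c\<in>{c \<in> ?C. e < c}. G e c)"
        unfolding c2[OF e, symmetric] by (simp add: sum_distrib_right G_def add_mult_distrib)
    qed
    also have "\<dots> = (\<Sum>e\<in>hook_ends z a b. conf_sum z (\<phi> \<circ> Suc) e b * I e)
        + (\<Sum>e\<in>hook_ends z a b. \<Sum>c\<in>{c \<in> ?C. e < c}. G e c)"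
      by (rule sum.distrib)
    also have "(\<Sum>e\<in>hook_ends z a b. conf_sum z (\<phi> \<circ> Suc) e b * I e) = conf_sum z (\<phi> \<circ> Suc) a b"
      unfolding I_def using 3 by (rule conf_sum_descent[symmetric])
    also have "(\<Sum>e\<in>hook_ends z a b. \<Sum>c\<in>{c \<in> ?C. e < c}. G e c)
      = (\<Sum>c\<in>?C. \<Sum>e\<in>{e \<in> hook_ends z a b. e < c}. G e c)"
      by (rule sum.swap_restrict) simp_all
    also have "\<dots> = (\<Sum>c\<in>?C. conf_sum z \<phi> a c * conf_sum z catalan c b)"
    proof (rule sum.cong[OF refl])
      fix c assume c: "c \<in> ?C"
      then have "conf_sum z \<phi> a c = (\<Sum>e\<in>hook_ends z a c. conf_sum z \<phi> e c * I e)"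
        unfolding I_def using 3 by (intro conf_sum_descent) auto
      also have "hook_ends z a c = {e \<in> hook_ends z a b. e < c}"
        using c by (intro hook_ends_below) (auto simp: desc_cuts_def)
      finally have *: "conf_sum z \<phi> a c = (\<Sum>e\<in>{e \<in> hook_ends z a b. e < c}. conf_sum z \<phi> e c * I e)" .
      show "(\<Sum>e\<in>{e \<in> hook_ends z a b. e < c}. G e c) = conf_sum z \<phi> a c * conf_sum z catalan c b"
        unfolding * G_def sum_distrib_right by (simp only: mult_ac)
    qed
    \<comment> \<open>The hook from \<open>a\<close> to the new last position supplies the cut at
      \<open>Suc a\<close>, the one descending cut that the outer pieces miss. On the left one blue
      point remains, \<open>b\<close> in the outer piece and \<open>a\<close> in the cut.\<close>
    also have "conf_sum z \<phi> b (Suc b) * I b = conf_sum z \<phi> a (Suc a) * conf_sum z catalan (Suc a) b"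
      by (simp add: I_def conf_sum_ascent conf_sum_empty)
    finally show ?thesis
      by (subst c1) (simp add: comp_def)
  qed
qed

text \<open>If the last entry is not maximal, the last occurrence of the maximum is a descent whose
  hook has nowhere to end. The induction from the left only has to keep some position with an entry
  above \<open>z b\<close>.\<close>

lemma conf_sum_Suc_nonmax:
  assumes "a \<le> p" "p < b" "z b < z p"
  shows "conf_sum z \<phi> a (Suc b) = 0"
  using assms
proof (induction "b - a" arbitrary: a p \<phi> rule: less_induct)
  case less
  show ?case
  proof (cases "z (Suc a) < z a")
    case True
    have "conf_sum z \<phi> e (Suc b) = 0" if e: "e \<in> hook_ends z a (Suc b)" for e
    proof -
      have *: "a < e" "e \<le> b" "\<And>q. a \<le> q \<Longrightarrow> q < e \<Longrightarrow> z q < z e"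
        using e by (auto simp: hook_ends_def)
      have "e \<noteq> b"
        using *(3)[of p] less.prems by auto
      \<comment> \<open>If the hook passes over \<open>p\<close>, its end is higher still and serves
        as the new witness.\<close>
      then have "e \<le> max e p" "max e p < b" "z b < z (max e p)"
        using * less.prems *(3)[of p] by (auto simp: max_def not_le intro: order_less_trans[of _ "z p"])
      then show ?thesis
        using * less.hyps[of e "max e p" \<phi>] less.prems by auto
    qed
    moreover have "Suc a < Suc b"
      using less.prems by simp
    ultimately show ?thesis
      using conf_sum_descent[of a "Suc b" z \<phi>] True by simp
  next
    case False
    then have "conf_sum z \<phi> a (Suc b) = conf_sum z (\<phi> \<circ> Suc) (Suc a) (Suc b)"
      using less.prems by (intro conf_sum_ascent) auto
    also have "\<dots> = 0"
    proof -
      have "Suc a \<noteq> b"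
      proof
        assume b: "Suc a = b"
        then have "p = a" using less.prems by linarith
        then show False using False less.prems(3) b by simp
      qed
      then have "Suc a < b" using less.prems by simp
      moreover have "z b < z (Suc a)" if "p = a" using False less.prems that by simp
      moreover have "p = a \<or> Suc a \<le> p" using less.prems by linarith
      ultimately have "Suc a \<le> max p (Suc a)" "max p (Suc a) < b" "z b < z (max p (Suc a))"
        using less.prems by (auto simp: max_def)
      then show ?thesis
        using less.hyps[of "Suc a" "max p (Suc a)"] less.prems by auto
    qed
    finally show ?thesis .
  qed
qed

text \<open>Ascending and descending cuts together are all cuts, which turns the two cases of
  \<open>conf_sum_Suc_max\<close> into the recursion of \<open>card_sorts_snoc\<close>.\<close>

lemma conf_sum_catalan_Suc:
  assumes "a \<le> b" "\<And>p. a \<le> p \<Longrightarrow> p < b \<Longrightarrow> z p < z b"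
  shows "conf_sum z catalan a (Suc b) = (\<Sum>c = a..b. conf_sum z catalan a c * conf_sum z catalan c b)"
proof -
  have "{a..b} = asc_cuts z a b \<union> desc_cuts z a b" "asc_cuts z a b \<inter> desc_cuts z a b = {}"
    by (auto simp: asc_cuts_def desc_cuts_def)
  then show ?thesis
    using assms by (simp add: conf_sum_Suc_max catalan_comp_Suc conf_sum_conv sum.union_disjoint)
qed

section \<open>Finite fertilities\<close>

text \<open>\<open>sorts x z\<close>: stack-sorting maps \<open>x\<close> to \<open>z\<close>, by \<open>s(L m R) = s(L) s(R) m\<close> for the maximum \<open>m\<close>.\<close>

inductive sorts :: "int list \<Rightarrow> int list \<Rightarrow> bool" where
  sorts_Nil: "sorts [] []"
| sorts_append: "sorts L A \<Longrightarrow> sorts R B \<Longrightarrow> (\<forall>y \<in> set (L @ R). y < m) \<Longrightarrow>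
    sorts (L @ m # R) (A @ B @ [m])"

lemma sorts_length: "sorts x z \<Longrightarrow> length x = length z"
  by (induction rule: sorts.induct) auto

lemma sorts_set: "sorts x z \<Longrightarrow> set x = set z"
  by (induction rule: sorts.induct) auto

lemma sorts_Nil_iff [simp]: "sorts x [] \<longleftrightarrow> x = []"
  using sorts_length[of x "[]"] by (auto intro: sorts_Nil)

lemma sorts_snoc:
  "{x. sorts x (Z @ [m])} = (if \<forall>y\<in>set Z. y < m
     then \<Union>c\<in>{..length Z}. (\<lambda>(L, R). L @ m # R) `
       ({L. sorts L (take c Z)} \<times> {R. sorts R (drop c Z)}) else {})" (is "_ = ?rhs")
proof (intro set_eqI iffI)
  fix x assume "x \<in> {x. sorts x (Z @ [m])}"
  then have "sorts x (Z @ [m])" by simp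
  then obtain L A R B where *: "x = L @ m # R" "Z = A @ B" "sorts L A" "sorts R B"
    "\<forall>y \<in> set (L @ R). y < m"
    by (cases rule: sorts.cases) auto
  then have "\<forall>y\<in>set Z. y < m"
    using sorts_set[of L A] sorts_set[of R B] by auto
  moreover have "x \<in> (\<lambda>(L, R). L @ m # R) `
       ({L'. sorts L' (take (length A) Z)} \<times> {R'. sorts R' (drop (length A) Z)})"
    using * by (intro image_eqI[of _ _ "(L, R)"]) simp_all
  moreover have "length A \<in> {..length Z}" using * by simp
  ultimately show "x \<in> ?rhs" by (subst if_P) blast+
next
  fix x assume x: "x \<in> ?rhs"
  then have max: "\<forall>y\<in>set Z. y < m" by (auto split: if_splits)
  obtain c L R where *: "x = L @ m # R" "sorts L (take c Z)" "sorts R (drop c Z)"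
    using x by (auto split: if_splits)
  have "\<forall>y \<in> set (L @ R). y < m"
    using max sorts_set[OF *(2)] sorts_set[OF *(3)] by (auto dest: in_set_takeD in_set_dropD)
  from sorts_append[OF *(2,3) this] show "x \<in> {x. sorts x (Z @ [m])}"
    unfolding *(1) append_assoc[symmetric] append_take_drop_id by simp
qed

lemma finite_sorts [simp]: "finite {x. sorts x z}"
  by (rule finite_subset[OF _ finite_lists_length_eq[OF finite_set[of z], of "length z"]])
     (auto simp: sorts_length sorts_set)

text \<open>The letter \<open>m\<close> exceeds all others, so it occurs once in
  \<open>L @ m # R\<close>, and its index recovers \<open>c\<close>. Hence the union in
  \<open>sorts_snoc\<close> is disjoint.\<close>

lemma card_sorts_snoc:
  assumes "\<forall>y\<in>set Z. y < m"
  shows "card {x. sorts x (Z @ [m])}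
    = (\<Sum>c\<le>length Z. card {x. sorts x (take c Z)} * card {x. sorts x (drop c Z)})"
proof -
  define T where "T c = (\<lambda>(L, R). L @ m # R) `
       ({L. sorts L (take c Z)} \<times> {R. sorts R (drop c Z)})" for c
  have pref: "length L = c" "m \<notin> set L" if "c \<le> length Z" "sorts L (take c Z)" for c L
    using that sorts_length[OF that(2)] sorts_set[OF that(2)] assms
    by (auto dest: in_set_takeD)
  have "card {x. sorts x (Z @ [m])} = card (\<Union>c\<in>{..length Z}. T c)"
    unfolding sorts_snoc T_def using assms by simp
  also have "\<dots> = (\<Sum>c\<le>length Z. card (T c))"
  proof (rule card_UN_disjoint)
    show "\<forall>c\<in>{..length Z}. finite (T c)"
      by (simp add: T_def)
    show "\<forall>c\<in>{..length Z}. \<forall>d\<in>{..length Z}. c \<noteq> d \<longrightarrow> T c \<inter> T d = {}"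
    proof (intro ballI impI, rule ccontr)
      fix c d assume cd: "c \<in> {..length Z}" "d \<in> {..length Z}" "c \<noteq> d" "T c \<inter> T d \<noteq> {}"
      then obtain L R L' R' where *: "L @ m # R = L' @ m # R'"
        "sorts L (take c Z)" "sorts L' (take d Z)" "sorts R (drop c Z)" "sorts R' (drop d Z)"
        by (auto simp: T_def)
      have tw: "takeWhile (\<lambda>y. y \<noteq> m) (K @ m # R) = K" if "m \<notin> set K" for K R
        using that by (subst takeWhile_append2) auto
      have "L = L'"
        using *(1-3) pref(2)[of c L] pref(2)[of d L'] cd tw[of L R] tw[of L' R'] by simp
      then show False
        using pref(1)[of c L] pref(1)[of d L'] * cd by auto
    qed
  qed simp
  also have "\<dots> = (\<Sum>c\<le>length Z. card {x. sorts x (take c Z)} * card {x. sorts x (drop c Z)})"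
  proof (rule sum.cong[OF refl])
    fix c assume c: "c \<in> {..length Z}"
    have "inj_on (\<lambda>(L, R). L @ m # R) ({L. sorts L (take c Z)} \<times> {R. sorts R (drop c Z)})"
    proof (rule inj_onI, clarify)
      fix L R L' R' assume "L @ m # R = L' @ m # R'" "sorts L (take c Z)" "sorts L' (take c Z)"
      then show "L = L' \<and> R = R'"
        using pref(1)[of c L] pref(1)[of c L'] c by simp
    qed
    then show "card (T c) = card {x. sorts x (take c Z)} * card {x. sorts x (drop c Z)}"
      unfolding T_def by (simp add: card_image card_cartesian_product)
  qed
  finally show ?thesis .
qed

theorem card_sorts_conf_sum:
  assumes "inj_on z {a..<b}" "a \<le> b"
  shows "card {x. sorts x (map z [a..<b])} = conf_sum z catalan a b"
  using assms
proof (induction "b - a" arbitrary: a b rule: less_induct)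
  case less
  show ?case
  proof (cases "a = b")
    case True
    then show ?thesis by (simp add: conf_sum_empty)
  next
    case False
    then obtain b' where b: "b = Suc b'" "a \<le> b'"
      using less.prems by (cases b) auto
    have split: "map z [a..<b] = map z [a..<b'] @ [z b']"
      using b by simp
    show ?thesis
    proof (cases "\<forall>p\<in>{a..<b'}. z p < z b'")
      case True
      have IH: "card {x. sorts x (map z [c..<d])} = conf_sum z catalan c d" if "a \<le> c" "c \<le> d" "d \<le> b'" for c d
        using that b less.prems(1) by (intro less.hyps) (auto intro: inj_on_subset)
      have "card {x. sorts x (map z [a..<b])}
        = (\<Sum>k\<le>b' - a. card {x. sorts x (take k (map z [a..<b']))} * card {x. sorts x (drop k (map z [a..<b']))})"
        unfolding split using True by (subst card_sorts_snoc) auto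
      also have "\<dots> = (\<Sum>k\<le>b' - a. conf_sum z catalan a (a + k) * conf_sum z catalan (a + k) b')"
      proof (rule sum.cong[OF refl])
        fix k assume k: "k \<in> {..b' - a}"
        have "take k (map z [a..<b']) = map z [a..<a + k]" "drop k (map z [a..<b']) = map z [a + k..<b']"
          using k b by (simp_all add: take_map drop_map)
        then show "card {x. sorts x (take k (map z [a..<b']))} * card {x. sorts x (drop k (map z [a..<b']))}
          = conf_sum z catalan a (a + k) * conf_sum z catalan (a + k) b'"
          using k b by (simp add: IH)
      qed
      also have "\<dots> = (\<Sum>c = a..b'. conf_sum z catalan a c * conf_sum z catalan c b')"
        by (rule sum.reindex_bij_witness[of _ "\<lambda>c. c - a" "\<lambda>k. a + k"]) (use b in auto)
      also have "\<dots> = conf_sum z catalan a b"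
        unfolding b using b True by (subst conf_sum_catalan_Suc) auto
      finally show ?thesis .
    next
      case False
      then obtain p where p: "a \<le> p" "p < b'" "\<not> z p < z b'" by auto
      then have "z b' < z p"
        using less.prems(1) b inj_onD[OF less.prems(1), of p b'] by (auto simp: not_less order_le_less)
      then have "conf_sum z catalan a b = 0"
        unfolding b using p conf_sum_Suc_nonmax by blast
      moreover have "{x. sorts x (map z [a..<b])} = {}"
        unfolding split sorts_snoc using False by auto
      ultimately show ?thesis by simp
    qed
  qed
qed

section \<open>Valid hook configurations\<close>

lemma set_descents: "set (descents z) = {d. Suc d < length z \<and> z ! Suc d < z ! d}"
  by (auto simp: descents_def)

lemma distinct_descents: "distinct (descents z)"
  by (simp add: descents_def)

lemma hook_points_iff:
  "(real p, y) \<in> hook_points z (d, e) \<longleftrightarrow>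
     p = d \<and> real_of_int (z ! d) \<le> y \<and> y \<le> real_of_int (z ! e) \<or>
     d \<le> p \<and> p \<le> e \<and> y = real_of_int (z ! e)"
  by (auto simp: hook_points_def)

lemma hook_pointsE:
  assumes "P \<in> hook_points z (d, e)"
  obtains y where "P = (real d, y)" "real_of_int (z ! d) \<le> y" "y \<le> real_of_int (z ! e)"
    | x where "P = (x, real_of_int (z ! e))" "real d \<le> x" "x \<le> real e"
  using assms by (auto simp: hook_points_def)

text \<open>Only the horizontal segment constrains points: the vertical one starts at the sole point
  of its column, and the endpoint \<open>e\<close> lies on the hook. Distinctness makes the
  inequality strict.\<close>

lemma no_point_above_iff:
  assumes "distinct z" "is_hook z (d, e)"
  shows "(\<forall>p < length z. \<forall>y. (real p, y) \<in> hook_points z (d, e) \<longrightarrow> \<not> y < real_of_int (z ! p))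
    \<longleftrightarrow> (\<forall>p\<in>{d..<e}. z ! p < z ! e)" (is "?L \<longleftrightarrow> ?R")
proof
  assume L: ?L
  show ?R
  proof
    fix p assume p: "p \<in> {d..<e}"
    then have "(real p, real_of_int (z ! e)) \<in> hook_points z (d, e)" "p < length z"
      using assms(2) by (auto simp: hook_points_iff is_hook_def)
    then have "z ! p \<le> z ! e"
      using L by (metis of_int_less_iff not_le)
    moreover have "z ! p \<noteq> z ! e"
      using assms p nth_eq_iff_index_eq[of z p e] by (auto simp: is_hook_def)
    ultimately show "z ! p < z ! e" by simp
  qed
next
  assume R: ?R
  show ?L
  proof (intro allI impI)
    fix p y assume "p < length z" "(real p, y) \<in> hook_points z (d, e)"
    then consider "p = d" "real_of_int (z ! d) \<le> y" | "d \<le> p" "p \<le> e" "y = real_of_int (z ! e)"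
      by (auto simp: hook_points_iff)
    then show "\<not> y < real_of_int (z ! p)"
    proof cases
      case 2
      then show ?thesis using R[rule_format, of p] by (cases "p = e") simp_all
    qed auto
  qed
qed

text \<open>If \<open>d' < e\<close>, the critical point is \<open>(d', z ! e)\<close> on the first
  hook: the second hook rises to this height unless it ends before \<open>e\<close>, in which case
  it stays strictly below. If \<open>d' \<ge> e\<close>, a common point needs \<open>e = d'\<close>,
  and it is the permitted one.\<close>

lemma hooks_disjoint_iff:
  assumes "\<forall>p\<in>{d..<e}. z ! p < z ! e" "\<forall>p\<in>{d'..<e'}. z ! p < z ! e'"
    and "d < d'" "d < e" "d' < e'"
  shows "(\<forall>P \<in> hook_points z (d, e) \<inter> hook_points z (d', e').
      P = plot_point z e \<and> P = plot_point z d' \<or> P = plot_point z e' \<and> P = plot_point z d)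
    \<longleftrightarrow> (d' < e \<longrightarrow> e' < e)" (is "?L \<longleftrightarrow> ?R")
proof
  assume L: ?L
  show ?R
  proof (rule impI, rule ccontr)
    assume *: "d' < e" "\<not> e' < e"
    have le: "z ! d' < z ! e" "z ! e \<le> z ! e'"
      using assms * by (auto simp: le_less)
    then have "(real d', real_of_int (z ! e)) \<in> hook_points z (d, e) \<inter> hook_points z (d', e')"
      using assms(3-5) * by (auto simp: hook_points_iff less_imp_le)
    then have "(real d', real_of_int (z ! e)) = plot_point z e \<or>
        (real d', real_of_int (z ! e)) = plot_point z e'"
      using L by blast
    then show False
      using * assms(5) by (auto simp: plot_point_def)
  qed
next
  assume R: ?R
  show ?L
  proof
    fix P assume P: "P \<in> hook_points z (d, e) \<inter> hook_points z (d', e')"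
    obtain x y where xy: "P = (x, y)" by (cases P)
    have x: "real d' \<le> x" "x \<le> real e" and y: "y = real_of_int (z ! e)"
      using P xy assms(3,5) by (auto elim!: hook_pointsE)
    have y': "y \<le> real_of_int (z ! e')" "x \<le> real e'"
      using P xy assms by (auto elim!: hook_pointsE)
    consider "e < d'" | "e = d'" | "d' < e" "e' < e" using R by linarith
    then show "P = plot_point z e \<and> P = plot_point z d' \<or> P = plot_point z e' \<and> P = plot_point z d"
    proof cases
      case 1
      then show ?thesis using x by simp
    next
      case 2
      then show ?thesis using x y xy by (simp add: plot_point_def)
    next
      case 3
      then have "z ! e' < z ! e" using assms by simp
      then show ?thesis using y y' by simp
    qed
  qed
qed

lemma VHC_iff:
  assumes "distinct z"
  shows "hs \<in> VHC z \<longleftrightarrow> map fst hs = descents z \<and> set hs \<in> hook_confs (nth z) 0 (length z)"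
proof (cases "map fst hs = descents z")
  case fsts: True
  have dist: "a = b" if "a < length hs" "b < length hs" "fst (hs ! a) = fst (hs ! b)" for a b
    using that fsts distinct_descents[of z] by (metis length_map nth_eq_iff_index_eq nth_map)
  have uniq: "e = e'" if "(d, e) \<in> set hs" "(d, e') \<in> set hs" for d e e'
    using that dist unfolding in_set_conv_nth by (metis fst_conv prod.inject)
  have ex: "(\<exists>e. (d, e) \<in> set hs) \<longleftrightarrow> Suc d < length z \<and> z ! Suc d < z ! d" for d
  proof -
    have "(\<exists>e. (d, e) \<in> set hs) \<longleftrightarrow> d \<in> set (map fst hs)" by force
    then show ?thesis unfolding fsts set_descents by simp
  qed
  show ?thesis
  proof (cases "(\<forall>H\<in>set hs. is_hook z H) \<and>
      (\<forall>H\<in>set hs. \<forall>p\<in>{fst H..<snd H}. z ! p < z ! snd H)")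
    case True
    then have hook: "is_hook z (d, e)" "\<forall>p\<in>{d..<e}. z ! p < z ! e" if "(d, e) \<in> set hs" for d e
      using that by force+
    define disj where "disj H H' \<longleftrightarrow> (\<forall>P \<in> hook_points z H \<inter> hook_points z H'.
      P = plot_point z (snd H) \<and> P = plot_point z (fst H') \<or>
      P = plot_point z (snd H') \<and> P = plot_point z (fst H))" for H H'
    have disj_iff: "disj (d, e) (d', e') \<longleftrightarrow> (d' < e \<longrightarrow> e' < e)"
      if "(d, e) \<in> set hs" "(d', e') \<in> set hs" "d < d'" for d e d' e'
      unfolding disj_def fst_conv snd_conv
      using hook[OF that(1)] hook[OF that(2)] that(3)
      by (intro hooks_disjoint_iff) (auto simp: is_hook_def)
    have sym: "disj H H' \<longleftrightarrow> disj H' H" for H H'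
      unfolding disj_def by blast
    have nest: "(\<forall>a<length hs. \<forall>b<length hs. a \<noteq> b \<longrightarrow> disj (hs ! a) (hs ! b)) \<longleftrightarrow>
      (\<forall>d e d' e'. (d, e) \<in> set hs \<longrightarrow> (d', e') \<in> set hs \<longrightarrow> d < d' \<longrightarrow> d' < e \<longrightarrow> e' < e)"
      (is "?A \<longleftrightarrow> ?B")
    proof
      assume A: ?A
      show ?B
      proof (intro allI impI)
        fix d e d' e' assume *: "(d, e) \<in> set hs" "(d', e') \<in> set hs" "d < d'" "d' < e"
        then obtain a b where "a < length hs" "hs ! a = (d, e)" "b < length hs" "hs ! b = (d', e')"
          by (auto simp: in_set_conv_nth)
        then have "disj (d, e) (d', e')" using A *(3) by (metis fst_conv less_irrefl)
        then show "e' < e" using disj_iff * by blast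
      qed
    next
      assume B: ?B
      show ?A
      proof (intro allI impI)
        fix a b assume ab: "a < length hs" "b < length hs" "a \<noteq> b"
        obtain d e d' e' where de: "hs ! a = (d, e)" "hs ! b = (d', e')" by (meson surj_pair)
        have m: "(d, e) \<in> set hs" "(d', e') \<in> set hs" using ab de nth_mem by force+
        have "d \<noteq> d'" using dist[of a b] ab de by auto
        then consider "d < d'" | "d' < d" by linarith
        then show "disj (hs ! a) (hs ! b)"
        proof cases
          case 1 then show ?thesis using B m disj_iff[OF m] unfolding de by blast
        next
          case 2 then show ?thesis using B m disj_iff[OF m(2,1)] sym unfolding de by blast
        qed
      qed
    qed
    have above: "\<forall>H\<in>set hs. \<forall>p<length z. \<forall>y. (real p, y) \<in> hook_points z H \<longrightarrow> \<not> y < real_of_int (z ! p)"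
    proof
      fix H assume "H \<in> set hs"
      then show "\<forall>p<length z. \<forall>y. (real p, y) \<in> hook_points z H \<longrightarrow> \<not> y < real_of_int (z ! p)"
        using hook[of "fst H" "snd H"] no_point_above_iff[OF assms, of "fst H" "snd H"] by simp
    qed
    have "hs \<in> VHC z \<longleftrightarrow>
      (\<forall>d e d' e'. (d, e) \<in> set hs \<longrightarrow> (d', e') \<in> set hs \<longrightarrow> d < d' \<longrightarrow> d' < e \<longrightarrow> e' < e)"
      unfolding VHC_def mem_Collect_eq nest[symmetric] unfolding disj_def
      using fsts True above by blast
    also have "\<dots> \<longleftrightarrow> set hs \<in> hook_confs (nth z) 0 (length z)"
    proof -
      have "0 \<le> d \<and> d < e \<and> e < length z \<and> (\<forall>p\<in>{d..<e}. z ! p < z ! e)" if "(d, e) \<in> set hs" for d e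
        using hook[OF that] by (auto simp: is_hook_def)
      then show ?thesis
        unfolding hook_confs_def mem_Collect_eq using ex uniq by blast
    qed
    finally show ?thesis using fsts by simp
  next
    case False
    have "hs \<notin> VHC z"
    proof
      assume V: "hs \<in> VHC z"
      have "is_hook z H \<and> (\<forall>p\<in>{fst H..<snd H}. z ! p < z ! snd H)" if "H \<in> set hs" for H
      proof -
        have 1: "is_hook z H"
          "\<forall>p<length z. \<forall>y. (real p, y) \<in> hook_points z H \<longrightarrow> \<not> y < real_of_int (z ! p)"
          using V that unfolding VHC_def by blast+
        then show ?thesis using no_point_above_iff[OF assms, of "fst H" "snd H"] by simp
      qed
      then show False using False by blast
    qed
    moreover have "set hs \<notin> hook_confs (nth z) 0 (length z)"
    proof
      assume E: "set hs \<in> hook_confs (nth z) 0 (length z)"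
      have "is_hook z H \<and> (\<forall>p\<in>{fst H..<snd H}. z ! p < z ! snd H)" if "H \<in> set hs" for H
        using hook_conf_edgeD(1-4)[OF E, of "fst H" "snd H"] that by (simp add: is_hook_def)
      then show False using False by blast
    qed
    ultimately show ?thesis by blast
  qed
qed (simp add: VHC_def)

text \<open>The list carries no more than its set, because \<open>descents\<close> prescribes the
  order of the southwest endpoints.\<close>

lemma bij_betw_VHC:
  assumes "distinct z"
  shows "bij_betw set (VHC z) (hook_confs (nth z) 0 (length z))"
proof (rule bij_betw_imageI)
  show "inj_on set (VHC z)"
  proof (rule inj_onI)
    fix hs hs' assume "hs \<in> VHC z" "hs' \<in> VHC z" and eq: "set hs = set hs'"
    then have f: "map fst hs = descents z" "map fst hs' = descents z"
      using VHC_iff[OF assms] by blast+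
    then have len: "length hs = length hs'" by (metis length_map)
    have d: "distinct (map fst hs')" using f distinct_descents by simp
    show "hs = hs'"
    proof (rule nth_equalityI[OF len])
      fix i assume i: "i < length hs"
      then obtain j where j: "j < length hs'" "hs' ! j = hs ! i"
        using eq by (metis in_set_conv_nth nth_mem)
      then have "map fst hs' ! j = map fst hs' ! i"
        using f i len by (metis nth_map)
      then have "j = i" using d i j len by (simp add: distinct_conv_nth) metis
      then show "hs ! i = hs' ! i" using j by simp
    qed
  qed
  show "set ` VHC z = hook_confs (nth z) 0 (length z)"
  proof (intro equalityI subsetI)
    fix E assume "E \<in> set ` VHC z"
    then show "E \<in> hook_confs (nth z) 0 (length z)" using VHC_iff[OF assms] by blast
  next
    fix E assume E: "E \<in> hook_confs (nth z) 0 (length z)"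
    define f where "f d = (THE e. (d, e) \<in> E)" for d
    have f: "f d = e" if "(d, e) \<in> E" for d e
      unfolding f_def using that hook_conf_unique[OF E] by blast
    define hs where "hs = map (\<lambda>d. (d, f d)) (descents z)"
    have "h \<in> set hs \<longleftrightarrow> h \<in> E" for h
    proof (cases h)
      case (Pair d e)
      have "h \<in> set hs \<longleftrightarrow> (\<exists>e'. (d, e') \<in> E) \<and> e = f d"
        unfolding hs_def Pair hook_conf_descent[OF E] using set_descents[of z] by auto
      also have "\<dots> \<longleftrightarrow> h \<in> E" unfolding Pair using f by blast
      finally show ?thesis .
    qed
    then have "set hs = E" by blast
    moreover have "map fst hs = descents z" by (simp add: hs_def comp_def)
    ultimately show "E \<in> set ` VHC z" using E VHC_iff[OF assms, of hs] by blast
  qed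
qed

section \<open>Colours and the Catalan product of a configuration\<close>

definition covers :: "hook list \<Rightarrow> nat \<Rightarrow> nat \<Rightarrow> bool" where
  "covers hs a p \<longleftrightarrow> a < length hs \<and> fst (hs ! a) < p \<and> p < snd (hs ! a)"

text \<open>A vertical segment lies over its own southwest endpoint only, which ignores it, and a
  northeast endpoint is level with its hook. What can be seen is the horizontal part strictly
  between the ends.\<close>

lemma sees_iff:
  assumes "distinct z" "hs \<in> VHC z"
  shows "sees z hs p a y \<longleftrightarrow> covers hs a p \<and> y = real_of_int (z ! snd (hs ! a))"
proof (cases "a < length hs")
  case True
  obtain d e where de: "hs ! a = (d, e)" by fastforce
  then have "(d, e) \<in> set hs" using True nth_mem by force
  moreover have "set hs \<in> hook_confs (nth z) 0 (length z)"
    using assms VHC_iff by blast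
  ultimately have D: "\<And>p. d \<le> p \<Longrightarrow> p < e \<Longrightarrow> z ! p < z ! e"
    using hook_conf_edgeD(4) by blast
  show ?thesis
    unfolding sees_def covers_def de hook_points_iff
    using True D[of p] by (cases "p = e") auto
qed (simp add: sees_def covers_def)

definition innermost :: "hook list \<Rightarrow> nat \<Rightarrow> nat \<Rightarrow> bool" where
  "innermost hs a p \<longleftrightarrow> covers hs a p \<and> (\<forall>b. covers hs b p \<longrightarrow> fst (hs ! b) \<le> fst (hs ! a))"

lemma ex_innermost:
  assumes "covers hs a p"
  shows "\<exists>a. innermost hs a p"
proof -
  define S where "S = {a. covers hs a p}"
  have S: "finite S" "S \<noteq> {}"
    using assms by (auto simp: S_def covers_def)
  then have "Max ((\<lambda>a. fst (hs ! a)) ` S) \<in> (\<lambda>a. fst (hs ! a)) ` S"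
    by (intro Max_in) auto
  then obtain c where "c \<in> S" "fst (hs ! c) = Max ((\<lambda>a. fst (hs ! a)) ` S)"
    by auto
  then have "innermost hs c p"
    using S unfolding innermost_def by (auto simp: S_def)
  then show ?thesis ..
qed

text \<open>Of the hooks over \<open>p\<close>, the one that starts last is the lowest: by nesting
  its end lies under every other such hook, so its height is smaller.\<close>

lemma point_color_innermost:
  assumes "distinct z" "hs \<in> VHC z" "innermost hs a p"
  shows "point_color z hs p = Suc a"
proof -
  note S = sees_iff[OF assms(1,2)]
  have E: "set hs \<in> hook_confs (nth z) 0 (length z)" and f: "map fst hs = descents z"
    using assms VHC_iff by blast+
  have ca: "covers hs a p" using assms(3) by (simp add: innermost_def)
  have lt: "z ! snd (hs ! a) < z ! snd (hs ! b)" if "covers hs b p" "b \<noteq> a" for b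
  proof -
    obtain d e d' e' where de: "hs ! b = (d, e)" "hs ! a = (d', e')" by (meson surj_pair)
    have l: "a < length hs" "b < length hs" using ca that by (auto simp: covers_def)
    then have m: "(d, e) \<in> set hs" "(d', e') \<in> set hs" using de by (metis nth_mem)+
    have "fst (hs ! b) \<noteq> fst (hs ! a)"
      using l that(2) f distinct_descents[of z] by (metis length_map nth_eq_iff_index_eq nth_map)
    then have "d < d'" using assms(3) that(1) de by (auto simp: innermost_def le_less)
    moreover have "d' < e" using ca that(1) de by (auto simp: covers_def)
    ultimately have "e' < e" using hook_conf_nested[OF E m] by blast
    moreover have "d \<le> e'" using \<open>d < d'\<close> hook_conf_edgeD(2)[OF E m(2)] by simp
    ultimately show ?thesis using hook_conf_edgeD(4)[OF E m(1)] de by simp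
  qed
  have "(THE a. \<exists>y. sees z hs p a y \<and> (\<forall>b y'. sees z hs p b y' \<longrightarrow> y \<le> y')) = a"
  proof (rule the_equality)
    show "\<exists>y. sees z hs p a y \<and> (\<forall>b y'. sees z hs p b y' \<longrightarrow> y \<le> y')"
      unfolding S using ca lt by (metis le_less of_int_le_iff)
    show "b = a" if "\<exists>y. sees z hs p b y \<and> (\<forall>b y'. sees z hs p b y' \<longrightarrow> y \<le> y')" for b
      using that ca lt[of b] unfolding S by fastforce
  qed
  moreover have "\<exists>a y. sees z hs p a y" unfolding S using ca by blast
  ultimately show ?thesis unfolding point_color_def by simp
qed

lemma point_color_eq_Suc_iff:
  assumes "distinct z" "hs \<in> VHC z"
  shows "point_color z hs p = Suc a \<longleftrightarrow> innermost hs a p"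
proof
  assume c: "point_color z hs p = Suc a"
  then have "\<exists>a y. sees z hs p a y" unfolding point_color_def by (auto split: if_splits)
  then obtain b where "innermost hs b p"
    using sees_iff[OF assms] ex_innermost by blast
  then show "innermost hs a p"
    using point_color_innermost[OF assms] c by simp
qed (rule point_color_innermost[OF assms])

lemma point_color_eq_0_iff:
  assumes "distinct z" "hs \<in> VHC z"
  shows "point_color z hs p = 0 \<longleftrightarrow> (\<forall>a. \<not> covers hs a p)"
  by (simp add: point_color_def sees_iff[OF assms])

lemma covers_set: "(\<exists>a. covers hs a p) \<longleftrightarrow> (\<exists>d e. (d, e) \<in> set hs \<and> d < p \<and> p < e)"
proof
  assume "\<exists>a. covers hs a p"
  then obtain a where "a < length hs" "fst (hs ! a) < p" "p < snd (hs ! a)"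
    by (auto simp: covers_def)
  then show "\<exists>d e. (d, e) \<in> set hs \<and> d < p \<and> p < e"
    by (intro exI[of _ "fst (hs ! a)"] exI[of _ "snd (hs ! a)"]) simp
next
  assume "\<exists>d e. (d, e) \<in> set hs \<and> d < p \<and> p < e"
  then obtain d e a where "a < length hs" "hs ! a = (d, e)" "d < p" "p < e"
    by (auto simp: in_set_conv_nth)
  then show "\<exists>a. covers hs a p"
    by (intro exI[of _ a]) (simp add: covers_def)
qed

lemma catalan_prod_q_comp:
  assumes "distinct z" "hs \<in> VHC z"
  shows "catalan_prod (q_comp z hs) = conf_weight catalan 0 (length z) (set hs)"
proof (cases "z = []")
  \<comment> \<open>The empty word has the empty composition, while \<open>conf_weight\<close> still
    has a factor for zero blue points; they agree since \<open>catalan 0 = 1\<close>.\<close>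
  case True
  then have "hs = []" using assms VHC_iff[of z hs] by (simp add: descents_def)
  then show ?thesis
    using True by (simp add: q_comp_def catalan_prod_def conf_weight_def free_points_def)
next
  case False
  have E: "set hs \<in> hook_confs (nth z) 0 (length z)" and f: "map fst hs = descents z"
    using assms VHC_iff by blast+
  define Q where "Q c = {p. p < length z \<and> p \<notin> snd ` set hs \<and> point_color z hs p = c}" for c
  have Q0: "Q 0 = free_points (set hs) 0 (length z)"
    unfolding Q_def point_color_eq_0_iff[OF assms] free_points_def using covers_set[of hs] by auto
  have QS: "Q (Suc a) = free_points (set hs) (Suc (fst (hs ! a))) (snd (hs ! a))"
    if a: "a < length hs" for a
  proof -
    obtain d e where de: "hs ! a = (d, e)" by fastforce
    have "e < length z" using hook_conf_edgeD(3)[OF E, of d e] a de by (metis nth_mem)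
    have "innermost hs a p \<longleftrightarrow> d < p \<and> p < e \<and>
        \<not> (\<exists>d' e'. (d', e') \<in> set hs \<and> d < d' \<and> d' < p \<and> p < e')" for p
    proof -
      have "(\<forall>b. covers hs b p \<longrightarrow> fst (hs ! b) \<le> d) \<longleftrightarrow>
          \<not> (\<exists>d' e'. (d', e') \<in> set hs \<and> d < d' \<and> d' < p \<and> p < e')"
        unfolding covers_def in_set_conv_nth by (metis fst_conv snd_conv prod.collapse not_le)
      then show ?thesis
        unfolding innermost_def using a de by (simp add: covers_def)
    qed
    then show ?thesis
      unfolding Q_def point_color_eq_Suc_iff[OF assms] free_points_def de
      using \<open>e < length z\<close> by (auto simp: Suc_le_eq)
  qed
  have "q_comp z hs = map (\<lambda>c. card (Q c)) (0 # map Suc [0..<length hs])"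
    using False unfolding q_comp_def Q_def map_Suc_upt by (simp add: upt_conv_Cons del: upt_Suc)
  also have "\<dots> = card (Q 0) # map (\<lambda>a. card (Q (Suc a))) [0..<length hs]"
    by simp
  also have "map (\<lambda>a. card (Q (Suc a))) [0..<length hs]
    = map (\<lambda>a. (\<lambda>(d, e). card (free_points (set hs) (Suc d) e)) (hs ! a)) [0..<length hs]"
    by (intro map_cong refl) (simp add: QS case_prod_beta)
  also have "\<dots> = map (\<lambda>(d, e). card (free_points (set hs) (Suc d) e)) hs"
    by (subst (3) map_nth[of hs, symmetric]) (simp only: map_map comp_def)
  finally have "catalan_prod (q_comp z hs) = catalan (card (free_points (set hs) 0 (length z))) *
      prod_list (map (\<lambda>h. catalan (case h of (d, e) \<Rightarrow> card (free_points (set hs) (Suc d) e))) hs)"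
    by (simp add: catalan_prod_def Q0 comp_def)
  also have "prod_list (map (\<lambda>h. catalan (case h of (d, e) \<Rightarrow> card (free_points (set hs) (Suc d) e))) hs)
    = (\<Prod>h\<in>set hs. catalan (case h of (d, e) \<Rightarrow> card (free_points (set hs) (Suc d) e)))"
    using f distinct_descents[of z] by (intro prod.distinct_set_conv_list[symmetric]) (metis distinct_map)
  finally show ?thesis
    by (simp add: conf_weight_def case_prod_beta)
qed

theorem finite_VHC: "distinct z \<Longrightarrow> finite (VHC z)"
  using bij_betw_finite[OF bij_betw_VHC] by simp

theorem fertility_formula:
  assumes "distinct z"
  shows "(\<Sum>hs\<in>VHC z. catalan_prod (q_comp z hs)) = card {x. sorts x z}"
proof -
  have "(\<Sum>hs\<in>VHC z. catalan_prod (q_comp z hs))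
    = (\<Sum>hs\<in>VHC z. conf_weight catalan 0 (length z) (set hs))"
    by (intro sum.cong refl catalan_prod_q_comp assms)
  also have "\<dots> = conf_sum (nth z) catalan 0 (length z)"
    unfolding conf_sum_def by (rule sum.reindex_bij_betw[OF bij_betw_VHC[OF assms]])
  also have "\<dots> = card {x. sorts x (map (nth z) [0..<length z])}"
    using assms by (intro card_sorts_conf_sum[symmetric]) (auto simp: inj_on_def nth_eq_iff_index_eq)
  finally show ?thesis by (simp add: map_nth)
qed

section \<open>The affine symmetric group\<close>

lemma dvd_period_iff: "int n dvd x - y \<longleftrightarrow> (\<exists>k. x = y + int n * k)"
  by (simp add: dvd_def diff_eq_eq add.commute)

lemma window_rep:
  assumes "n \<ge> 1"
  shows "\<exists>k. 1 \<le> x + int n * k \<and> x + int n * k \<le> int n"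
proof
  have "x + int n * (- ((x - 1) div int n)) = (x - 1) mod int n + 1"
    using mult_div_mod_eq[of "int n" "x - 1"] by (simp add: algebra_simps)
  moreover have "0 \<le> (x - 1) mod int n" "(x - 1) mod int n < int n"
    using assms by simp_all
  ultimately show "1 \<le> x + int n * (- ((x - 1) div int n)) \<and> x + int n * (- ((x - 1) div int n)) \<le> int n"
    by linarith
qed

lemma window_unique:
  assumes "1 \<le> x" "x \<le> int n" "1 \<le> y" "y \<le> int n" "int n dvd x - y"
  shows "x = y"
proof -
  have "\<bar>x - y\<bar> < int n" using assms by auto
  then show ?thesis using dvd_imp_le_int[of "x - y" "int n"] assms(5) by auto
qed

lemma periodic_mult:
  fixes w :: "int \<Rightarrow> int"
  assumes "\<And>i. w (i + int n) = w i + int n"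
  shows "w (i + int n * k) = w i + int n * k"
proof (induction k rule: int_induct[where k = 0])
  case (step1 k)
  then show ?case using assms[of "i + int n * k"] by (simp add: algebra_simps)
next
  case (step2 k)
  then show ?case using assms[of "i + int n * (k - 1)"] by (simp add: algebra_simps)
qed simp

lemma invariant_mult:
  fixes g :: "int \<Rightarrow> 'a"
  assumes "\<And>i. g (i + int n) = g i"
  shows "g (i + int n * k) = g i"
proof (induction k rule: int_induct[where k = 0])
  case (step1 k)
  then show ?case using assms[of "i + int n * k"] by (simp add: algebra_simps)
next
  case (step2 k)
  then show ?case using assms[of "i + int n * (k - 1)"] by (simp add: algebra_simps)
qed simp

text \<open>The map \<open>w\<close> permutes the residues modulo \<open>n\<close>, and
  \<open>g\<close> depends on the residue only; \<open>h\<close> is \<open>w\<close> reduced to the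
  window \<open>{1..n}\<close>.\<close>

lemma sum_periodic_reindex:
  fixes g :: "int \<Rightarrow> int"
  assumes "n \<ge> 1" "inj w" "\<And>i. w (i + int n) = w i + int n" "\<And>i. g (i + int n) = g i"
  shows "(\<Sum>i = 1..int n. g (w i)) = (\<Sum>i = 1..int n. g i)"
proof -
  define h where "h i = (w i - 1) mod int n + 1" for i
  have h: "h i = w i + int n * (- ((w i - 1) div int n))" for i
    using mult_div_mod_eq[of "int n" "w i - 1"] by (simp add: h_def algebra_simps)
  have "inj_on h {1..int n}"
  proof (rule inj_onI)
    fix i j assume ij: "i \<in> {1..int n}" "j \<in> {1..int n}" "h i = h j"
    then have "int n dvd w i - w j"
      by (simp add: h_def mod_eq_dvd_iff)
    then obtain k where "w i = w j + int n * k"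
      using dvd_period_iff by blast
    then have "w i = w (j + int n * k)"
      using periodic_mult[of w n j k] assms(3) by simp
    then have "i = j + int n * k"
      using assms(2) by (simp add: inj_eq)
    then have "int n dvd i - j" by simp
    then show "i = j" using ij by (intro window_unique) auto
  qed
  moreover have "h ` {1..int n} \<subseteq> {1..int n}"
  proof (rule image_subsetI)
    fix i
    have "0 \<le> (w i - 1) mod int n" "(w i - 1) mod int n < int n"
      using assms(1) by simp_all
    then show "h i \<in> {1..int n}" unfolding h_def atLeastAtMost_iff by linarith
  qed
  ultimately have "bij_betw h {1..int n} {1..int n}"
    by (simp add: bij_betw_def endo_inj_surj)
  then have "(\<Sum>i = 1..int n. g i) = (\<Sum>i = 1..int n. g (h i))"
    by (rule sum.reindex_bij_betw[symmetric])
  also have "\<dots> = (\<Sum>i = 1..int n. g (w i))"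
    by (simp only: h invariant_mult[where g = g, OF assms(4)])
  finally show ?thesis by simp
qed

lemma sum_upto_choose: "(\<Sum>i = 1..int n. i) = int ((n + 1) choose 2)"
proof (induction n)
  case (Suc n)
  have "{1..int (Suc n)} = insert (int (Suc n)) {1..int n}" by auto
  then show ?case using Suc by (simp add: numeral_2_eq_2)
qed simp

text \<open>The displacement \<open>w i - i\<close> is periodic, so in this form the normalization
  can be tested on any window of length \<open>n\<close>, and it is additive under
  composition.\<close>

lemma affine_perms_iff:
  "w \<in> affine_perms n \<longleftrightarrow> bij w \<and> (\<forall>i. w (i + int n) = w i + int n) \<and> (\<Sum>i = 1..int n. w i - i) = 0"
  by (simp add: affine_perms_def sum_subtractf sum_upto_choose)

lemma affine_perm_bij: "w \<in> affine_perms n \<Longrightarrow> bij w"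
  by (simp add: affine_perms_iff)

lemma affine_perm_shift: "w \<in> affine_perms n \<Longrightarrow> w (i + int n) = w i + int n"
  by (simp add: affine_perms_iff)

lemma affine_perm_mult: "w \<in> affine_perms n \<Longrightarrow> w (i + int n * k) = w i + int n * k"
  by (rule periodic_mult) (simp add: affine_perms_iff)

lemma affine_perm_comp:
  assumes "n \<ge> 1" "v \<in> affine_perms n" "w \<in> affine_perms n"
  shows "v \<circ> w \<in> affine_perms n"
proof -
  have "(\<Sum>i = 1..int n. v (w i) - w i) = (\<Sum>i = 1..int n. v i - i)"
    using assms by (intro sum_periodic_reindex[where g = "\<lambda>j. v j - j"])
      (auto simp: affine_perms_iff bij_is_inj)
  then have "(\<Sum>i = 1..int n. v (w i) - i) = (\<Sum>i = 1..int n. v i - i) + (\<Sum>i = 1..int n. w i - i)"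
    by (simp add: sum_subtractf)
  then show ?thesis
    using assms by (simp add: affine_perms_iff bij_comp)
qed

lemma affine_perm_inv_shift:
  assumes "w \<in> affine_perms n"
  shows "inv w (i + int n) = inv w i + int n"
proof -
  have b: "bij w" using assms by (rule affine_perm_bij)
  have "w (inv w i + int n) = i + int n"
    using affine_perm_shift[OF assms] b by (simp add: bij_is_surj surj_f_inv_f)
  then show ?thesis using b by (metis bij_inv_eq_iff)
qed

lemma affine_perm_inv:
  assumes "n \<ge> 1" "w \<in> affine_perms n"
  shows "inv w \<in> affine_perms n"
proof -
  have b: "bij w" using assms by (simp add: affine_perm_bij)
  have "(\<Sum>i = 1..int n. inv w (w i) - w i) = (\<Sum>i = 1..int n. inv w i - i)"
    using assms affine_perm_inv_shift[OF assms(2)]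
    by (intro sum_periodic_reindex[where g = "\<lambda>j. inv w j - j"]) (auto simp: affine_perms_iff bij_is_inj)
  moreover have "(\<Sum>i = 1..int n. inv w (w i) - w i) = - (\<Sum>i = 1..int n. w i - i)"
    using b by (simp add: bij_is_inj flip: sum_negf)
  ultimately show ?thesis
    using assms affine_perm_inv_shift[OF assms(2)] by (simp add: affine_perms_iff bij_imp_bij_inv)
qed

lemma id_affine_perm: "id \<in> affine_perms n"
  by (simp add: affine_perms_iff)

lemma strict_mono_surj_shift:
  fixes f :: "int \<Rightarrow> int"
  assumes "strict_mono f" "surj f"
  shows "f i = f 0 + i"
proof -
  have step: "f (i + 1) = f i + 1" for i
  proof -
    obtain j where j: "f j = f i + 1" using assms(2) by (metis surjD)
    then have "f i < f j" by simp
    then have "i < j" using assms(1) by (simp only: strict_mono_less)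
    then have "f (i + 1) \<le> f j" using assms(1) by (simp add: strict_mono_less_eq)
    moreover have "f i < f (i + 1)" using assms(1) by (simp add: strict_mono_less)
    ultimately show ?thesis using j by simp
  qed
  show ?thesis
  proof (induction i rule: int_induct[where k = 0])
    case (step1 i) then show ?case using step[of i] by simp
  next
    case (step2 i) then show ?case using step[of "i - 1"] by simp
  qed simp
qed

text \<open>An increasing bijection of the integers is a translation, and the normalization leaves
  only the trivial one. Uniqueness statements below rest on this.\<close>

lemma affine_perm_strict_mono_id:
  assumes "n \<ge> 1" "w \<in> affine_perms n" "strict_mono w"
  shows "w = id"
proof -
  note w = strict_mono_surj_shift[OF assms(3) bij_is_surj[OF affine_perm_bij[OF assms(2)]]]
  have "w i - i = w 0" for i using w[of i] by simp
  then have "(\<Sum>i = 1..int n. w i - i) = int n * w 0" by simp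
  then have "w 0 = 0" using assms(1,2) by (simp add: affine_perms_iff)
  then have "w i = i" for i using w[of i] by linarith
  then show ?thesis by (simp add: fun_eq_iff)
qed

section \<open>Length and inversions\<close>

definition inversions :: "(int \<Rightarrow> int) \<Rightarrow> (int \<times> int) set" where
  "inversions w = {(i, j). i < j \<and> w j < w i}"

text \<open>For a translation-invariant \<open>R\<close>: one representative for each class of pairs
  under simultaneous translation by multiples of \<open>n\<close>. Restricting the first component
  is enough to choose it.\<close>

definition orbit_reps :: "nat \<Rightarrow> (int \<times> int) set \<Rightarrow> (int \<times> int) set" where
  "orbit_reps n R = {(i, j) \<in> R. 1 \<le> i \<and> i \<le> int n}"

definition ninv :: "nat \<Rightarrow> (int \<Rightarrow> int) \<Rightarrow> nat" where
  "ninv n w = card (orbit_reps n (inversions w))"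

text \<open>The map \<open>u\<close> commutes with the translations, so it permutes their orbits. It
  may move a representative out of the window; \<open>c\<close> translates it back.\<close>

lemma card_orbit_reps_image:
  assumes "n \<ge> 1" "u \<in> affine_perms n"
    and R: "\<And>i j k. (i + int n * k, j + int n * k) \<in> R \<longleftrightarrow> (i, j) \<in> R"
  shows "card (orbit_reps n (map_prod u u ` R)) = card (orbit_reps n R)"
proof -
  have b: "bij u" using assms(2) by (rule affine_perm_bij)
  have iu: "inv u \<in> affine_perms n" using assms by (simp add: affine_perm_inv)
  have [simp]: "u (inv u x) = x" "inv u (u x) = x" for x
    using b by (simp_all add: bij_is_surj surj_f_inv_f bij_is_inj)
  have R': "(a, b) \<in> map_prod u u ` R \<longleftrightarrow> (inv u a, inv u b) \<in> R" for a b
    by (force simp: image_iff)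
  obtain c where c: "\<And>x. 1 \<le> x + int n * c x" "\<And>x. x + int n * c x \<le> int n"
    using window_rep[OF assms(1)] by metis
  have cu: "c (x + int n * k) = - k" if "1 \<le> x" "x \<le> int n" for x k
  proof -
    have "x + int n * k + int n * c (x + int n * k) = x"
    proof (rule window_unique)
      have "x + int n * k + int n * c (x + int n * k) - x = int n * (k + c (x + int n * k))"
        by (simp add: algebra_simps)
      then show "int n dvd x + int n * k + int n * c (x + int n * k) - x"
        by (simp only: dvd_triv_left)
    qed (use c that in simp_all)
    then have "int n * (k + c (x + int n * k)) = 0" by (simp add: algebra_simps)
    then show ?thesis using assms(1) by simp
  qed
  define f where "f = (\<lambda>(i, j). (u i + int n * c (u i), u j + int n * c (u i)))"
  define g where "g = (\<lambda>(a, b). (inv u a + int n * c (inv u a), inv u b + int n * c (inv u a)))"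
  have "bij_betw f (orbit_reps n R) (orbit_reps n (map_prod u u ` R))"
  proof (rule bij_betw_byWitness[where f' = g])
    show "\<forall>p\<in>orbit_reps n R. g (f p) = p"
      by (auto simp: orbit_reps_def f_def g_def affine_perm_mult[OF iu] cu)
    show "\<forall>p\<in>orbit_reps n (map_prod u u ` R). f (g p) = p"
      by (auto simp: orbit_reps_def f_def g_def affine_perm_mult[OF assms(2)] cu)
    show "f ` orbit_reps n R \<subseteq> orbit_reps n (map_prod u u ` R)"
      unfolding orbit_reps_def by (auto simp: f_def R' affine_perm_mult[OF iu] R c)
    show "g ` orbit_reps n (map_prod u u ` R) \<subseteq> orbit_reps n R"
      unfolding orbit_reps_def by (auto simp: g_def R' R c)
  qed
  then show ?thesis by (simp add: bij_betw_same_card)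
qed

lemma inversions_shift:
  assumes "w \<in> affine_perms n"
  shows "(i + int n * k, j + int n * k) \<in> inversions w \<longleftrightarrow> (i, j) \<in> inversions w"
  by (simp add: inversions_def affine_perm_mult[OF assms])

text \<open>A periodic displacement takes finitely many values. This makes the inversion count
  finite and later provides left-to-right maxima.\<close>

lemma affine_perm_bounded:
  assumes "n \<ge> 1" "w \<in> affine_perms n"
  obtains K where "\<And>i. \<bar>w i - i\<bar> \<le> K"
proof (rule that)
  fix i
  obtain k where k: "1 \<le> i + int n * k" "i + int n * k \<le> int n"
    using window_rep[OF assms(1)] by blast
  define i' where "i' = i + int n * k"
  have i': "i' \<in> {1..int n}"
    using k by (simp add: i'_def)
  have "w i - i = w i' - i'"
    by (simp add: i'_def affine_perm_mult[OF assms(2)])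
  also have "\<bar>\<dots>\<bar> \<le> Max ((\<lambda>i. \<bar>w i - i\<bar>) ` {1..int n})"
    using i' by (intro Max_ge) auto
  finally show "\<bar>w i - i\<bar> \<le> Max ((\<lambda>i. \<bar>w i - i\<bar>) ` {1..int n})" .
qed

lemma finite_orbit_reps_inversions:
  assumes "n \<ge> 1" "w \<in> affine_perms n"
  shows "finite (orbit_reps n (inversions w))"
proof -
  obtain K where K: "\<And>i. \<bar>w i - i\<bar> \<le> K" using affine_perm_bounded[OF assms] by blast
  have "orbit_reps n (inversions w) \<subseteq> {1..int n} \<times> {1..int n + 2 * K}"
  proof
    fix p assume "p \<in> orbit_reps n (inversions w)"
    then obtain i j where p: "p = (i, j)" "i < j" "w j < w i" "1 \<le> i" "i \<le> int n"
      by (auto simp: orbit_reps_def inversions_def)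
    have "j \<le> int n + 2 * K" using K[of i] K[of j] p by linarith
    then show "p \<in> {1..int n} \<times> {1..int n + 2 * K}" using p by simp
  qed
  then show ?thesis by (rule finite_subset) simp
qed

text \<open>The inversions of \<open>x u\<^sup>-\<^sup>1\<close> are the images under \<open>u\<close> of the inversions of \<open>x\<close> that \<open>u\<close> lacks.\<close>

lemma ninv_comp_inv:
  assumes n: "n \<ge> 1" and u: "u \<in> affine_perms n" and x: "x \<in> affine_perms n"
    and sub: "inversions u \<subseteq> inversions x"
  shows "ninv n (x \<circ> inv u) + ninv n u = ninv n x"
proof -
  have [simp]: "u (inv u y) = y" "inv u (u y) = y" for y
    using affine_perm_bij[OF u] by (simp_all add: bij_is_surj surj_f_inv_f bij_is_inj)
  have "inversions (x \<circ> inv u) = map_prod u u ` (inversions x - inversions u)"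
  proof (intro set_eqI iffI)
    fix p assume "p \<in> inversions (x \<circ> inv u)"
    then obtain a b where p: "p = (a, b)" "a < b" "x (inv u b) < x (inv u a)"
      by (auto simp: inversions_def)
    define i j where "i = inv u a" and "j = inv u b"
    have ij: "u i = a" "u j = b" "x j < x i" using p by (simp_all add: i_def j_def)
    have "\<not> j < i"
    proof
      assume "j < i"
      then have "(j, i) \<in> inversions u" using ij p by (simp add: inversions_def)
      then show False using sub ij by (auto simp: inversions_def)
    qed
    then have "i < j" using ij by (auto simp: not_less le_less)
    then have "(i, j) \<in> inversions x - inversions u" using ij p by (auto simp: inversions_def)
    then have "map_prod u u (i, j) \<in> map_prod u u ` (inversions x - inversions u)"
      by (rule imageI)
    then show "p \<in> map_prod u u ` (inversions x - inversions u)"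
      using p ij by simp
  next
    fix p assume "p \<in> map_prod u u ` (inversions x - inversions u)"
    then obtain i j where ij: "p = (u i, u j)" "i < j" "x j < x i" "\<not> u j < u i"
      by (auto simp: inversions_def)
    have "u i \<noteq> u j" using ij affine_perm_bij[OF u] by (auto simp: bij_is_inj inj_eq)
    then show "p \<in> inversions (x \<circ> inv u)" using ij by (auto simp: inversions_def)
  qed
  then have "ninv n (x \<circ> inv u) = card (orbit_reps n (inversions x - inversions u))"
    unfolding ninv_def using n u
    by (simp only:) (rule card_orbit_reps_image; simp add: inversions_shift[OF u] inversions_shift[OF x])
  also have "orbit_reps n (inversions x - inversions u)
      = orbit_reps n (inversions x) - orbit_reps n (inversions u)"
    by (auto simp: orbit_reps_def)
  also have "card \<dots> = ninv n x - ninv n u"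
    unfolding ninv_def using sub finite_orbit_reps_inversions[OF n u]
    by (intro card_Diff_subset) (auto simp: orbit_reps_def)
  finally have "ninv n (x \<circ> inv u) = ninv n x - ninv n u" .
  moreover have "ninv n u \<le> ninv n x"
    unfolding ninv_def using sub
    by (intro card_mono finite_orbit_reps_inversions n x) (auto simp: orbit_reps_def)
  ultimately show ?thesis by simp
qed

lemma ninv_eq_0:
  assumes n: "n \<ge> 1" and w: "w \<in> affine_perms n" and "ninv n w = 0"
  shows "w = id"
proof (rule affine_perm_strict_mono_id[OF n w], rule strict_monoI, rule ccontr)
  fix i j :: int assume ij: "i < j" "\<not> w i < w j"
  have "w i \<noteq> w j" using ij affine_perm_bij[OF w] by (auto simp: bij_is_inj inj_eq)
  then have inv: "(i, j) \<in> inversions w" using ij by (simp add: inversions_def)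
  obtain k where "1 \<le> i + int n * k" "i + int n * k \<le> int n"
    using window_rep[OF n] by blast
  then have "(i + int n * k, j + int n * k) \<in> orbit_reps n (inversions w)"
    using inv inversions_shift[OF w] by (simp add: orbit_reps_def)
  then show False
    using assms(3) finite_orbit_reps_inversions[OF n w] by (auto simp: ninv_def)
qed

section \<open>Simple generators and reduced words\<close>

lemma affine_simple_dvd:
  "affine_simple n a x = (if int n dvd x - a then x + 1 else if int n dvd x - (a + 1) then x - 1 else x)"
  by (simp add: affine_simple_def mod_eq_dvd_iff)

lemma not_dvd_both: "n \<ge> 2 \<Longrightarrow> int n dvd y \<Longrightarrow> \<not> int n dvd y + 1"
  using dvd_diff[of "int n" "y + 1" y] by (auto simp: zdvd1_eq)

lemma affine_simple_involution:
  assumes "n \<ge> 2"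
  shows "affine_simple n a (affine_simple n a x) = x"
  using not_dvd_both[OF assms, of "x - a"] by (auto simp: affine_simple_dvd algebra_simps)

lemma affine_simple_affine_perm:
  assumes "n \<ge> 2"
  shows "affine_simple n a \<in> affine_perms n"
proof -
  let ?s = "affine_simple n a"
  have "?s \<circ> ?s = id" using affine_simple_involution[OF assms] by auto
  then have b: "bij ?s" using o_bij by blast
  have sh: "?s (i + int n) = ?s i + int n" for i
    by (simp add: affine_simple_def)
  \<comment> \<open>Reindexing along the involution turns the displacement sum into its own
    negative, so it vanishes.\<close>
  have "(\<Sum>i = 1..int n. ?s (?s i) - ?s i) = (\<Sum>i = 1..int n. ?s i - i)"
    using assms b sh by (intro sum_periodic_reindex[where g = "\<lambda>j. ?s j - j"]) (auto simp: bij_is_inj)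
  moreover have "(\<Sum>i = 1..int n. ?s (?s i) - ?s i) = - (\<Sum>i = 1..int n. ?s i - i)"
    by (simp add: affine_simple_involution[OF assms] flip: sum_negf)
  ultimately show ?thesis using b sh by (simp add: affine_perms_iff)
qed

lemma inv_affine_simple: "n \<ge> 2 \<Longrightarrow> inv (affine_simple n a) = affine_simple n a"
  by (rule inv_equality) (simp_all add: affine_simple_involution)

lemma affine_simple_less_iff:
  assumes "n \<ge> 2" "x < y"
  shows "affine_simple n a x < affine_simple n a y \<longleftrightarrow> \<not> (y = x + 1 \<and> int n dvd x - a)"
proof (cases "y = x + 1")
  case True
  have "\<not> (int n dvd x - (a + 1) \<and> int n dvd x - a)"
    using not_dvd_both[OF assms(1), of "x - (a + 1)"] by (auto simp: algebra_simps)
  then show ?thesis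
    unfolding True affine_simple_dvd using not_dvd_both[OF assms(1), of "x - a"]
    by (auto simp: algebra_simps)
next
  case False
  have "affine_simple n a x \<le> x + 1" "y - 1 \<le> affine_simple n a y"
    by (auto simp: affine_simple_def)
  moreover have "affine_simple n a x \<noteq> affine_simple n a y"
    using affine_simple_involution[OF assms(1)] assms(2) by (metis less_irrefl)
  ultimately show ?thesis using False assms(2) by linarith
qed

lemma inversions_affine_simple:
  assumes "n \<ge> 2"
  shows "(x, y) \<in> inversions (affine_simple n a) \<longleftrightarrow> y = x + 1 \<and> int n dvd x - a"
proof -
  have "affine_simple n a x \<noteq> affine_simple n a y" if "x < y"
    using affine_simple_involution[OF assms] that by (metis less_irrefl)
  then show ?thesis
    unfolding inversions_def using affine_simple_less_iff[OF assms, of x y a] by auto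
qed

lemma ninv_affine_simple:
  assumes "n \<ge> 2"
  shows "ninv n (affine_simple n a) = 1"
proof -
  obtain k where k: "1 \<le> a + int n * k" "a + int n * k \<le> int n"
    using window_rep[of n a] assms by auto
  define b where "b = a + int n * k"
  have b: "int n dvd b - a" "1 \<le> b" "b \<le> int n"
    using k by (simp_all add: b_def)
  have uniq: "i = b" if "int n dvd i - a" "1 \<le> i" "i \<le> int n" for i
  proof (rule window_unique)
    have "i - a - (b - a) = i - b" by simp
    then show "int n dvd i - b" using dvd_diff[OF that(1) b(1)] by metis
  qed (fact that b)+
  have "orbit_reps n (inversions (affine_simple n a)) = {(b, b + 1)}"
    unfolding orbit_reps_def using b
    by (auto simp: inversions_affine_simple[OF assms] dest: uniq)
  then show ?thesis by (simp add: ninv_def)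
qed

text \<open>The case of \<open>ninv_comp_inv\<close> where \<open>u\<close> is a generator: its
  inversions form a single orbit, which \<open>w\<close> contains because of the descent at
  \<open>a\<close>.\<close>

lemma ninv_comp_simple_descent:
  assumes "n \<ge> 2" "w \<in> affine_perms n" "w (a + 1) < w a"
  shows "ninv n (w \<circ> affine_simple n a) + 1 = ninv n w"
proof -
  have "inversions (affine_simple n a) \<subseteq> inversions w"
  proof
    fix p assume "p \<in> inversions (affine_simple n a)"
    then obtain x where "p = (x, x + 1)" "int n dvd x - a"
      using inversions_affine_simple[OF assms(1)] by (cases p) blast
    then obtain k where "p = (a + int n * k, a + 1 + int n * k)"
      using dvd_period_iff[of n x a] by (auto simp: algebra_simps)
    moreover have "(a, a + 1) \<in> inversions w" using assms(3) by (simp add: inversions_def)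
    ultimately show "p \<in> inversions w" using inversions_shift[OF assms(2)] by simp
  qed
  then show ?thesis
    using ninv_comp_inv[of n "affine_simple n a" w] assms affine_simple_affine_perm[OF assms(1)]
    by (simp add: inv_affine_simple ninv_affine_simple)
qed

lemma ninv_comp_simple_le:
  assumes "n \<ge> 2" "w \<in> affine_perms n"
  shows "ninv n (w \<circ> affine_simple n a) \<le> ninv n w + 1"
proof (cases "w (a + 1) < w a")
  case True
  then show ?thesis using ninv_comp_simple_descent[OF assms] by fastforce
next
  case False
  let ?s = "affine_simple n a"
  let ?w = "w \<circ> ?s"
  have "w a \<noteq> w (a + 1)" using affine_perm_bij[OF assms(2)] by (auto simp: bij_is_inj inj_eq)
  moreover have "?s a = a + 1" "?s (a + 1) = a"
    using not_dvd_both[OF assms(1), of 0] by (auto simp: affine_simple_dvd)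
  ultimately have "?w (a + 1) < ?w a" using False by simp
  moreover have "?w \<in> affine_perms n"
    using assms by (intro affine_perm_comp affine_simple_affine_perm) auto
  ultimately have "ninv n (?w \<circ> ?s) + 1 = ninv n ?w"
    by (intro ninv_comp_simple_descent assms)
  moreover have "?w \<circ> ?s = w" using affine_simple_involution[OF assms(1)] by auto
  ultimately show ?thesis by simp
qed

lemma affine_simple_in_gens:
  assumes "n \<ge> 2"
  shows "affine_simple n a \<in> affine_gens n"
proof -
  obtain k where k: "1 \<le> a + int n * k" "a + int n * k \<le> int n"
    using window_rep[of n a] assms by auto
  define b where "b = a + int n * k"
  have "b + 1 = (a + 1) + int n * k" by (simp add: b_def)
  then have "b mod int n = a mod int n" "(b + 1) mod int n = (a + 1) mod int n"
    by (simp_all only: b_def mod_mult_self2)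
  then have "affine_simple n a = affine_simple n b"
    by (auto simp: affine_simple_def)
  moreover have "b \<in> {1..int n}"
    using k by (simp add: b_def)
  ultimately show ?thesis using assms by (auto simp: affine_gens_def)
qed

definition word_prod :: "(int \<Rightarrow> int) list \<Rightarrow> int \<Rightarrow> int" where
  "word_prod ss = foldr (\<circ>) ss id"

lemma word_prod_Nil: "word_prod [] = id"
  unfolding word_prod_def by (rule ext) simp

lemma word_prod_snoc: "word_prod (ss @ [s]) = word_prod ss \<circ> s"
proof -
  have "foldr (\<circ>) ss f = foldr (\<circ>) ss id \<circ> f" for f :: "int \<Rightarrow> int"
    by (induction ss) (simp_all add: comp_assoc)
  then show ?thesis
    unfolding word_prod_def by (metis comp_id foldr_Cons foldr_Nil foldr_append id_apply comp_apply)
qed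

lemma ninv_id: "ninv n id = 0"
proof -
  have "orbit_reps n (inversions id) = {}" by (auto simp: orbit_reps_def inversions_def)
  then show ?thesis unfolding ninv_def by (simp only: card.empty)
qed

lemma ninv_word_le:
  assumes "n \<ge> 1" "set ss \<subseteq> affine_gens n"
  shows "word_prod ss \<in> affine_perms n \<and> ninv n (word_prod ss) \<le> length ss"
  using assms(2)
proof (induction ss rule: rev_induct)
  case Nil
  then show ?case unfolding word_prod_Nil ninv_id using id_affine_perm by blast
next
  case (snoc s ss)
  then obtain a where a: "s = affine_simple n a" "n \<ge> 2"
    by (auto simp: affine_gens_def split: if_splits)
  have IH: "word_prod ss \<in> affine_perms n" "ninv n (word_prod ss) \<le> length ss"
    using snoc by auto
  have "word_prod ss \<circ> s \<in> affine_perms n"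
    unfolding a(1) by (rule affine_perm_comp[OF assms(1) IH(1) affine_simple_affine_perm[OF a(2)]])
  moreover have "ninv n (word_prod ss \<circ> s) \<le> length ss + 1"
    unfolding a(1) using ninv_comp_simple_le[OF a(2) IH(1), of a] IH(2) by linarith
  moreover have "length (ss @ [s]) = length ss + 1" by simp
  ultimately show ?case
    unfolding word_prod_snoc by (simp only:)
qed

lemma reduced_word:
  assumes n: "n \<ge> 1" and "w \<in> affine_perms n"
  shows "\<exists>ss. length ss = ninv n w \<and> set ss \<subseteq> affine_gens n \<and> w = word_prod ss"
  using assms(2)
proof (induction "ninv n w" arbitrary: w)
  case 0
  then have "w = id" using ninv_eq_0[OF n] by metis
  then show ?case using 0(1) by (intro exI[of _ "[]"]) (simp add: word_prod_Nil)
next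
  case (Suc m)
  have "\<exists>a. \<not> w a < w (a + 1)"
  proof (rule ccontr)
    assume "\<nexists>a. \<not> w a < w (a + 1)"
    then have up: "w a < w (a + 1)" for a by simp
    have "w i < w j" if "i < j" for i j
      using that by (induction rule: int_gr_induct) (use up in \<open>auto intro: less_trans\<close>)
    then have "orbit_reps n (inversions w) = {}" by (force simp: orbit_reps_def inversions_def)
    then show False using Suc.hyps(2) by (simp add: ninv_def)
  qed
  then obtain a where a: "\<not> w a < w (a + 1)" ..
  moreover have "w a \<noteq> w (a + 1)"
    using affine_perm_bij[OF Suc.prems] by (auto simp: bij_is_inj inj_eq)
  ultimately have desc: "w (a + 1) < w a" by simp
  \<comment> \<open>For \<open>n = 1\<close> periodicity reads \<open>w (a + 1) = w a + 1\<close>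
    and excludes a descent.\<close>
  then have n2: "n \<ge> 2"
    using n affine_perm_shift[OF Suc.prems, of a] by (cases "n = 1") auto
  let ?s = "affine_simple n a"
  have "w \<circ> ?s \<in> affine_perms n"
    using n Suc.prems n2 by (simp add: affine_perm_comp affine_simple_affine_perm)
  moreover have "m = ninv n (w \<circ> ?s)"
    using ninv_comp_simple_descent[OF n2 Suc.prems desc] Suc.hyps(2) by simp
  ultimately obtain ss where ss: "length ss = m" "set ss \<subseteq> affine_gens n" "w \<circ> ?s = word_prod ss"
    using Suc.hyps(1) by metis
  have "w = (w \<circ> ?s) \<circ> ?s" using affine_simple_involution[OF n2] by auto
  also have "\<dots> = word_prod (ss @ [?s])"
    unfolding ss(3) word_prod_snoc ..
  finally have "w = word_prod (ss @ [?s])" .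
  moreover have "length (ss @ [?s]) = ninv n w" "set (ss @ [?s]) \<subseteq> affine_gens n"
    using ss Suc.hyps(2) affine_simple_in_gens[OF n2] by auto
  ultimately show ?case by blast
qed

text \<open>A generator raises the inversion count by at most one, which bounds every word from
  below; removing descents one at a time attains the bound.\<close>

lemma coxeter_length_ninv:
  assumes "n \<ge> 1" "w \<in> affine_perms n"
  shows "coxeter_length n w = ninv n w"
  unfolding coxeter_length_def word_prod_def[symmetric]
proof (rule Least_equality)
  show "\<exists>ss. length ss = ninv n w \<and> set ss \<subseteq> affine_gens n \<and> w = word_prod ss"
    by (rule reduced_word[OF assms])
  show "ninv n w \<le> k" if "\<exists>ss. length ss = k \<and> set ss \<subseteq> affine_gens n \<and> w = word_prod ss" for k
    using that ninv_word_le[OF assms(1)] by auto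
qed

section \<open>Minimal elements of the sylvester classes\<close>

text \<open>A position \<open>i\<close> precedes \<open>j > i\<close> in postorder unless \<open>j\<close> is in the right subtree of \<open>i\<close>.\<close>

definition postorder :: "(int \<Rightarrow> int) \<Rightarrow> (int \<Rightarrow> int) \<Rightarrow> bool" where
  "postorder w u \<longleftrightarrow> (\<forall>i j. i < j \<longrightarrow> (u i < u j \<longleftrightarrow> (\<exists>k. i < k \<and> k \<le> j \<and> w i < w k)))"

definition blocked :: "(int \<Rightarrow> int) \<Rightarrow> int \<Rightarrow> int \<Rightarrow> bool" where
  "blocked w i j \<longleftrightarrow> (\<exists>k. i < k \<and> k < j \<and> w i < w k \<and> w j < w k)"

lemma descendant_le_iff:
  "i < j \<Longrightarrow> descendant_le w i j \<longleftrightarrow> w i < w j \<and> \<not> blocked w i j"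
  "j < i \<Longrightarrow> descendant_le w i j \<longleftrightarrow> w i < w j \<and> \<not> blocked w j i"
  unfolding descendant_le_def blocked_def max_less_iff_conj by (auto simp: min_def max_def)

lemma descendant_le_refl: "descendant_le w i i"
  by (simp add: descendant_le_def)

lemma blocked_iff:
  assumes "inj w" "i < j"
  shows "blocked w i j \<longleftrightarrow> \<not> descendant_le w i j \<and> \<not> descendant_le w j i"
proof -
  have "w i \<noteq> w j" using assms by (auto simp: inj_eq)
  then show ?thesis using assms(2) by (auto simp: descendant_le_iff)
qed

text \<open>For injective \<open>w\<close> this \<open>k\<close> is the lowest common ancestor of
  \<open>p\<close> and \<open>q\<close> in the decreasing tree.\<close>

lemma blocked_argmax:
  assumes "blocked w p q"
  obtains k where "p < k" "k < q" "w p < w k" "w q < w k" "\<And>j. p < j \<Longrightarrow> j < q \<Longrightarrow> w j \<le> w k"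
proof -
  obtain k0 where k0: "p < k0" "k0 < q" "w p < w k0" "w q < w k0"
    using assms by (auto simp: blocked_def)
  have "Max (w ` {p<..<q}) \<in> w ` {p<..<q}"
    using k0 by (intro Max_in) auto
  then obtain k where k: "k \<in> {p<..<q}" "w k = Max (w ` {p<..<q})" by force
  have max: "w j \<le> w k" if "p < j" "j < q" for j
    using that by (simp add: k(2))
  show thesis
    using k(1) max max[OF k0(1,2)] k0(3,4) by (intro that[of k]) auto
qed

text \<open>The two maps may compare a pair differently only if some position between exceeds both
  entries in either map. Such a pair is incomparable anyway, so the descendant order does not
  notice.\<close>

lemma descendant_le_eqI:
  assumes "inj w" "inj u"
    and same: "\<And>p q. p < q \<Longrightarrow> (w p < w q \<longleftrightarrow> u p < u q) \<or>
      (\<exists>k. p < k \<and> k < q \<and> w p < w k \<and> w q < w k \<and> u p < u k \<and> u q < u k)"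
  shows "descendant_le w = descendant_le u"
proof -
  \<comment> \<open>Stated for arbitrary maps, as it is needed in both directions. No entry between
    \<open>p\<close> and \<open>q\<close> exceeds that at the lowest common ancestor
    \<open>k\<close>, so the comparisons of \<open>k\<close> with \<open>p\<close> and with
    \<open>q\<close> cannot fall under the exception and carry over.\<close>
  have bl: "blocked u p q" if injs: "inj w" "inj u" and bw: "blocked w p q" and same: "\<And>p q. p < q \<Longrightarrow>
      (w p < w q \<longleftrightarrow> u p < u q) \<or> (\<exists>k. p < k \<and> k < q \<and> w p < w k \<and> w q < w k \<and> u p < u k \<and> u q < u k)"
    for w u :: "int \<Rightarrow> int" and p q
  proof -
    obtain k where k: "p < k" "k < q" "w p < w k" "w q < w k"
      "\<And>j. p < j \<Longrightarrow> j < q \<Longrightarrow> w j \<le> w k"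
      using blocked_argmax[OF bw] by blast
    have "u p < u k"
      using same[OF k(1)] k(3,5) k(2) by fastforce
    moreover have "\<not> u k < u q"
    proof
      assume "u k < u q"
      then obtain j where "k < j" "j < q" "w k < w j"
        using same[OF k(2)] k(4) by auto
      then show False using k(1) k(5)[of j] by auto
    qed
    then have "u q < u k"
      using injD[OF injs(2), of q k] k(2) by (auto simp: not_less le_less)
    ultimately show ?thesis using k(1,2) by (auto simp: blocked_def)
  qed
  have B: "blocked w p q \<longleftrightarrow> blocked u p q" for p q
  proof
    show "blocked w p q \<Longrightarrow> blocked u p q"
      by (rule bl[OF assms(1,2)]) (use same in blast)+
    show "blocked u p q \<Longrightarrow> blocked w p q"
      by (rule bl[OF assms(2,1)]) (use same in blast)+
  qed
  have C: "w p < w q \<longleftrightarrow> u p < u q" if "p < q" "\<not> blocked w p q" for p q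
    using same[OF that(1)] that(2) by (auto simp: blocked_def)
  have C': "w q < w p \<longleftrightarrow> u q < u p" if "p < q" "\<not> blocked w p q" for p q
    using C[OF that] injD[OF assms(1), of p q] injD[OF assms(2), of p q] that(1)
    by (auto simp: less_le not_less)
  show ?thesis
  proof (intro ext)
    fix i j :: int
    consider "i = j" | "i < j" | "j < i" by linarith
    then show "descendant_le w i j = descendant_le u i j"
    proof cases
      case 1 then show ?thesis by (simp add: descendant_le_refl)
    next
      case 2 then show ?thesis using C[of i j] B[of i j] by (auto simp: descendant_le_iff)
    next
      case 3 then show ?thesis using C'[of j i] B[of j i] by (auto simp: descendant_le_iff)
    qed
  qed
qed

text \<open>For an unblocked pair, an entry above \<open>w p\<close> up to \<open>q\<close> forces
  \<open>w p < w q\<close>, so \<open>u\<close> and \<open>w\<close> compare it alike. For a blocked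
  pair, the lowest common ancestor is numbered after both positions.\<close>

lemma postorder_sylvester:
  assumes "inj w" "inj u" "postorder w u"
  shows "affine_sylvester u w"
proof -
  have P: "u i < u j \<longleftrightarrow> (\<exists>k. i < k \<and> k \<le> j \<and> w i < w k)" if "i < j" for i j
    using assms(3) that by (simp add: postorder_def)
  have "descendant_le w = descendant_le u"
  proof (rule descendant_le_eqI[OF assms(1,2)])
    fix p q :: int assume pq: "p < q"
    show "(w p < w q \<longleftrightarrow> u p < u q) \<or>
      (\<exists>k. p < k \<and> k < q \<and> w p < w k \<and> w q < w k \<and> u p < u k \<and> u q < u k)"
    proof (cases "blocked w p q")
      case True
      then obtain k where k: "p < k" "k < q" "w p < w k" "w q < w k"
        "\<And>j. p < j \<Longrightarrow> j < q \<Longrightarrow> w j \<le> w k"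
        using blocked_argmax by blast
      have "u p < u k" using P[OF k(1)] k(1,3) by blast
      moreover have "\<not> u k < u q"
        unfolding P[OF k(2)] using k(1,4) k(5) by (metis le_less not_less order.strict_trans)
      then have "u q < u k" using injD[OF assms(2), of q k] k(2) by (auto simp: not_less le_less)
      ultimately show ?thesis using k by blast
    next
      case False
      have "w p < w q" if "p < k" "k \<le> q" "w p < w k" for k
      proof (rule ccontr)
        assume "\<not> w p < w q"
        then have "k \<noteq> q" "w q < w k" using that by auto
        then show False using False that by (auto simp: blocked_def)
      qed
      then show ?thesis using P[OF pq] pq by blast
    qed
  qed
  then show ?thesis by (simp add: affine_sylvester_def)
qed

text \<open>Members of a class can differ only in how they order blocked pairs; postorder is the
  choice that puts the left position first.\<close>

lemma sylvester_postorder: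
  assumes "inj w" "inj u" "affine_sylvester u w"
    and up: "\<And>i j. i < j \<Longrightarrow> blocked u i j \<Longrightarrow> u i < u j"
  shows "postorder w u"
  unfolding postorder_def
proof (intro allI impI)
  fix i j :: int assume ij: "i < j"
  have D: "descendant_le u = descendant_le w" using assms(3) by (simp add: affine_sylvester_def)
  have B: "blocked u i j \<longleftrightarrow> blocked w i j"
    using blocked_iff[OF assms(1) ij] blocked_iff[OF assms(2) ij] D by simp
  show "u i < u j \<longleftrightarrow> (\<exists>k. i < k \<and> k \<le> j \<and> w i < w k)"
  proof (cases "blocked w i j")
    case True
    then have "\<exists>k. i < k \<and> k \<le> j \<and> w i < w k" by (auto simp: blocked_def intro: less_imp_le)
    then show ?thesis using up[OF ij] B True by blast
  next
    case False
    then have "u i < u j \<longleftrightarrow> w i < w j"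
      using B D descendant_le_iff(1)[OF ij] by metis
    also have "\<dots> \<longleftrightarrow> (\<exists>k. i < k \<and> k \<le> j \<and> w i < w k)"
    proof
      show "w i < w j \<Longrightarrow> \<exists>k. i < k \<and> k \<le> j \<and> w i < w k" using ij by blast
      show "w i < w j" if ex: "\<exists>k. i < k \<and> k \<le> j \<and> w i < w k"
      proof (rule ccontr)
        assume n: "\<not> w i < w j"
        obtain k where "i < k" "k \<le> j" "w i < w k" using ex by blast
        moreover from this have "k \<noteq> j" "w j < w k" using n by auto
        ultimately show False using False by (auto simp: blocked_def)
      qed
    qed
    finally show ?thesis .
  qed
qed

text \<open>Exchanging the adjacent values at a blocked pair keeps the separating entry above both,
  so the class is preserved, while one orbit of inversions disappears.\<close>

lemma sylvester_swap:
  assumes n: "n \<ge> 1" and u: "u \<in> affine_perms n"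
    and ij: "i < j" "blocked u i j" and adj: "u i = u j + 1"
  defines "u' \<equiv> affine_simple n (u j) \<circ> u"
  shows "u' \<in> affine_perms n" "descendant_le u' = descendant_le u" "ninv n u' < ninv n u"
proof -
  let ?s = "affine_simple n (u j)"
  have n2: "n \<ge> 2"
  proof (rule ccontr)
    assume "\<not> n \<ge> 2"
    then have "n = 1" using n by simp
    then have "u (j + int 1 * 1) = u i"
      using affine_perm_mult[OF u, of j 1] adj by simp
    then show False
      using affine_perm_bij[OF u] ij(1) by (simp add: bij_is_inj inj_eq)
  qed
  have inju: "inj u" using affine_perm_bij[OF u] by (simp add: bij_is_inj)
  show u': "u' \<in> affine_perms n"
    unfolding u'_def using n u n2 by (intro affine_perm_comp affine_simple_affine_perm)
  then have inju': "inj u'" using affine_perm_bij by (simp add: bij_is_inj)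
  have less: "u' p < u' q \<longleftrightarrow> \<not> (u q = u p + 1 \<and> int n dvd u p - u j)" if "u p < u q" for p q
    unfolding u'_def using affine_simple_less_iff[OF n2 that] by simp
  have swapped: "\<exists>k. q = i + int n * k \<and> p = j + int n * k" if h: "u q = u p + 1" "int n dvd u p - u j" for p q
  proof -
    obtain k where k: "u p = u j + int n * k" using h(2) dvd_period_iff by blast
    then have "u p = u (j + int n * k)" "u q = u (i + int n * k)"
      using affine_perm_mult[OF u] h(1) adj by simp_all
    then show ?thesis using inju by (auto simp: inj_eq)
  qed
  have same: "(u' p < u' q \<longleftrightarrow> u p < u q) \<or> u p = u q + 1 \<and> int n dvd u q - u j" if "p < q" for p q
  proof (cases "u p < u q")
    case True
    then show ?thesis using less[OF True] swapped[of q p] ij(1) that by auto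
  next
    case False
    then have "u q < u p" using injD[OF inju, of p q] that by (auto simp: not_less le_less)
    then show ?thesis using less[of q p] False by (auto dest: less_asym)
  qed
  show "descendant_le u' = descendant_le u"
  proof (rule descendant_le_eqI[OF inju' inju])
    fix p q :: int assume pq: "p < q"
    show "(u' p < u' q \<longleftrightarrow> u p < u q) \<or>
      (\<exists>k. p < k \<and> k < q \<and> u' p < u' k \<and> u' q < u' k \<and> u p < u k \<and> u q < u k)"
    proof (cases "u p = u q + 1 \<and> int n dvd u q - u j")
      case True
      obtain m where m: "p = i + int n * m" "q = j + int n * m" using swapped True by blast
      obtain k0 where k0: "i < k0" "k0 < j" "u i < u k0" "u j < u k0" using ij(2) by (auto simp: blocked_def)
      define k where "k = k0 + int n * m"
      have k: "p < k" "k < q" "u p < u k" "u q < u k"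
        using k0 m by (simp_all add: k_def affine_perm_mult[OF u])
      \<comment> \<open>The generator exchanges \<open>u q\<close> with \<open>u p\<close>, which is
        \<open>u q + 1\<close>, and never \<open>u p\<close> with \<open>u p + 1\<close>. So
        \<open>k\<close> stays above \<open>p\<close> even if \<open>u k = u p + 1\<close>.\<close>
      have "\<not> int n dvd u p - u j"
        using not_dvd_both[OF n2, of "u q - u j"] True by (simp add: algebra_simps)
      then have "u' p < u' k" "u' q < u' k"
        using less[OF k(3)] less[OF k(4)] True k(3) by auto
      then show ?thesis using k by blast
    next
      case False
      then show ?thesis using same[OF pq] by blast
    qed
  qed
  have "inversions u' \<subseteq> inversions u"
  proof
    fix p assume "p \<in> inversions u'"
    then obtain x y where p: "p = (x, y)" "x < y" "u' y < u' x" by (auto simp: inversions_def)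
    have "\<not> u x < u y"
      using same[OF p(2)] p(3) by auto
    then show "p \<in> inversions u"
      using injD[OF inju, of x y] p by (auto simp: inversions_def not_less le_less)
  qed
  then have "ninv n (u \<circ> inv u') + ninv n u' = ninv n u"
    by (rule ninv_comp_inv[OF n u' u])
  moreover have "u \<circ> inv u' = ?s"
  proof
    fix x
    have "u' (inv u' x) = x" using affine_perm_bij[OF u'] by (simp add: bij_is_surj surj_f_inv_f)
    then have "?s (?s (u (inv u' x))) = ?s x" by (simp add: u'_def)
    then show "(u \<circ> inv u') x = ?s x" using affine_simple_involution[OF n2] by simp
  qed
  ultimately show "ninv n u' < ninv n u" using ninv_affine_simple[OF n2] by simp
qed

text \<open>Among the class members, take one with the fewest inversions. A blocked pair in the
  wrong order and with the smallest gap would have adjacent values, and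
  \<open>sylvester_swap\<close> would contradict minimality.\<close>

lemma ex_postorder:
  assumes n: "n \<ge> 1" and w: "w \<in> affine_perms n"
  shows "\<exists>u \<in> affine_perms n. postorder w u"
proof -
  have injw: "inj w" using affine_perm_bij[OF w] by (simp add: bij_is_inj)
  have "w \<in> sylvester_class n w" using w by (simp add: sylvester_class_def affine_sylvester_def)
  then obtain u where u: "u \<in> sylvester_class n w"
    and min: "\<And>x. x \<in> sylvester_class n w \<Longrightarrow> ninv n u \<le> ninv n x"
    using ex_has_least_nat[of "\<lambda>u. u \<in> sylvester_class n w" w "ninv n"] by blast
  then have uS: "u \<in> affine_perms n" and uw: "affine_sylvester u w"
    by (auto simp: sylvester_class_def)
  have inju: "inj u" using affine_perm_bij[OF uS] by (simp add: bij_is_inj)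
  have no_bad: "\<not> (i < j \<and> blocked u i j \<and> u j < u i)" for i j
  proof
    assume "i < j \<and> blocked u i j \<and> u j < u i"
    then have "\<exists>p. fst p < snd p \<and> blocked u (fst p) (snd p) \<and> u (snd p) < u (fst p)"
      by (intro exI[of _ "(i, j)"]) simp
    then obtain p where p: "fst p < snd p \<and> blocked u (fst p) (snd p) \<and> u (snd p) < u (fst p)"
      and pmin: "\<And>q. fst q < snd q \<and> blocked u (fst q) (snd q) \<and> u (snd q) < u (fst q) \<Longrightarrow>
        nat (u (fst p) - u (snd p)) \<le> nat (u (fst q) - u (snd q))"
      using ex_has_least_nat[of "\<lambda>p. fst p < snd p \<and> blocked u (fst p) (snd p) \<and> u (snd p) < u (fst p)"
          "(i, j)" "\<lambda>p. nat (u (fst p) - u (snd p))"] \<open>i < j \<and> blocked u i j \<and> u j < u i\<close>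
      by auto
    define x y where "x = fst p" and "y = snd p"
    have xy: "x < y" "blocked u x y" "u y < u x" using p by (auto simp: x_def y_def)
    have xymin: "u x - u y \<le> u x' - u y'" if "x' < y'" "blocked u x' y'" "u y' < u x'" for x' y'
      using pmin[of "(x', y')"] that xy(3) by (simp add: x_def y_def)
    obtain k where k: "x < k" "k < y" "u x < u k" "u y < u k" using xy(2) by (auto simp: blocked_def)
    \<comment> \<open>Otherwise the value \<open>u y + 1\<close> occurs at some \<open>z\<close>
      other than \<open>k\<close>. On whichever side of \<open>k\<close> it lies, it forms with
      \<open>x\<close> or \<open>y\<close> a wrongly ordered blocked pair of smaller gap.\<close>
    have "u x = u y + 1"
    proof (rule ccontr)
      assume "u x \<noteq> u y + 1"
      then have gap: "u y < u y + 1" "u y + 1 < u x" using xy(3) by auto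
      obtain z where z: "u z = u y + 1"
        using bij_is_surj[OF affine_perm_bij[OF uS]] by (metis surjD)
      have "z \<noteq> k" using z gap k by auto
      then consider "z < k" | "k < z" by linarith
      then show False
      proof cases
        case 1
        then have "blocked u z y" using k z gap by (auto simp: blocked_def)
        then show False using xymin[of z y] 1 k z gap by auto
      next
        case 2
        then have "blocked u x z" using k z gap by (auto simp: blocked_def)
        then show False using xymin[of x z] 2 k z gap by auto
      qed
    qed
    from sylvester_swap[OF n uS xy(1,2) this] have "affine_simple n (u y) \<circ> u \<in> sylvester_class n w"
      and "ninv n (affine_simple n (u y) \<circ> u) < ninv n u"
      using uw by (auto simp: sylvester_class_def affine_sylvester_def)
    then show False using min by fastforce
  qed
  have "postorder w u"
  proof (rule sylvester_postorder[OF injw inju uw])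
    fix i j :: int assume "i < j" "blocked u i j"
    then show "u i < u j" using no_bad[of i j] injD[OF inju, of i j] by (auto simp: not_less le_less)
  qed
  then show ?thesis using uS by blast
qed

text \<open>The condition decides every comparison between values of \<open>u\<close>, so
  \<open>u' \<circ> inv u\<close> is increasing and hence the identity.\<close>

lemma postorder_unique:
  assumes n: "n \<ge> 1" and u: "u \<in> affine_perms n" "u' \<in> affine_perms n"
    and "postorder w u" "postorder w u'"
  shows "u' = u"
proof -
  have [simp]: "u (inv u y) = y" "inv u (u y) = y" for y
    using affine_perm_bij[OF u(1)] by (simp_all add: bij_is_surj surj_f_inv_f bij_is_inj)
  have inj': "inj u'" using affine_perm_bij[OF u(2)] by (simp add: bij_is_inj)
  have inj: "inj u" using affine_perm_bij[OF u(1)] by (simp add: bij_is_inj)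
  have ord: "u i < u j \<longleftrightarrow> u' i < u' j" if "i < j" for i j
    using assms(4,5) that by (simp add: postorder_def)
  have less': "u' i < u' j" if "u i < u j" for i j
  proof (cases i j rule: linorder_cases)
    case less then show ?thesis using that ord by simp
  next
    case equal then show ?thesis using that by simp
  next
    case greater
    then have "\<not> u' j < u' i" using that ord[of j i] by simp
    then show ?thesis using greater injD[OF inj', of i j] by (auto simp: not_less le_less)
  qed
  have "strict_mono (u' \<circ> inv u)"
    by (rule strict_monoI) (auto intro!: less')
  then have "u' \<circ> inv u = id"
    by (rule affine_perm_strict_mono_id[OF n affine_perm_comp[OF n u(2) affine_perm_inv[OF n u(1)]]])
  then have "u' (inv u (u i)) = u i" for i by (metis comp_apply id_apply)
  then show ?thesis by auto
qed

text \<open>An inversion of \<open>u\<close> at \<open>i < j\<close> means that \<open>j\<close>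
  lies in the right subtree of \<open>i\<close>, so every member of the class has it. Thus
  \<open>u\<close> is below the whole class in the left weak order, which makes it the only minimal
  member.\<close>

lemma pi_down_eq:
  assumes n: "n \<ge> 1" and w: "w \<in> affine_perms n" and u: "u \<in> affine_perms n" and P: "postorder w u"
  shows "pi_down n w = u"
proof -
  have injw: "inj w" using affine_perm_bij[OF w] by (simp add: bij_is_inj)
  have inju: "inj u" using affine_perm_bij[OF u] by (simp add: bij_is_inj)
  have [simp]: "u (inv u y) = y" "inv u (u y) = y" for y
    using affine_perm_bij[OF u] by (simp_all add: bij_is_surj surj_f_inv_f bij_is_inj)
  have uc: "u \<in> sylvester_class n w"
    using u postorder_sylvester[OF injw inju P] by (simp add: sylvester_class_def)
  have add: "ninv n (x \<circ> inv u) + ninv n u = ninv n x" if x: "x \<in> sylvester_class n w" for x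
  proof (rule ninv_comp_inv[OF n u])
    show xS: "x \<in> affine_perms n" using x by (simp add: sylvester_class_def)
    have D: "descendant_le x = descendant_le w"
      using x by (simp add: sylvester_class_def affine_sylvester_def)
    show "inversions u \<subseteq> inversions x"
    proof
      fix p assume "p \<in> inversions u"
      then obtain i j where p: "p = (i, j)" "i < j" "u j < u i" by (auto simp: inversions_def)
      have "\<not> u i < u j" using p(3) by simp
      then have "\<not> (\<exists>k. i < k \<and> k \<le> j \<and> w i < w k)"
        using P p(2) unfolding postorder_def by blast
      then have "\<not> w i < w j" "\<not> blocked w i j"
        using p(2) by (auto simp: blocked_def)
      then have "descendant_le w j i"
        using injD[OF injw, of i j] p(2) by (auto simp: descendant_le_iff not_less le_less)
      then have "x j < x i"
        using descendant_le_iff(2)[OF p(2), of x] unfolding D by blast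
      then show "p \<in> inversions x" using p by (simp add: inversions_def)
    qed
  qed
  have eq: "x = u" if x: "x \<in> sylvester_class n w" and "ninv n x \<le> ninv n u" for x
  proof -
    have "x \<in> affine_perms n" using x by (simp add: sylvester_class_def)
    then have "x \<circ> inv u \<in> affine_perms n"
      by (intro affine_perm_comp affine_perm_inv n u)
    moreover have "ninv n (x \<circ> inv u) = 0"
      using add[OF x] that(2) by linarith
    ultimately have "x \<circ> inv u = id"
      by (rule ninv_eq_0[OF n])
    then have "x (inv u (u i)) = u i" for i by (metis comp_apply id_apply)
    then show ?thesis by auto
  qed
  have len: "left_weak_le n x y \<longleftrightarrow> ninv n (y \<circ> inv x) + ninv n x = ninv n y"
    if "x \<in> affine_perms n" "y \<in> affine_perms n" for x y
  proof -
    have "y \<circ> inv x \<in> affine_perms n" by (intro affine_perm_comp affine_perm_inv n that)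
    then show ?thesis
      unfolding left_weak_le_def using n that by (simp only: coxeter_length_ninv) linarith
  qed
  show ?thesis
    unfolding pi_down_def
  proof (rule the_equality)
    show "u \<in> sylvester_class n w \<and> (\<forall>x\<in>sylvester_class n w. left_weak_le n x u \<longrightarrow> x = u)"
    proof (intro conjI ballI impI uc)
      fix x assume x: "x \<in> sylvester_class n w" "left_weak_le n x u"
      then have "ninv n x \<le> ninv n u" using len[of x u] u by (auto simp: sylvester_class_def)
      then show "x = u" by (rule eq[OF x(1)])
    qed
    fix x assume x: "x \<in> sylvester_class n w \<and> (\<forall>y\<in>sylvester_class n w. left_weak_le n y x \<longrightarrow> y = x)"
    then have "left_weak_le n u x" using len[of u x] add[of x] u by (auto simp: sylvester_class_def)
    then show "x = u" using x uc by auto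
  qed
qed

theorem affine_stack_sort_eq_iff:
  assumes n: "n \<ge> 1" and v: "v \<in> affine_perms n" and w: "w \<in> affine_perms n"
  shows "affine_stack_sort n w = v \<longleftrightarrow> postorder w (inv v \<circ> w)"
proof -
  have iv: "inv v \<in> affine_perms n" using n v by (rule affine_perm_inv)
  have bv: "bij v" using v by (rule affine_perm_bij)
  obtain u where u: "u \<in> affine_perms n" "postorder w u" using ex_postorder[OF n w] by blast
  have bu: "bij u" using u affine_perm_bij by blast
  have s: "affine_stack_sort n w = w \<circ> inv u"
    using pi_down_eq[OF n w u] by (simp add: affine_stack_sort_def)
  have "w \<circ> inv u = v \<longleftrightarrow> inv v \<circ> w = u"
  proof
    assume "w \<circ> inv u = v"
    then have "w (inv u (u i)) = v (u i)" for i by (metis comp_apply)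
    then have "w i = v (u i)" for i using bu by (simp add: bij_is_inj)
    then show "inv v \<circ> w = u" using bv by (simp add: bij_is_inj fun_eq_iff)
  next
    assume "inv v \<circ> w = u"
    then have "v (inv v (w i)) = v (u i)" for i by (metis comp_apply)
    then have "w i = v (u i)" for i using bv by (simp add: bij_is_surj surj_f_inv_f)
    then show "w \<circ> inv u = v" using bu by (simp add: fun_eq_iff bij_is_surj surj_f_inv_f)
  qed
  also have "\<dots> \<longleftrightarrow> postorder w (inv v \<circ> w)"
    using u postorder_unique[OF n u(1) affine_perm_comp[OF n iv w] u(2)] by auto
  finally show ?thesis unfolding s .
qed

section \<open>Postorder on intervals\<close>

definition postorder_on :: "(int \<Rightarrow> int) \<Rightarrow> (int \<Rightarrow> int) \<Rightarrow> int \<Rightarrow> int \<Rightarrow> bool" where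
  "postorder_on w u a b \<longleftrightarrow>
     (\<forall>i j. a \<le> i \<longrightarrow> i < j \<longrightarrow> j \<le> b \<longrightarrow> (u i < u j \<longleftrightarrow> (\<exists>k. i < k \<and> k \<le> j \<and> w i < w k)))"

lemma postorder_on_subset: "postorder_on w u a b \<Longrightarrow> a \<le> a' \<Longrightarrow> b' \<le> b \<Longrightarrow> postorder_on w u a' b'"
  unfolding postorder_on_def by (meson order.trans)

text \<open>Distributes consecutive postorder numbers over the two subtrees of a root;
  \<open>c \<le> d + 1\<close> admits the empty interval.\<close>

lemma split_interval:
  fixes L R :: "int set"
  assumes "c \<le> d + 1" "L \<union> R = {c..d}" "\<And>x y. x \<in> L \<Longrightarrow> y \<in> R \<Longrightarrow> x < y"
  shows "\<exists>e. c \<le> e \<and> e \<le> d + 1 \<and> L = {c..e - 1} \<and> R = {e..d}"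
proof (cases "L = {}")
  case True
  then show ?thesis using assms(1,2) by (auto intro!: exI[of _ c])
next
  case False
  have fin: "finite L" using assms(2) by (metis finite_Un finite_atLeastAtMost_int)
  define e where "e = Max L + 1"
  have M: "e - 1 \<in> L" using False fin by (simp add: e_def)
  have le: "x \<le> e - 1" if "x \<in> L" for x using that fin by (simp add: e_def)
  have sub: "L \<subseteq> {c..d}" "R \<subseteq> {c..d}" using assms(2) by auto
  have "L = {c..e - 1}"
  proof (intro equalityI subsetI)
    fix x assume x: "x \<in> {c..e - 1}"
    have "x \<in> L \<union> R" using x M sub(1) unfolding assms(2) by auto
    moreover have "x \<notin> R" using assms(3)[OF M, of x] x by auto
    ultimately show "x \<in> L" by blast
  qed (use le sub in auto)
  moreover have "R = {e..d}"
  proof (intro equalityI subsetI)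
    fix x assume x: "x \<in> {e..d}"
    have "x \<in> L \<union> R" using x M sub(1) unfolding assms(2) by auto
    moreover have "x \<notin> L" using le[of x] x by auto
    ultimately show "x \<in> R" by blast
  qed (use assms(3)[OF M] sub in fastforce)
  ultimately show ?thesis using M sub(1) by (intro exI[of _ e]) auto
qed

text \<open>The maximum of \<open>w\<close> at \<open>k\<close> is the root of the interval and
  receives the last number \<open>d\<close>. All positions left of \<open>k\<close> are numbered
  before those to its right, so both sides fill consecutive runs and the decomposition of
  \<open>sorts\<close> applies.\<close>

lemma postorder_imp_sorts:
  assumes "inj u" "inj v" "\<And>i. w i = v (u i)" "u ` {a..b} = {c..d}" "postorder_on w u a b"
  shows "sorts (map w [a..b]) (map v [c..d])"
  using assms(4,5)
proof (induction "nat (b - a + 1)" arbitrary: a b c d rule: less_induct)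
  case less
  note PO = less.prems(2)[unfolded postorder_on_def, rule_format]
  have injw: "w i = w j \<longleftrightarrow> i = j" for i j
    using assms(1-3) by (simp add: inj_eq)
  show ?case
  proof (cases "a \<le> b")
    case False
    then have "{c..d} = {}" using less.prems(1) by auto
    then show ?thesis using False by (simp add: sorts_Nil)
  next
    case True
    have "Max (w ` {a..b}) \<in> w ` {a..b}" using True by (intro Max_in) auto
    then obtain k where k: "k \<in> {a..b}" "w k = Max (w ` {a..b})" by force
    have max: "w i < w k" if "a \<le> i" "i \<le> b" "i \<noteq> k" for i
    proof -
      have "w i \<le> w k" using that by (simp add: k(2))
      then show ?thesis using that injw by (simp add: le_less)
    qed
    have umax: "u i < u k" if "a \<le> i" "i \<le> b" "i \<noteq> k" for i
    proof (cases "i < k")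
      case True
      then show ?thesis using PO[of i k] max[OF that] that k(1) by auto
    next
      case False
      then have ki: "k < i" using that by simp
      have "\<not> (\<exists>j. k < j \<and> j \<le> i \<and> w k < w j)"
        using max k(1) that by (metis atLeastAtMost_iff less_asym less_imp_le less_irrefl order.trans)
      then have "\<not> u k < u i" using PO[of k i] ki that k(1) by auto
      moreover have "u k \<noteq> u i" using assms(1) that by (simp add: inj_eq)
      ultimately show ?thesis by simp
    qed
    have "u a \<in> {c..d}" using True unfolding less.prems(1)[symmetric] by simp
    then have cd: "c \<le> d" by simp
    then have "d \<in> u ` {a..b}" unfolding less.prems(1) by simp
    then obtain i where i: "d = u i" "a \<le> i" "i \<le> b" by auto
    have "u k \<in> {c..d}" using k(1) less.prems(1) by blast
    then have ukd: "u k = d" using i umax[of i] by (cases "i = k") auto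
    have un: "u ` {a..k - 1} \<union> u ` {k + 1..b} = {c..d - 1}"
    proof -
      have "{a..k - 1} \<union> {k + 1..b} = {a..b} - {k}" using k(1) by auto
      then have "u ` {a..k - 1} \<union> u ` {k + 1..b} = u ` ({a..b} - {k})" by (metis image_Un)
      also have "\<dots> = {c..d} - {d}"
        using assms(1) less.prems(1) ukd by (simp add: image_set_diff)
      finally show ?thesis by auto
    qed
    have lt: "x < y" if "x \<in> u ` {a..k - 1}" "y \<in> u ` {k + 1..b}" for x y
    proof -
      obtain i j where ij: "x = u i" "y = u j" "a \<le> i" "i < k" "k < j" "j \<le> b" using \<open>x \<in> _\<close> \<open>y \<in> _\<close> by auto
      then show ?thesis using PO[of i j] max[of i] k(1) by auto
    qed
    obtain e where e: "c \<le> e" "e \<le> d" "u ` {a..k - 1} = {c..e - 1}" "u ` {k + 1..b} = {e..d - 1}"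
      using split_interval[OF _ un lt] cd by auto
    have IH1: "sorts (map w [a..k - 1]) (map v [c..e - 1])"
      using k(1) e(3) less.prems(2) by (intro less.hyps) (auto intro: postorder_on_subset)
    have IH2: "sorts (map w [k + 1..b]) (map v [e..d - 1])"
      using k(1) e(4) less.prems(2) by (intro less.hyps) (auto intro: postorder_on_subset)
    have "sorts (map w [a..k - 1] @ w k # map w [k + 1..b]) (map v [c..e - 1] @ map v [e..d - 1] @ [w k])"
      by (rule sorts_append[OF IH1 IH2]) (use max k(1) in auto)
    moreover have "[a..b] = [a..k - 1] @ k # [k + 1..b]" using k(1) by (intro upto_split3) auto
    moreover have "[c..d] = [c..e - 1] @ [e..d - 1] @ [d]"
      using e(1,2) upto_split1[of c e d] upto_rec2[of e d] by simp
    ultimately show ?thesis using assms(3) ukd by simp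
  qed
qed

lemma upto_append_split:
  assumes "[a..b] = xs @ ys"
  shows "xs = [a..a + int (length xs) - 1]" "ys = [a + int (length xs)..b]"
proof -
  have "length xs \<le> nat (b - a + 1)" using arg_cong[OF assms, of length] by simp
  then have "[a..b] = [a..a + int (length xs) - 1] @ [a + int (length xs)..b]"
  proof (cases "a + int (length xs) \<le> b")
    case True
    then show ?thesis using upto_split1[of a "a + int (length xs)" b] by simp
  next
    case False
    have "xs = [] \<and> b < a \<or> a + int (length xs) = b + 1"
      using \<open>length xs \<le> _\<close> False by (cases "b < a") auto
    then show ?thesis by auto
  qed
  then have eq: "xs @ ys = [a..a + int (length xs) - 1] @ [a + int (length xs)..b]"
    using assms by simp
  have "length xs = length [a..a + int (length xs) - 1]" by simp
  then show "xs = [a..a + int (length xs) - 1]" "ys = [a + int (length xs)..b]"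
    using eq append_eq_append_conv by blast+
qed

text \<open>A derivation of \<open>sorts\<close> singles out the root \<open>k\<close> and the cut
  \<open>e\<close>. Pairs on one side of \<open>k\<close> are settled by induction, pairs across
  \<open>k\<close> by the separation of the runs, and \<open>k\<close> itself by being numbered
  last.\<close>

lemma sorts_imp_postorder:
  assumes "inj v" "\<And>i. w i = v (u i)" "sorts (map w [a..b]) (map v [c..d])"
  shows "u ` {a..b} = {c..d} \<and> postorder_on w u a b"
  using assms(3)
proof (induction "nat (b - a + 1)" arbitrary: a b c d rule: less_induct)
  case less
  from less.prems show ?case
  proof (cases rule: sorts.cases)
    case sorts_Nil
    then show ?thesis by (auto simp: postorder_on_def)
  next
    case (sorts_append L A R B m)
    obtain xs ys where 1: "[a..b] = xs @ ys" "L = map w xs" "m # R = map w ys"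
      using sorts_append(1) by (auto simp: map_eq_append_conv)
    define k where "k = a + int (length xs)"
    have ys: "xs = [a..k - 1]" "ys = [k..b]" using upto_append_split[OF 1(1)] by (simp_all add: k_def)
    have kb: "a \<le> k" "k \<le> b" using 1(3) ys(2) by (auto simp: k_def) (metis list.distinct(1) list.simps(8) not_le upto_empty)
    have mk: "m = w k" "R = map w [k + 1..b]" using 1(3) kb(2) unfolding ys(2) by (simp_all add: upto_rec1)
    obtain as bs' where 2: "[c..d] = as @ bs'" "A = map v as" "B @ [m] = map v bs'"
      using sorts_append(2) by (auto simp: map_eq_append_conv)
    define e where "e = c + int (length as)"
    have bs': "as = [c..e - 1]" "bs' = [e..d]" using upto_append_split[OF 2(1)] by (simp_all add: e_def)
    have ed: "c \<le> e" "e \<le> d" using 2(3) bs'(2) by (auto simp: e_def) (metis append_is_Nil_conv list.distinct(1) list.simps(8) not_le upto_empty)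
    have md: "m = v d" "B = map v [e..d - 1]" using 2(3) ed(2) unfolding bs'(2) by (simp_all add: upto_rec2)
    have IH1: "u ` {a..k - 1} = {c..e - 1} \<and> postorder_on w u a (k - 1)"
      using sorts_append(3) kb unfolding 1(2) 2(2) ys(1) bs'(1) by (intro less.hyps) auto
    have IH2: "u ` {k + 1..b} = {e..d - 1} \<and> postorder_on w u (k + 1) b"
      using sorts_append(4) kb unfolding mk(2) md(2) by (intro less.hyps) auto
    have uk: "u k = d" using mk(1) md(1) assms(1,2) by (simp add: inj_eq)
    have "{a..b} = {a..k - 1} \<union> {k} \<union> {k + 1..b}" "{c..d} = {c..e - 1} \<union> {d} \<union> {e..d - 1}"
      using kb ed by auto
    then have "u ` {a..b} = {c..d}" using IH1 IH2 uk by (simp add: image_Un)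
    moreover have max: "w i < w k" if "a \<le> i" "i \<le> b" "i \<noteq> k" for i
      using sorts_append(5) that unfolding 1(2) mk ys(1) by (cases "i < k") auto
    have "postorder_on w u a b"
      unfolding postorder_on_def
    proof (intro allI impI)
      fix i j :: int assume ij: "a \<le> i" "i < j" "j \<le> b"
      consider "j < k" | "k < i" | "i < k" "k \<le> j" | "i = k" by linarith
      then show "u i < u j \<longleftrightarrow> (\<exists>k. i < k \<and> k \<le> j \<and> w i < w k)"
      proof cases
        case 1
        then show ?thesis using IH1 ij unfolding postorder_on_def by auto
      next
        case 2
        then show ?thesis using IH2 ij unfolding postorder_on_def by auto
      next
        case 3
        have "u i \<in> {c..e - 1}" using IH1 3 ij by (metis image_eqI atLeastAtMost_iff zle_diff1_eq)
        moreover have "e \<le> u j"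
        proof (cases "j = k")
          case False
          then have "u j \<in> {e..d - 1}" using IH2 3 ij by (metis image_eqI atLeastAtMost_iff le_less zless_imp_add1_zle)
          then show ?thesis by simp
        qed (use uk ed in simp)
        moreover have "w i < w k" using max[of i] 3 ij by simp
        ultimately show ?thesis using 3 by auto
      next
        case 4
        have "j \<in> {k + 1..b}" using 4 ij by simp
        then have "u j \<in> {e..d - 1}" using IH2 by blast
        then have "\<not> u i < u j" using 4 uk by simp
        moreover have "\<not> w i < w l" if "i < l" "l \<le> j" for l using max[of l] 4 ij that by auto
        ultimately show ?thesis by blast
      qed
    qed
    ultimately show ?thesis by blast
  qed
qed

text \<open>Used to translate the word of a block by a multiple of \<open>n\<close>.\<close>

lemma sorts_map:
  assumes "strict_mono f" "sorts x z"
  shows "sorts (map f x) (map f z)"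
  using assms(2)
proof (induction rule: sorts.induct)
  case (sorts_append L A R B m)
  then have "sorts (map f L @ f m # map f R) (map f A @ map f B @ [f m])"
    using assms(1) by (intro sorts.sorts_append) (auto simp: strict_mono_less)
  then show ?case by simp
qed (simp add: sorts_Nil)

section \<open>Skylines\<close>

lemma strict_mono_int_add:
  fixes P :: "int \<Rightarrow> int"
  assumes "strict_mono P" "i \<le> j"
  shows "P i + (j - i) \<le> P j"
  using assms(2)
proof (induction rule: int_ge_induct)
  case (step j)
  have "P j < P (j + 1)" using assms(1) by (simp add: strict_mono_less)
  then show ?case using step by simp
qed simp

lemma interval_index:
  fixes P :: "int \<Rightarrow> int"
  assumes "strict_mono P"
  shows "\<exists>i. P i \<le> x \<and> x < P (i + 1)"
proof -
  define B where "B = \<bar>x\<bar> + \<bar>P 0\<bar> + 1"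
  have B0: "0 \<le> B" by (simp add: B_def)
  have lo: "P (- B) \<le> x" using strict_mono_int_add[OF assms, of "- B" 0] B0 B_def by linarith
  have hi: "x < P B" using strict_mono_int_add[OF assms, of 0 B] B0 B_def by linarith
  define S where "S = {i \<in> {- B..B}. P i \<le> x}"
  have S: "finite S" "- B \<in> S"
    using lo B0 by (auto simp: S_def intro: finite_subset[of _ "{- B..B}"])
  then have "Max S \<in> S" by (intro Max_in) auto
  moreover have "x < P (Max S + 1)"
  proof (rule ccontr)
    assume n: "\<not> x < P (Max S + 1)"
    then have "P (Max S + 1) < P B" using hi by simp
    then have "Max S + 1 \<le> B" using assms by (simp add: strict_mono_less)
    then have "Max S + 1 \<in> S" using n \<open>Max S \<in> S\<close> by (auto simp: S_def)
    then have "Max S + 1 \<le> Max S" using S(1) by (rule Max_ge[rotated])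
    then show False by simp
  qed
  ultimately show ?thesis by (auto simp: S_def)
qed

lemma interval_index_unique:
  fixes P :: "int \<Rightarrow> int"
  assumes "strict_mono P" "P i \<le> x" "x < P (i + 1)" "P j \<le> x" "x < P (j + 1)"
  shows "i = j"
proof -
  have "P i < P (j + 1)" "P j < P (i + 1)" using assms by linarith+
  then have "i < j + 1" "j < i + 1" using assms(1) by (simp_all only: strict_mono_less)
  then show ?thesis by simp
qed

lemma ltr_maxima_iff:
  assumes "bij w"
  shows "w p \<in> ltr_maxima w \<longleftrightarrow> (\<forall>i<p. w i < w p)"
  using assms by (simp add: ltr_maxima_def bij_is_inj)

lemma ltr_maxima_inv_less:
  assumes "bij w" "m \<in> ltr_maxima w" "m' \<in> ltr_maxima w" "m < m'"
  shows "inv w m < inv w m'"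
proof (rule ccontr)
  assume n: "\<not> inv w m < inv w m'"
  have w: "w (inv w m) = m" "w (inv w m') = m'"
    using assms(1) by (simp_all add: bij_is_surj surj_f_inv_f)
  then have "inv w m \<noteq> inv w m'" using assms(4) by auto
  then have "inv w m' < inv w m" using n by simp
  then have "w (inv w m') < m" using assms(2) unfolding ltr_maxima_def by blast
  then show False using w(2) assms(4) by simp
qed

lemma periodic_set_enum:
  assumes n: "n \<ge> 1" and M: "M \<noteq> {}" "(\<lambda>m. m + int n) ` M = M"
  shows "\<exists>m r. r \<ge> 1 \<and> strict_mono m \<and> range m = M \<and> (\<forall>j. m (j + int r) = m j + int n)"
proof -
  have step: "(x + int n \<in> M) = (x \<in> M)" for x
  proof
    assume "x + int n \<in> M"
    then have "x + int n \<in> (\<lambda>m. m + int n) ` M" using M(2) by simp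
    then show "x \<in> M" by auto
  next
    assume "x \<in> M"
    then have "x + int n \<in> (\<lambda>m. m + int n) ` M" by blast
    then show "x + int n \<in> M" using M(2) by simp
  qed
  have per: "(x + int n * k \<in> M) = (x \<in> M)" for x k
    using invariant_mult[of "\<lambda>x. x \<in> M" n x k] step by simp
  define M0 where "M0 = M \<inter> {1..int n}"
  have fin: "finite M0" by (simp add: M0_def)
  have rep: "\<exists>k. x + int n * k \<in> M0" if "x \<in> M" for x
    using window_rep[OF n, of x] per that by (auto simp: M0_def)
  then have "M0 \<noteq> {}" using M(1) by blast
  define xs where "xs = sorted_list_of_set M0"
  define r where "r = length xs"
  have xs: "set xs = M0" "sorted_wrt (<) xs" using fin by (simp_all add: xs_def)
  have r: "r \<ge> 1" using \<open>M0 \<noteq> {}\<close> xs(1) by (cases xs) (auto simp: r_def)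
  \<comment> \<open>The elements in one window are repeated: \<open>r\<close> steps of the index are
    one translation by \<open>n\<close>.\<close>
  define m where "m i = xs ! nat (i mod int r) + int n * (i div int r)" for i
  have idx: "nat (i mod int r) < length xs" for i
  proof -
    have "0 \<le> i mod int r" "i mod int r < int r" using r by simp_all
    then show ?thesis unfolding r_def[symmetric] by linarith
  qed
  have xs_in: "xs ! nat (i mod int r) \<in> M0" for i using idx xs(1) nth_mem by blast
  have "m i < m j" if "i < j" for i j
  proof (cases "i div int r = j div int r")
    case True
    have "i mod int r < j mod int r"
      unfolding minus_mult_div_eq_mod[symmetric] using that True by simp
    moreover have "0 \<le> i mod int r" using r by simp
    ultimately have "nat (i mod int r) < nat (j mod int r)" by (simp only: nat_less_eq_zless)
    then have "xs ! nat (i mod int r) < xs ! nat (j mod int r)"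
      using sorted_wrt_nth_less[OF xs(2)] idx by blast
    then show ?thesis using True by (simp add: m_def)
  next
    case False
    have "i div int r \<le> j div int r" using that r by (intro zdiv_mono1) auto
    then have "i div int r + 1 \<le> j div int r" using False by simp
    then have "int n * (i div int r + 1) \<le> int n * (j div int r)" by (intro mult_left_mono) auto
    moreover have "xs ! nat (i mod int r) \<le> int n" "1 \<le> xs ! nat (j mod int r)"
      using xs_in[of i] xs_in[of j] by (auto simp: M0_def)
    ultimately show ?thesis by (simp add: m_def distrib_left)
  qed
  then have "strict_mono m" by (rule strict_monoI)
  moreover have "range m = M"
  proof (intro equalityI subsetI)
    fix x assume "x \<in> range m"
    then obtain i where "x = m i" by blast
    then show "x \<in> M" using xs_in[of i] per by (simp add: m_def M0_def)
  next
    fix x assume "x \<in> M"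
    then obtain k where "x + int n * k \<in> M0" using rep by blast
    then obtain a where a: "a < length xs" "xs ! a = x + int n * k" using xs(1) by (metis in_set_conv_nth)
    have "(int a + (- k) * int r) div int r = - k + int a div int r"
      "(int a + (- k) * int r) mod int r = int a mod int r"
      using r by (simp_all only: div_mult_self1 mod_mult_self1)
    moreover have "int a div int r = 0" "int a mod int r = int a" using a(1) by (simp_all add: r_def)
    ultimately have "m (int a + (- k) * int r) = x" using a(2) by (simp add: m_def)
    then show "x \<in> range m" by (metis rangeI)
  qed
  moreover have "m (j + int r) = m j + int n" for j
    using r by (simp add: m_def distrib_left)
  ultimately show ?thesis using r by blast
qed

locale skyline =
  fixes n r :: nat and v m :: "int \<Rightarrow> int"
  assumes n_pos: "n \<ge> 1" and v_perm: "v \<in> affine_perms n"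
    and m_mono: "strict_mono m" and m_ltr: "range m \<subseteq> ltr_maxima v"
    and r_pos: "r \<ge> 1" and m_period: "m (j + int r) = m j + int n"
begin

definition P :: "int \<Rightarrow> int" where "P i = inv v (m i)"

lemma v_inv [simp]: "v (inv v x) = x" "inv v (v x) = x"
  using affine_perm_bij[OF v_perm] by (simp_all add: bij_is_surj surj_f_inv_f bij_is_inj)

lemma P_mono: "strict_mono P"
proof (rule strict_monoI)
  fix i j :: int assume "i < j"
  then have "m i < m j" using m_mono by (simp add: strict_mono_less)
  then show "P i < P j"
    unfolding P_def using m_ltr by (intro ltr_maxima_inv_less affine_perm_bij[OF v_perm]) auto
qed

lemma P_less: "P i < P j \<longleftrightarrow> i < j" and P_le: "P i \<le> P j \<longleftrightarrow> i \<le> j"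
  using P_mono by (simp_all add: strict_mono_less strict_mono_less_eq)

lemma m_mult: "m (j + int r * k) = m j + int n * k"
proof (induction k rule: int_induct[where k = 0])
  case (step1 k)
  then show ?case using m_period[of "j + int r * k"] by (simp add: algebra_simps)
next
  case (step2 k)
  then show ?case using m_period[of "j + int r * (k - 1)"] by (simp add: algebra_simps)
qed simp

lemma P_mult: "P (j + int r * k) = P j + int n * k"
  by (simp add: P_def m_mult affine_perm_mult[OF affine_perm_inv[OF n_pos v_perm]])

lemma below_m: "x < P i \<Longrightarrow> v x < m i"
  using m_ltr by (auto simp: P_def ltr_maxima_def)

lemma block: "\<exists>i. P i < x \<and> x \<le> P (i + 1)"
  using interval_index[OF P_mono, of "x - 1"] by force

lemma block_unique:
  assumes "P i < x" "x \<le> P (i + 1)" "P j < x" "x \<le> P (j + 1)"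
  shows "i = j"
  using assms interval_index_unique[OF P_mono, of i "x - 1" j] by simp

text \<open>\<open>w\<close> arises from \<open>v\<close> by replacing each factor \<open>z\<^sub>i m\<^sub>i\<^sub>+\<^sub>1\<close>, at the positions \<open>P i + 1, \<dots>, P (i + 1)\<close>, by
  \<open>m\<^sub>i\<^sub>+\<^sub>1 x\<^sub>i\<close> with \<open>x\<^sub>i\<close> stack-sorted to \<open>z\<^sub>i\<close>.\<close>

definition blockwise :: "(int \<Rightarrow> int) \<Rightarrow> bool" where
  "blockwise w \<longleftrightarrow> (\<forall>i. w (P i + 1) = m (i + 1) \<and>
     sorts (map w [P i + 2..P (i + 1)]) (map v [P i + 1..P (i + 1) - 1]))"

end

text \<open>An entry \<open>w i\<close> that precedes \<open>w p\<close> in \<open>v\<close> has a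
  smaller postorder number. Either \<open>i < p\<close>, where \<open>w p\<close> is a left-to-right
  maximum of \<open>w\<close>, or \<open>i\<close> lies in the right subtree of \<open>p\<close>;
  both times \<open>w i < w p\<close>.\<close>

lemma ltr_maxima_in_Sky:
  assumes n: "n \<ge> 1" and v: "v \<in> affine_perms n" and w: "w \<in> affine_perms n"
    and P: "postorder w (inv v \<circ> w)"
  shows "ltr_maxima w \<in> Sky n v"
proof -
  have bw: "bij w" and bv: "bij v" using v w affine_perm_bij by blast+
  have rec: "m \<in> ltr_maxima w \<longleftrightarrow> (\<exists>p. m = w p \<and> (\<forall>i<p. w i < w p))" for m
    using ltr_maxima_iff[OF bw] bij_is_surj[OF bw] by (metis surjD)
  obtain K where K: "\<And>i. \<bar>w i - i\<bar> \<le> K" using affine_perm_bounded[OF n w] by blast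
  \<comment> \<open>Left of this window \<open>w i \<le> i + K < w 0\<close>, so the maximum over it
    dominates everything up to position 0.\<close>
  define A where "A = {w 0 - K..0}"
  have A: "finite A" "0 \<in> A" using K[of 0] by (auto simp: A_def)
  then have "Max (w ` A) \<in> w ` A" by (intro Max_in) auto
  then obtain p where p: "p \<in> A" "w p = Max (w ` A)" by force
  have "w i < w p" if "i < p" for i
  proof -
    have "w i \<le> w p"
    proof (cases "i \<in> A")
      case True then show ?thesis using A by (simp add: p(2))
    next
      case False
      then have "i < w 0 - K" using that p(1) by (auto simp: A_def)
      then have "w i \<le> w 0" using K[of i] by linarith
      also have "w 0 \<le> w p" using A by (simp add: p(2))
      finally show ?thesis .
    qed
    moreover have "w i \<noteq> w p" using that bw by (simp add: bij_is_inj inj_eq)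
    ultimately show ?thesis by simp
  qed
  then have "ltr_maxima w \<noteq> {}" using rec by blast
  moreover have "ltr_maxima w \<subseteq> ltr_maxima v"
  proof
    fix m assume "m \<in> ltr_maxima w"
    then obtain p where p: "m = w p" "\<forall>i<p. w i < w p" using rec by blast
    show "m \<in> ltr_maxima v"
      unfolding ltr_maxima_def
    proof (intro CollectI allI impI)
      fix x assume x: "x < inv v m"
      obtain i where i: "w i = v x" using bij_is_surj[OF bw] by (metis surjD)
      have ui: "inv v (w i) = x" using i bv by (simp add: bij_is_inj)
      have "w i < w p"
      proof (cases "i < p")
        case False
        have "i \<noteq> p" using ui x p(1) by auto
        then have pi: "p < i" using False by simp
        then have "inv v (w p) < inv v (w i) \<longleftrightarrow> (\<exists>k. p < k \<and> k \<le> i \<and> w p < w k)"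
          using P by (simp add: postorder_def)
        then have "\<not> w p < w i" using pi ui x p(1) by auto
        moreover have "w i \<noteq> w p" using \<open>i \<noteq> p\<close> bw by (simp add: bij_is_inj inj_eq)
        ultimately show ?thesis by simp
      qed (use p(2) in simp)
      then show "v x < m" using i p(1) by simp
    qed
  qed
  moreover have "(\<lambda>m. m + int n) ` ltr_maxima w = ltr_maxima w"
  proof (intro equalityI subsetI)
    fix m assume "m \<in> (\<lambda>m. m + int n) ` ltr_maxima w"
    then obtain l where l: "m = l + int n" "l \<in> ltr_maxima w" by blast
    then obtain p where p: "m = w p + int n" "\<forall>i<p. w i < w p" using rec[of l] by blast
    have "w i < w (p + int n)" if "i < p + int n" for i
      using p(2)[rule_format, of "i - int n"] that affine_perm_shift[OF w, of "i - int n"]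
        affine_perm_shift[OF w, of p] by simp
    then show "m \<in> ltr_maxima w"
      unfolding rec using p(1) affine_perm_shift[OF w, of p] by metis
  next
    fix m assume "m \<in> ltr_maxima w"
    then obtain p where p: "m = w p" "\<forall>i<p. w i < w p" using rec by blast
    have "w i < w (p - int n)" if "i < p - int n" for i
      using p(2)[rule_format, of "i + int n"] that affine_perm_shift[OF w, of "p - int n"]
        affine_perm_shift[OF w, of i] by simp
    then have "w (p - int n) \<in> ltr_maxima w" unfolding rec by blast
    moreover have "m = w (p - int n) + int n" using p(1) affine_perm_shift[OF w, of "p - int n"] by simp
    ultimately show "m \<in> (\<lambda>m. m + int n) ` ltr_maxima w" by blast
  qed
  ultimately show ?thesis by (simp add: Sky_def)
qed

text \<open>The image of a half-line determines the offset, because the sum over a period is normalized.\<close>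

lemma half_line_image:
  assumes n: "n \<ge> 1" and u: "u \<in> affine_perms n" and h: "\<And>x. x < a \<longleftrightarrow> u x < b"
  shows "a = b"
proof -
  have bu: "bij u" using u by (rule affine_perm_bij)
  have g: "(\<Sum>i = 1..int n. u (i + (a - int n - 1)) - (i + (a - int n - 1))) = (\<Sum>i = 1..int n. u i - i)"
    by (rule sum_periodic_reindex[where g = "\<lambda>i. u i - i", OF n])
       (simp_all add: affine_perm_shift[OF u] inj_def)
  have sh: "(\<Sum>i = 1..int n. f (i + (c - int n - 1))) = (\<Sum>x\<in>{c - int n..<c}. f x)" for f :: "int \<Rightarrow> int" and c
    by (rule sum.reindex_bij_witness[of _ "\<lambda>x. x - (c - int n - 1)" "\<lambda>i. i + (c - int n - 1)"]) auto
  have "u ` {a - int n..<a} = {b - int n..<b}"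
  proof (intro equalityI subsetI)
    fix y assume "y \<in> u ` {a - int n..<a}"
    then obtain x where x: "y = u x" "a - int n \<le> x" "x < a" by auto
    then have "u x < b" "\<not> u (x + int n) < b" using h[of x] h[of "x + int n"] by auto
    then show "y \<in> {b - int n..<b}" using x(1) affine_perm_shift[OF u, of x] by simp
  next
    fix y assume y: "y \<in> {b - int n..<b}"
    obtain x where x: "u x = y" using bij_is_surj[OF bu] by (metis surjD)
    have "x < a" "\<not> x + int n < a" using h[of x] h[of "x + int n"] x y affine_perm_shift[OF u, of x] by auto
    then show "y \<in> u ` {a - int n..<a}" using x by force
  qed
  then have "(\<Sum>x\<in>{a - int n..<a}. u x) = (\<Sum>x\<in>{b - int n..<b}. x)"
    using sum.reindex[of u "{a - int n..<a}" "\<lambda>x. x"] bu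
    by (simp add: bij_is_inj inj_on_subset[of u UNIV])
  then have "(\<Sum>x\<in>{a - int n..<a}. u x - x) = (\<Sum>x\<in>{b - int n..<b}. x) - (\<Sum>x\<in>{a - int n..<a}. x)"
    by (simp add: sum_subtractf)
  also have "\<dots> = int n * (b - a)"
    unfolding sh[where f = "\<lambda>x. x", symmetric] by (simp add: sum.distrib sum_subtractf algebra_simps)
  finally have "int n * (b - a) = 0"
    using g sh[where f = "\<lambda>x. u x - x" and c = a] u by (simp add: affine_perms_iff)
  then show ?thesis using n by simp
qed

text \<open>The positions before \<open>p (i + 1)\<close> form its left subtree, whose root
  \<open>p i\<close> is visited last, with number \<open>P i\<close>. So \<open>u\<close> maps this
  half-line onto the numbers up to \<open>P i\<close>, which pins down where
  \<open>m (i + 1)\<close> stands in \<open>w\<close>.\<close>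

lemma (in skyline) postorder_imp_blockwise:
  assumes w: "w \<in> affine_perms n" and post: "postorder w (inv v \<circ> w)" and ltr: "ltr_maxima w = range m"
  shows "blockwise w"
proof -
  define u where "u = inv v \<circ> w"
  have bw: "bij w" using w by (rule affine_perm_bij)
  have wv: "w x = v (u x)" for x by (simp add: u_def)
  have uS: "u \<in> affine_perms n" unfolding u_def by (intro affine_perm_comp affine_perm_inv n_pos v_perm w)
  have inju: "inj u" using affine_perm_bij[OF uS] by (simp add: bij_is_inj)
  have PO: "u i < u j \<longleftrightarrow> (\<exists>k. i < k \<and> k \<le> j \<and> w i < w k)" if "i < j" for i j
    using post that by (simp add: postorder_def u_def)
  define p where "p i = inv w (m i)" for i
  have wp: "w (p i) = m i" for i using bw by (simp add: p_def bij_is_surj surj_f_inv_f)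
  have up: "u (p i) = P i" for i by (simp add: u_def wp P_def)
  have rec: "w x < m i" if "x < p i" for x i
  proof -
    have "m i \<in> ltr_maxima w" using ltr by simp
    then show ?thesis using that unfolding ltr_maxima_def p_def by blast
  qed
  have pless: "p i < p j" if "i < j" for i j
    unfolding p_def using that m_mono ltr
    by (intro ltr_maxima_inv_less[OF bw]) (auto simp: strict_mono_less)
  have p_le: "j \<le> i" if "p j \<le> p i" for i j using pless[of i j] that by (auto simp: not_le[symmetric])
  have half: "x < p (i + 1) \<longleftrightarrow> u x < P i + 1" for x i
  proof -
    consider "x < p i" | "x = p i" | "p i < x" "x < p (i + 1)" | "p (i + 1) \<le> x" by linarith
    then show ?thesis
    proof cases
      case 1
      then have "u x < u (p i)" using PO[OF 1] rec[OF 1] wp by auto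
      moreover have "p i < p (i + 1)" by (rule pless) simp
      ultimately show ?thesis using 1 up by simp
    next
      case 2
      moreover have "p i < p (i + 1)" by (rule pless) simp
      ultimately show ?thesis using up by simp
    next
      case 3
      have "\<not> w (p i) < w k" if k: "p i < k" "k \<le> x" for k
      proof
        assume "w (p i) < w k"
        \<comment> \<open>The first entry after \<open>p i\<close> that exceeds
          \<open>w (p i)\<close> would be a left-to-right maximum strictly between two consecutive
          ones.\<close>
        define S where "S = {k. p i < k \<and> k \<le> x \<and> w (p i) < w k}"
        have S: "finite S" "k \<in> S"
          using k \<open>w (p i) < w k\<close> by (auto simp: S_def intro: finite_subset[of _ "{p i..x}"])
        define l where "l = Min S"
        have l: "l \<in> S" "\<And>y. y \<in> S \<Longrightarrow> l \<le> y" using S by (auto simp: l_def intro: Min_in)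
        have "w y < w l" if "y < l" for y
        proof (cases "y \<le> p i")
          case True
          then have "w y \<le> w (p i)" using rec[of y i] wp by (cases "y = p i") auto
          then show ?thesis using l(1) by (auto simp: S_def)
        next
          case False
          have "y \<notin> S" using l(2)[of y] that by auto
          then have "w y \<le> w (p i)" using False that l(1) by (auto simp: S_def)
          then show ?thesis using l(1) by (auto simp: S_def)
        qed
        then have "w l \<in> ltr_maxima w" using ltr_maxima_iff[OF bw] by blast
        then obtain j where "w l = m j" using ltr by auto
        then have pj: "p j = l" unfolding p_def using bw by (metis bij_is_inj inv_f_f)
        have "p i < p j" "p j < p (i + 1)" using l(1) 3 pj by (auto simp: S_def)
        then have "i \<le> j" "j \<le> i + 1" "j \<noteq> i" "j \<noteq> i + 1" using p_le less_imp_le by blast+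
        then show False by linarith
      qed
      then have "\<not> u (p i) < u x" using PO[OF 3(1)] by blast
      then show ?thesis using up 3 by simp
    next
      case 4
      have "p i < p (i + 1)" by (rule pless) simp
      moreover have "w (p i) < w (p (i + 1))" using wp m_mono by (simp add: strict_mono_less)
      ultimately have "u (p i) < u x" using PO[of "p i" x] 4 by (meson order.strict_trans2)
      then show ?thesis using up 4 by simp
    qed
  qed
  \<comment> \<open>Order alone would give this up to a common shift; the normalization removes the
    shift.\<close>
  have pP: "p (i + 1) = P i + 1" for i
    using half_line_image[OF n_pos uS half] .
  show ?thesis
    unfolding blockwise_def
  proof (intro allI conjI)
    fix i
    show "w (P i + 1) = m (i + 1)" using wp[of "i + 1"] pP by simp
    have le: "x \<le> P i \<longleftrightarrow> u x \<le> P i" for x i using half[of x i] pP by simp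
    have "u (P i + 1) = P (i + 1)" using up[of "i + 1"] pP by simp
    have "u ` {P i + 2..P (i + 1)} = {P i + 1..P (i + 1) - 1}"
    proof (intro equalityI subsetI)
      fix y assume "y \<in> u ` {P i + 2..P (i + 1)}"
      then obtain x where x: "y = u x" "P i + 2 \<le> x" "x \<le> P (i + 1)" by auto
      have "u x \<noteq> P (i + 1)"
        using x(2) injD[OF inju, of x "P i + 1"] \<open>u (P i + 1) = _\<close> by auto
      then show "y \<in> {P i + 1..P (i + 1) - 1}" using x le[of x i] le[of x "i + 1"] by auto
    next
      fix y assume y: "y \<in> {P i + 1..P (i + 1) - 1}"
      obtain x where x: "u x = y" using bij_is_surj[OF affine_perm_bij[OF uS]] by (metis surjD)
      have "x \<noteq> P i + 1" using x y \<open>u (P i + 1) = _\<close> by auto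
      then have "P i + 2 \<le> x" "x \<le> P (i + 1)" using x y le[of x i] le[of x "i + 1"] by auto
      then show "y \<in> u ` {P i + 2..P (i + 1)}" using x by auto
    qed
    moreover have "postorder_on w u (P i + 2) (P (i + 1))"
      using PO by (simp add: postorder_on_def)
    ultimately show "sorts (map w [P i + 2..P (i + 1)]) (map v [P i + 1..P (i + 1) - 1])"
      using inju affine_perm_bij[OF v_perm] wv by (intro postorder_imp_sorts) (auto simp: bij_is_inj)
  qed
qed

text \<open>Each block \<open>{P i + 1..P (i + 1)}\<close> is permuted by \<open>u\<close>, which
  gives bijectivity. Inside a block postorder comes from \<open>sorts\<close>; between blocks it
  holds because the first entry of the later block exceeds everything before it.\<close>

lemma (in skyline) blockwise_imp_postorder:
  assumes B: "blockwise w" and per: "\<And>x. w (x + int n) = w x + int n"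
  shows "w \<in> affine_perms n" "postorder w (inv v \<circ> w)" "ltr_maxima w = range m"
proof -
  define u where "u = inv v \<circ> w"
  have wv: "w x = v (u x)" for x by (simp add: u_def)
  have injv: "inj v" using affine_perm_bij[OF v_perm] by (simp add: bij_is_inj)
  have top: "w (P i + 1) = m (i + 1)" for i using B by (simp add: blockwise_def)
  have utop: "u (P i + 1) = P (i + 1)" for i by (simp add: u_def top) (simp add: P_def)
  have "sorts (map w [P i + 2..P (i + 1)]) (map v [P i + 1..P (i + 1) - 1])" for i
    using B by (simp add: blockwise_def)
  then have "u ` {P i + 2..P (i + 1)} = {P i + 1..P (i + 1) - 1} \<and>
      postorder_on w u (P i + 2) (P (i + 1))" for i
    by (rule sorts_imp_postorder[OF injv wv])
  then have bl: "u ` {P i + 2..P (i + 1)} = {P i + 1..P (i + 1) - 1}"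
    and po: "postorder_on w u (P i + 2) (P (i + 1))" for i
    by blast+
  have PP: "P i < P (i + 1)" for i by (simp add: P_less)
  have blk: "u ` {P i + 1..P (i + 1)} = {P i + 1..P (i + 1)}" for i
  proof -
    have "{P i + 1..P (i + 1)} = insert (P i + 1) {P i + 2..P (i + 1)}" using PP[of i] by auto
    then have "u ` {P i + 1..P (i + 1)} = insert (P (i + 1)) {P i + 1..P (i + 1) - 1}"
      by (simp add: bl utop)
    then show ?thesis using PP[of i] by auto
  qed
  have keep: "P i < u x \<and> u x \<le> P (i + 1)" if "P i < x" "x \<le> P (i + 1)" for x i
  proof -
    have "u x \<in> u ` {P i + 1..P (i + 1)}" using that by (intro imageI) simp
    then show ?thesis unfolding blk by simp
  qed
  have half: "u x \<le> P j \<longleftrightarrow> x \<le> P j" for x j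
  proof -
    obtain i where i: "P i < x" "x \<le> P (i + 1)" using block by blast
    have "x \<le> P j \<longleftrightarrow> i < j" if "P i < x" "x \<le> P (i + 1)" for x
    proof
      assume "x \<le> P j"
      then have "P i < P j" using that by simp
      then show "i < j" by (simp add: P_less)
    next
      assume "i < j"
      then have "P (i + 1) \<le> P j" by (simp add: P_le)
      then show "x \<le> P j" using that by simp
    qed
    then show ?thesis using i keep[OF i] by blast
  qed
  have "inj u"
  proof (rule injI)
    fix x y assume xy: "u x = u y"
    obtain i j where i: "P i < x" "x \<le> P (i + 1)" and j: "P j < y" "y \<le> P (j + 1)" using block by meson
    have "i = j" using block_unique[of i "u x" j] keep[OF i] keep[OF j] xy by simp
    moreover have "inj_on u {P i + 1..P (i + 1)}"
      by (rule finite_surj_inj) (simp_all add: blk)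
    ultimately show "x = y" using xy i j by (auto dest: inj_onD)
  qed
  moreover have "surj u"
    unfolding surj_def
  proof
    fix y
    obtain i where "P i < y" "y \<le> P (i + 1)" using block by blast
    then have "y \<in> u ` {P i + 1..P (i + 1)}" unfolding blk by simp
    then show "\<exists>x. y = u x" by blast
  qed
  ultimately have bu: "bij u" by (simp add: bij_def)
  have uper: "u (x + int n) = u x + int n" for x
    by (simp add: u_def per affine_perm_inv_shift[OF v_perm])
  \<comment> \<open>The first \<open>r\<close> blocks make up one period of length \<open>n\<close>.
    As \<open>u\<close> permutes them, its displacements over a period cancel.\<close>
  have Pr: "P (int r) = P 0 + int n" using P_mult[of 0 1] by simp
  have sh: "(\<Sum>i = 1..int n. f (i + P 0)) = (\<Sum>x\<in>{P 0 + 1..P (int r)}. f x)" for f :: "int \<Rightarrow> int"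
    unfolding Pr by (rule sum.reindex_bij_witness[of _ "\<lambda>x. x - P 0" "\<lambda>i. i + P 0"]) auto
  have "u ` {P 0 + 1..P (int r)} \<subseteq> {P 0 + 1..P (int r)}"
    using half[of _ 0] half[of _ "int r"] by (auto simp: add1_zle_eq not_le[symmetric])
  then have "bij_betw u {P 0 + 1..P (int r)} {P 0 + 1..P (int r)}"
    using \<open>inj u\<close> by (intro bij_betw_imageI endo_inj_surj) (auto intro: inj_on_subset)
  then have "(\<Sum>x\<in>{P 0 + 1..P (int r)}. u x) = (\<Sum>x\<in>{P 0 + 1..P (int r)}. x)"
    using sum.reindex_bij_betw[of u _ _ "\<lambda>x. x"] by simp
  then have "(\<Sum>i = 1..int n. u (i + P 0) - (i + P 0)) = 0"
    unfolding sh[where f = "\<lambda>x. u x - x"] by (simp add: sum_subtractf)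
  moreover have "(\<Sum>i = 1..int n. u (i + P 0) - (i + P 0)) = (\<Sum>i = 1..int n. u i - i)"
    by (rule sum_periodic_reindex[where g = "\<lambda>i. u i - i", OF n_pos]) (simp_all add: uper inj_def)
  ultimately have "u \<in> affine_perms n" using bu uper by (simp add: affine_perms_iff)
  then have "v \<circ> u \<in> affine_perms n" by (rule affine_perm_comp[OF n_pos v_perm])
  moreover have "v \<circ> u = w" using wv by auto
  ultimately show w: "w \<in> affine_perms n" by simp
  then have bw: "bij w" by (rule affine_perm_bij)
  \<comment> \<open>Only \<open>P i + 1\<close> is sent to \<open>P (i + 1)\<close>; every other
    \<open>x\<close> up to there lands strictly before, where \<open>v\<close> stays below its
    left-to-right maximum \<open>m (i + 1)\<close>.\<close>
  have small: "w x < m (i + 1)" if "x \<le> P (i + 1)" "x \<noteq> P i + 1" for x i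
  proof -
    have "u x \<noteq> P (i + 1)" using that(2) utop[of i] \<open>inj u\<close> by (metis injD)
    then have "u x < P (i + 1)" using half[of x "i + 1"] that(1) by simp
    then show ?thesis unfolding wv by (rule below_m)
  qed
  show "postorder w (inv v \<circ> w)"
    unfolding postorder_def u_def[symmetric]
  proof (intro allI impI)
    fix x y :: int assume xy: "x < y"
    obtain i j where i: "P i < x" "x \<le> P (i + 1)" and j: "P j < y" "y \<le> P (j + 1)" using block by meson
    have "P i < P (j + 1)" using i j xy by linarith
    then have "i \<le> j" by (simp add: P_less)
    then consider "i < j" | "i = j" "x = P i + 1" | "i = j" "P i + 2 \<le> x" using i(1) by fastforce
    then show "u x < u y \<longleftrightarrow> (\<exists>k. x < k \<and> k \<le> y \<and> w x < w k)"
    proof cases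
      case 1
      then have le: "P (i + 1) \<le> P j" by (simp add: P_le)
      then have "u x < u y" using keep[OF i] keep[OF j] by linarith
      moreover have "w x < w (P j + 1)"
        unfolding top using le i PP[of j] by (intro small) auto
      moreover have "x < P j + 1" "P j + 1 \<le> y" using le i j by auto
      ultimately show ?thesis by blast
    next
      case 2
      have "\<not> u x < u y" using keep[OF j] utop[of i] 2 by simp
      moreover have "\<not> w x < w k" if "x < k" "k \<le> y" for k
        using small[of k i] that 2 j top[of i] by auto
      ultimately show ?thesis by blast
    next
      case 3
      then show ?thesis using po[of i] xy j unfolding postorder_on_def by blast
    qed
  qed
  show "ltr_maxima w = range m"
  proof (intro equalityI subsetI)
    fix y assume y: "y \<in> ltr_maxima w"
    obtain x where x: "w x = y" using bij_is_surj[OF bw] by (metis surjD)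
    obtain i where i: "P i < x" "x \<le> P (i + 1)" using block by blast
    have "x = P i + 1"
    proof (rule ccontr)
      assume "x \<noteq> P i + 1"
      then have "w x < w (P i + 1)" "P i + 1 < x" using small[OF i(2)] top i(1) by auto
      moreover have "w (P i + 1) < w x"
        using ltr_maxima_iff[OF bw, of x] y x \<open>P i + 1 < x\<close> by blast
      ultimately show False by simp
    qed
    then show "y \<in> range m" using top x by auto
  next
    fix y assume "y \<in> range m"
    then obtain i where "y = m ((i - 1) + 1)" by auto
    then have y: "y = w (P (i - 1) + 1)" using top by metis
    have "w x < w (P (i - 1) + 1)" if "x < P (i - 1) + 1" for x
      unfolding top using that PP[of "i - 1"] by (intro small) auto
    then show "y \<in> ltr_maxima w" unfolding y ltr_maxima_iff[OF bw] by blast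
  qed
qed

lemma upto_shift: "[a + t..b + t] = map (\<lambda>x. x + t) [a..b]" for a b t :: int
  by (rule nth_equalityI) (simp_all add: nth_upto)

section \<open>Independent choice of the words in one period\<close>

context skyline
begin

definition word :: "nat \<Rightarrow> int list" where
  "word i = map v [P (int i) + 1..P (int i + 1) - 1]"

definition blockwise_perms :: "(int \<Rightarrow> int) set" where
  "blockwise_perms = {w. blockwise w \<and> (\<forall>x. w (x + int n) = w x + int n)}"

lemma blockwise_perms_eq:
  "blockwise_perms = {w \<in> affine_perms n. postorder w (inv v \<circ> w) \<and> ltr_maxima w = range m}"
proof (intro equalityI subsetI)
  fix w assume "w \<in> blockwise_perms"
  then show "w \<in> {w \<in> affine_perms n. postorder w (inv v \<circ> w) \<and> ltr_maxima w = range m}"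
    using blockwise_imp_postorder[of w] by (simp add: blockwise_perms_def)
next
  fix w assume "w \<in> {w \<in> affine_perms n. postorder w (inv v \<circ> w) \<and> ltr_maxima w = range m}"
  then show "w \<in> blockwise_perms"
    using postorder_imp_blockwise[of w] affine_perm_shift[of w n] by (simp add: blockwise_perms_def)
qed

definition block_words :: "(int \<Rightarrow> int) \<Rightarrow> nat \<Rightarrow> int list" where
  "block_words w = (\<lambda>i\<in>{1..r}. map w [P (int i) + 2..P (int i + 1)])"

lemma block_words_inj: "inj_on block_words blockwise_perms"
proof (rule inj_onI)
  fix w w' assume w: "w \<in> blockwise_perms" "w' \<in> blockwise_perms" and eq: "block_words w = block_words w'"
  show "w = w'"
  proof
    fix x
    obtain i where i: "P i < x" "x \<le> P (i + 1)" using block by blast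
    obtain k where k: "1 \<le> i + int r * k" "i + int r * k \<le> int r" using window_rep[OF r_pos] by blast
    define j where "j = nat (i + int r * k)"
    have j: "int j = i + int r * k" "j \<in> {1..r}" using k by (auto simp: j_def)
    define y where "y = x + int n * k"
    have Pj: "P (int j) = P i + int n * k" "P (int j + 1) = P (i + 1) + int n * k"
      using P_mult[of i k] P_mult[of "i + 1" k] by (simp_all add: j(1) add_ac)
    have "map w [P (int j) + 2..P (int j + 1)] = map w' [P (int j) + 2..P (int j + 1)]"
      using fun_cong[OF eq, of j] j(2) by (simp add: block_words_def)
    then have "w y = w' y" if "y \<noteq> P (int j) + 1"
      using i that Pj by (simp add: y_def)
    moreover have "w (P (int j) + 1) = w' (P (int j) + 1)"
      using w by (simp add: blockwise_perms_def blockwise_def)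
    ultimately have "w y = w' y" by metis
    then show "w x = w' x"
      using periodic_mult[of w n x k] periodic_mult[of w' n x k] w by (simp add: y_def blockwise_perms_def)
  qed
qed

text \<open>Block \<open>i\<close> reuses the word of its representative \<open>h i\<close> in
  \<open>{1..r}\<close>. That block lies \<open>c i\<close> periods further, so its values are
  translated back by \<open>int n * c i\<close>.\<close>

lemma block_words_surj:
  assumes X: "X \<in> (\<Pi>\<^sub>E i\<in>{1..r}. {x. sorts x (word i)})"
  shows "X \<in> block_words ` blockwise_perms"
proof -
  obtain blk where blk: "\<And>x. P (blk x) < x" "\<And>x. x \<le> P (blk x + 1)" using block by metis
  obtain c where c: "\<And>i. 1 \<le> i + int r * c i" "\<And>i. i + int r * c i \<le> int r"
    using window_rep[OF r_pos] by metis
  define h where "h i = nat (i + int r * c i)" for i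
  have h: "int (h i) = i + int r * c i" "h i \<in> {1..r}" for i
    using c[of i] by (auto simp: h_def)
  have c_eq: "c i = k" if "1 \<le> i + int r * k" "i + int r * k \<le> int r" for i k
  proof -
    have "i + int r * c i - (i + int r * k) = int r * (c i - k)" by (simp add: algebra_simps)
    then have "int r dvd i + int r * c i - (i + int r * k)" by simp
    then have "i + int r * c i = i + int r * k" using window_unique[OF c(1,2) that] by blast
    then show ?thesis using r_pos by simp
  qed
  have c_shift: "c (i + int r) = c i - 1" for i
    using c[of i] by (intro c_eq) (simp_all add: algebra_simps)
  have h_shift: "h (i + int r) = h i" for i
    unfolding h_def c_shift by (simp add: algebra_simps)
  define Y where "Y i = map (\<lambda>y. y - int n * c i) (X (h i))" for i
  have Y_sorts: "sorts (Y i) (map v [P i + 1..P (i + 1) - 1])" for i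
  proof -
    have "sorts (X (h i)) (word (h i))" using X h(2)[of i] by (auto simp: PiE_iff)
    then have "sorts (Y i) (map (\<lambda>y. y - int n * c i) (word (h i)))"
      unfolding Y_def by (intro sorts_map) (auto intro: strict_monoI)
    moreover have "P (int (h i)) = P i + int n * c i" "P (int (h i) + 1) = P (i + 1) + int n * c i"
      using P_mult[of i "c i"] P_mult[of "i + 1" "c i"] by (simp_all add: h(1) add_ac)
    then have "word (h i) = map v [P i + 1 + int n * c i..P (i + 1) - 1 + int n * c i]"
      by (simp add: word_def algebra_simps)
    then have "map (\<lambda>y. y - int n * c i) (word (h i)) = map v [P i + 1..P (i + 1) - 1]"
      unfolding upto_shift by (simp add: affine_perm_mult[OF v_perm])
    ultimately show ?thesis by simp
  qed
  have Y_shift: "Y (i + int r) = map (\<lambda>y. y + int n) (Y i)" for i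
    by (simp add: Y_def c_shift h_shift algebra_simps)
  have Y_len: "length (Y i) = nat (P (i + 1) - P i - 1)" for i
    using sorts_length[OF Y_sorts[of i]] by simp
  \<comment> \<open>Index 0 is the position \<open>P (blk x) + 1\<close>, which receives the
    maximum; the word of the block follows.\<close>
  define w where "w x = (m (blk x + 1) # Y (blk x)) ! nat (x - P (blk x) - 1)" for x
  have w: "w x = (m (i + 1) # Y i) ! nat (x - P i - 1)" if "P i < x" "x \<le> P (i + 1)" for x i
    using block_unique[OF blk that] by (simp add: w_def)
  have lt: "P i < P (i + 1)" for i by (simp add: P_less)
  have inner: "map w [P i + 2..P (i + 1)] = Y i" for i
  proof (rule nth_equalityI)
    show len: "length (map w [P i + 2..P (i + 1)]) = length (Y i)"
      by (simp add: Y_len)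
    fix j assume "j < length (map w [P i + 2..P (i + 1)])"
    then have j: "P i + 2 + int j \<le> P (i + 1)" by simp
    then have "map w [P i + 2..P (i + 1)] ! j = w (P i + 2 + int j)" by (simp add: nth_upto)
    also have "\<dots> = (m (i + 1) # Y i) ! nat (P i + 2 + int j - P i - 1)"
      using j by (intro w) auto
    also have "nat (P i + 2 + int j - P i - 1) = Suc j" by simp
    finally show "map w [P i + 2..P (i + 1)] ! j = Y i ! j" by simp
  qed
  have "blockwise w"
    unfolding blockwise_def inner
  proof (intro allI conjI Y_sorts)
    show "w (P i + 1) = m (i + 1)" for i using w[of i "P i + 1"] lt[of i] by simp
  qed
  moreover have "w (x + int n) = w x + int n" for x
  proof -
    define i where "i = blk x"
    have i: "P i < x" "x \<le> P (i + 1)" using blk by (simp_all add: i_def)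
    have Pr: "P (j + int r) = P j + int n" for j using P_mult[of j 1] by simp
    have "w (x + int n) = (m (i + int r + 1) # Y (i + int r)) ! nat (x + int n - P (i + int r) - 1)"
      using i Pr[of i] Pr[of "i + 1"] by (intro w) (simp_all add: add_ac)
    also have "m (i + int r + 1) = m (i + 1) + int n"
      using m_period[of "i + 1"] by (simp add: add_ac)
    also have "(m (i + 1) + int n) # Y (i + int r) = map (\<lambda>y. y + int n) (m (i + 1) # Y i)"
      by (simp add: Y_shift)
    also have "nat (x + int n - P (i + int r) - 1) = nat (x - P i - 1)" by (simp add: Pr)
    also have "map (\<lambda>y. y + int n) (m (i + 1) # Y i) ! nat (x - P i - 1)
        = (m (i + 1) # Y i) ! nat (x - P i - 1) + int n"
      using i by (intro nth_map) (auto simp: Y_len)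
    also have "(m (i + 1) # Y i) ! nat (x - P i - 1) = w x" using w[OF i] by simp
    finally show ?thesis .
  qed
  ultimately have "w \<in> blockwise_perms" by (simp add: blockwise_perms_def)
  moreover have "block_words w = X"
  proof
    fix i
    show "block_words w i = X i"
    proof (cases "i \<in> {1..r}")
      case True
      then have "c (int i) = 0" by (intro c_eq) auto
      then have "Y (int i) = X i" by (simp add: Y_def h_def)
      then show ?thesis using True inner[of "int i"] by (simp add: block_words_def)
    next
      case False
      then show ?thesis using X by (auto simp: block_words_def PiE_iff extensional_def)
    qed
  qed
  ultimately show ?thesis by blast
qed

lemma bij_betw_block_words:
  "bij_betw block_words blockwise_perms (\<Pi>\<^sub>E i\<in>{1..r}. {x. sorts x (word i)})"
proof (rule bij_betw_imageI[OF block_words_inj])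
  show "block_words ` blockwise_perms = (\<Pi>\<^sub>E i\<in>{1..r}. {x. sorts x (word i)})"
  proof (intro equalityI subsetI)
    fix X assume "X \<in> block_words ` blockwise_perms"
    then obtain w where "blockwise w" "X = block_words w" by (auto simp: blockwise_perms_def)
    then show "X \<in> (\<Pi>\<^sub>E i\<in>{1..r}. {x. sorts x (word i)})"
      by (simp add: block_words_def blockwise_def word_def)
  qed (rule block_words_surj)
qed

lemma finite_blockwise_perms: "finite blockwise_perms"
  using bij_betw_finite[OF bij_betw_block_words] by (simp add: finite_PiE)

lemma card_blockwise_perms: "card blockwise_perms = (\<Prod>i\<in>{1..r}. card {x. sorts x (word i)})"
  using bij_betw_same_card[OF bij_betw_block_words] by (simp add: card_PiE)

text \<open>Two increasing enumerations of the same set differ by a shift of the index, and the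
  condition at position 1 fixes the shift.\<close>

lemma sky_enum_eq:
  assumes "P 1 \<le> 1" "1 < P 2"
  shows "sky_enum v (range m) = m"
  unfolding sky_enum_def
proof (rule the_equality)
  show "strict_mono m \<and> range m = range m \<and> inv v (m 1) \<le> 1 \<and> 1 < inv v (m 2)"
    using assms m_mono by (simp add: P_def)
  fix m' :: "int \<Rightarrow> int"
  assume m': "strict_mono m' \<and> range m' = range m \<and> inv v (m' 1) \<le> 1 \<and> 1 < inv v (m' 2)"
  define f where "f = inv m \<circ> m'"
  have injm: "inj m" using m_mono by (rule strict_mono_imp_inj_on)
  have mf: "m (f i) = m' i" for i
  proof -
    have "m' i \<in> range m" using m' by auto
    then show ?thesis by (simp add: f_def f_inv_into_f)
  qed
  have "f i < f j" if "i < j" for i j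
  proof -
    have "m (f i) < m (f j)" using that m' by (simp add: mf strict_mono_less)
    then show ?thesis using m_mono by (simp add: strict_mono_less)
  qed
  then have sm: "strict_mono f" by (rule strict_monoI)
  have su: "surj f"
    unfolding surj_def
  proof
    fix y
    have "m y \<in> range m'" using m' by auto
    then obtain x where "m y = m' x" by blast
    then have "m y = m (f x)" by (simp add: mf)
    then have "y = f x" by (rule injD[OF injm])
    then show "\<exists>x. y = f x" by blast
  qed
  note sh = strict_mono_surj_shift[OF sm su]
  have e: "m (f 0 + 1) = m' 1" "m (f 0 + 1 + 1) = m' 2"
    using mf[of 1] mf[of 2] sh[of 1] sh[of 2] by (simp_all add: add.commute)
  have "P (f 0 + 1) \<le> 1" "1 < P (f 0 + 1 + 1)"
    unfolding P_def e using m' by blast+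
  then have "f 0 + 1 = 1"
    using interval_index_unique[OF P_mono, of "f 0 + 1" 1 1] assms by simp
  then have "f i = i" for i using sh[of i] by simp
  then show "m' = m" using mf by (intro ext) metis
qed

lemma sky_period_eq:
  assumes "P 1 \<le> 1" "1 < P 2"
  shows "sky_period n v (range m) = r"
  unfolding sky_period_def sky_enum_eq[OF assms]
proof (rule the_equality)
  show "0 < r \<and> (\<forall>j. m (j + int r) = m j + int n)" using r_pos m_period by simp
  fix r' assume "0 < r' \<and> (\<forall>j. m (j + int r') = m j + int n)"
  then have "m (0 + int r') = m (0 + int r)" using m_period by metis
  then show "r' = r" using strict_mono_eq[OF m_mono] by simp
qed

lemma sky_word_eq:
  assumes "P 1 \<le> 1" "1 < P 2"
  shows "sky_word v (range m) i = word i"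
  unfolding sky_word_def sky_enum_eq[OF assms] word_def P_def ..

end

lemma ex_skyline:
  assumes n: "n \<ge> 1" and v: "v \<in> affine_perms n" and M: "M \<in> Sky n v"
  shows "\<exists>m r. skyline n r v m \<and> range m = M \<and> inv v (m 1) \<le> 1 \<and> 1 < inv v (m 2)"
proof -
  obtain m r where m: "r \<ge> 1" "strict_mono m" "range m = M" "\<And>j. m (j + int r) = m j + int n"
    using periodic_set_enum[OF n, of M] M by (auto simp: Sky_def)
  interpret skyline n r v m
    by standard (use n v m M in \<open>auto simp: Sky_def\<close>)
  obtain i where i: "P i \<le> 1" "1 < P (i + 1)" using interval_index[OF P_mono] by blast
  \<comment> \<open>Index \<open>i\<close>, the last with a position at most 1, becomes index
    1.\<close>
  define m' where "m' j = m (j + (i - 1))" for j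
  have mono: "strict_mono m'"
    using m(2) by (intro strict_monoI) (simp add: m'_def strict_mono_less)
  have range: "range m' = M"
  proof -
    have "m y = m' (y - (i - 1))" for y by (simp add: m'_def)
    then have "range m \<subseteq> range m'" by blast
    moreover have "range m' \<subseteq> range m" by (auto simp: m'_def)
    ultimately show ?thesis using m(3) by simp
  qed
  have "m' (j + int r) = m' j + int n" for j
    using m(4)[of "j + (i - 1)"] by (simp add: m'_def algebra_simps)
  then have "skyline n r v m'"
    by unfold_locales (use n v m(1) mono range M in \<open>auto simp: Sky_def\<close>)
  moreover have "inv v (m' 1) \<le> 1" "1 < inv v (m' 2)"
    using i by (simp_all add: m'_def P_def add.commute)
  ultimately show ?thesis using range by blast
qed

text \<open>A periodic set is determined by its trace on one window.\<close>

lemma finite_Sky: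
  assumes n: "n \<ge> 1"
  shows "finite (Sky n v)"
proof (rule finite_imageD)
  show "finite ((\<lambda>M. M \<inter> {1..int n}) ` Sky n v)"
    by (rule finite_subset[of _ "Pow {1..int n}"]) auto
  have per: "x + int n * k \<in> M \<longleftrightarrow> x \<in> M" if "M \<in> Sky n v" for M x k
  proof -
    have M: "(\<lambda>m. m + int n) ` M = M" using that by (simp add: Sky_def)
    have "(y + int n \<in> M) = (y \<in> M)" for y
      by (subst (1) M[symmetric]) auto
    then show ?thesis using invariant_mult[of "\<lambda>x. x \<in> M" n x k] by simp
  qed
  show "inj_on (\<lambda>M. M \<inter> {1..int n}) (Sky n v)"
  proof (rule inj_onI, rule set_eqI)
    fix M M' x assume M: "M \<in> Sky n v" "M' \<in> Sky n v" "M \<inter> {1..int n} = M' \<inter> {1..int n}"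
    obtain k where k: "x + int n * k \<in> {1..int n}" using window_rep[OF n, of x] by auto
    then have "x + int n * k \<in> M \<longleftrightarrow> x + int n * k \<in> M'" using M(3) by blast
    then show "x \<in> M \<longleftrightarrow> x \<in> M'" using per M(1,2) by blast
  qed
qed

lemma catalan_prod_concat:
  "catalan_prod (concat (map f [1..<Suc r])) = (\<Prod>i\<in>{1..r}. catalan_prod (f i))"
proof (induction r)
  case (Suc r)
  then show ?case by (simp add: catalan_prod_def mult.commute)
qed (simp add: catalan_prod_def)

lemma distinct_sky_word:
  assumes "v \<in> affine_perms n"
  shows "distinct (sky_word v M i)"
  using inj_on_subset[OF bij_is_inj[OF affine_perm_bij[OF assms]]]
  by (simp add: sky_word_def distinct_map)

definition sky_fiber :: "nat \<Rightarrow> (int \<Rightarrow> int) \<Rightarrow> int set \<Rightarrow> (int \<Rightarrow> int) set" where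
  "sky_fiber n v M = {w \<in> affine_perms n. affine_stack_sort n w = v \<and> ltr_maxima w = M}"

lemma sky_fiber_finite_card:
  assumes n: "n \<ge> 1" and v: "v \<in> affine_perms n" and M: "M \<in> Sky n v"
  shows "finite (sky_fiber n v M)"
    and "card (sky_fiber n v M) = (\<Prod>i\<in>{1..sky_period n v M}. card {x. sorts x (sky_word v M i)})"
proof -
  obtain m r where m: "skyline n r v m" "range m = M" "inv v (m 1) \<le> 1" "1 < inv v (m 2)"
    using ex_skyline[OF n v M] by blast
  interpret skyline n r v m by (rule m(1))
  have norm: "P 1 \<le> 1" "1 < P 2" using m by (simp_all add: P_def)
  have eq: "sky_fiber n v M = blockwise_perms"
    unfolding sky_fiber_def blockwise_perms_eq m(2)
    using affine_stack_sort_eq_iff[OF n v] by blast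
  show "finite (sky_fiber n v M)" unfolding eq by (rule finite_blockwise_perms)
  show "card (sky_fiber n v M) = (\<Prod>i\<in>{1..sky_period n v M}. card {x. sorts x (sky_word v M i)})"
    using card_blockwise_perms sky_period_eq[OF norm] sky_word_eq[OF norm] m(2) by (simp add: eq)
qed

text \<open>Finiteness is asserted along with the equation because \<open>card\<close> and
  \<open>sum\<close> are 0 on infinite sets. The fiber is partitioned by the set of left-to-right
  maxima of \<open>w\<close>; distributing products over sums turns the finite fertilities into a
  sum over choices of hook configurations.\<close>

theorem theorem8p12:
  fixes n :: nat and v :: "int \<Rightarrow> int"
  assumes "n \<ge> 1" and "v \<in> affine_perms n"
  shows "finite {w \<in> affine_perms n. affine_stack_sort n w = v} \<and>
         finite (AVHC n v) \<and>
         card {w \<in> affine_perms n. affine_stack_sort n w = v} =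
           (\<Sum>H \<in> AVHC n v. catalan_prod (affine_q n v H))"
proof -
  let ?F = "{w \<in> affine_perms n. affine_stack_sort n w = v}"
  note v = assms(2)
  have Sky: "finite (Sky n v)" by (rule finite_Sky[OF assms(1)])
  have F: "?F = (\<Union>M\<in>Sky n v. sky_fiber n v M)"
    using ltr_maxima_in_Sky[OF assms] affine_stack_sort_eq_iff[OF assms] by (auto simp: sky_fiber_def)
  have VHC: "finite (VHC (sky_word v M i))" for M i
    by (rule finite_VHC[OF distinct_sky_word[OF v]])
  have PiE: "finite (\<Pi>\<^sub>E i\<in>{1..sky_period n v M}. VHC (sky_word v M i))" for M
    by (intro finite_PiE) (simp_all add: VHC)
  have "finite ?F"
    unfolding F using Sky sky_fiber_finite_card(1)[OF assms] by blast
  moreover have "finite (AVHC n v)"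
    unfolding AVHC_def using Sky PiE by (intro finite_SigmaI)
  moreover have "card ?F = (\<Sum>H\<in>AVHC n v. catalan_prod (affine_q n v H))"
  proof -
    have "card ?F = (\<Sum>M\<in>Sky n v. card (sky_fiber n v M))"
      unfolding F using Sky sky_fiber_finite_card(1)[OF assms]
      by (intro card_UN_disjoint) (auto simp: sky_fiber_def)
    also have "\<dots> = (\<Sum>M\<in>Sky n v. \<Prod>i\<in>{1..sky_period n v M}.
        \<Sum>hs\<in>VHC (sky_word v M i). catalan_prod (q_comp (sky_word v M i) hs))"
      by (intro sum.cong refl)
         (simp add: sky_fiber_finite_card(2)[OF assms] fertility_formula[OF distinct_sky_word[OF v]])
    also have "\<dots> = (\<Sum>M\<in>Sky n v. \<Sum>X\<in>(\<Pi>\<^sub>E i\<in>{1..sky_period n v M}. VHC (sky_word v M i)).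
        \<Prod>i\<in>{1..sky_period n v M}. catalan_prod (q_comp (sky_word v M i) (X i)))"
      by (intro sum.cong refl prod_sum_PiE) (simp_all add: VHC)
    also have "\<dots> = (\<Sum>H\<in>AVHC n v. catalan_prod (affine_q n v H))"
    proof -
      have "(\<Prod>i\<in>{1..sky_period n v M}. catalan_prod (q_comp (sky_word v M i) (X i)))
          = catalan_prod (affine_q n v (M, X))" for M X
        by (simp only: affine_q_def fst_conv snd_conv catalan_prod_concat)
      then show ?thesis
        unfolding AVHC_def using Sky PiE by (simp add: sum.Sigma)
    qed
    finally show ?thesis .
  qed
  ultimately show ?thesis by blast
qed

end
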